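(* The topological entropy of the Lozi map does not, in general, depend continuously on the parameters; that is, the function $(a,b)\mapsto h(\mathcal{L}_{a,b})$ on $\{(a,b)\in\mathbb{R}^2 : b\neq 0\}$ is not continuous. More precisely, there exists some $\epsilon_*>0$ such that for all real $\epsilon_1,\epsilon_2$ with $0<\epsilon_1<\epsilon_*$ and $|\epsilon_2|<\epsilon_*$: (i) $h(\mathcal{L}_{1.4+\epsilon_2,\;0.4+\epsilon_2})=0$; (ii) $h(\mathcal{L}_{1.4+\epsilon_1+\epsilon_2,\;0.4+\epsilon_2})\ge 0.1203$.
   Context: For $a,b\in\mathbb{R}$ with $b\neq 0$, the Lozi map $\mathcal{L}_{a,b}:\mathbb{R}^2\to\mathbb{R}^2$ is the piecewise affine homeomorphism $\mathcal{L}_{a,b}(x,y)=(1-a|x|+by,\;x)$. Topological entropy: let $f:X\to X$ be a continuous map on a compact metric space $(X,d)$. Two distinct points $x,y\in X$ are $(n,\epsilon)$-separated (for a positive integer $n$ and $\epsilon>0$) if there is $m\in\{0,1,\dots,n-1\}$ with $d(f^m(x),f^m(y))>\epsilon$. A set $U\subset X$ is an $(n,\epsilon)$-separated set if every pair of distinct points of $U$ is $(n,\epsilon)$-separated. Let $r(n,\epsilon,f)$ be the maximum cardinality of an $(n,\epsilon)$-separated set in $X$ (finite by compactness), let $h(\epsilon,f)=\limsup_{n\to\infty}\frac{\log r(n,\epsilon,f)}{n}$ (natural logarithm), and define $h(f)=\lim_{\epsilon\to 0,\,\epsilon>0}h(\epsilon,f)$. Since $\mathbb{R}^2$ is not compact,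 $h(\mathcal{L}_{a,b})$ means the topological entropy of the continuous extension of $\mathcal{L}_{a,b}$ to the one-point compactification $\mathbb{R}^2\cup\{\infty\}$ (with $\infty\mapsto\infty$), equipped with any metric inducing its topology. *)

theory Defs
  imports "HOL-Analysis.Analysis"
begin

definition lozi :: "real \<Rightarrow> real \<Rightarrow> real \<times> real \<Rightarrow> real \<times> real" where
  "lozi a b = (\<lambda>(x, y). (1 - a * \<bar>x\<bar> + b * y, x))"

definition separated_set :: "'a metric \<Rightarrow> nat \<Rightarrow> real \<Rightarrow> ('a \<Rightarrow> 'a) \<Rightarrow> 'a set \<Rightarrow> bool" where
  "separated_set X n \<epsilon> f U \<longleftrightarrow>
     U \<subseteq> mspace X \<and>
     (\<forall>x\<in>U. \<forall>y\<in>U. x \<noteq> y \<longrightarrow> (\<exists>m<n. mdist X ((f ^^ m) x) ((f ^^ m) y) > \<epsilon>))"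

text \<open>The maximum is only meaningful when the cardinalities are bounded, as they are for a
  continuous map of a compact metric space when \<open>\<epsilon> > 0\<close>.\<close>

definition max_separated :: "'a metric \<Rightarrow> nat \<Rightarrow> real \<Rightarrow> ('a \<Rightarrow> 'a) \<Rightarrow> nat" where
  "max_separated X n \<epsilon> f = Max {card U | U. separated_set X n \<epsilon> f U}"

definition entropy_at_scale :: "'a metric \<Rightarrow> real \<Rightarrow> ('a \<Rightarrow> 'a) \<Rightarrow> ereal" where
  "entropy_at_scale X \<epsilon> f = limsup (\<lambda>n. ereal (ln (real (max_separated X n \<epsilon> f)) / real n))"

definition topological_entropy :: "'a metric \<Rightarrow> ('a \<Rightarrow> 'a) \<Rightarrow> ereal" where
  "topological_entropy X f = Lim (at_right 0) (\<lambda>\<epsilon>. entropy_at_scale X \<epsilon> f)"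

definition compactified_plane_metrics :: "(real \<times> real) option metric set" where
  "compactified_plane_metrics =
     {X. mtopology_of X = Alexandroff_compactification (euclidean :: (real \<times> real) topology)}"

text \<open>The point at infinity is \<^term>\<open>None\<close>, so \<^term>\<open>map_option (lozi a b)\<close> is the extension of the
  Lozi map that fixes infinity.\<close>

definition lozi_entropy :: "(real \<times> real) option metric \<Rightarrow> real \<Rightarrow> real \<Rightarrow> ereal" where
  "lozi_entropy X a b = topological_entropy X (map_option (lozi a b))"

lemma continuous_map_map_option_lozi:
  assumes "b \<noteq> 0"
  shows "continuous_map (Alexandroff_compactification euclidean)
           (Alexandroff_compactification euclidean) (map_option (lozi a b))"
proof -
  define g where "g = (\<lambda>(u, v). (v, (u - 1 + a * \<bar>v\<bar>) / b))"
  have cl: "continuous_on UNIV (lozi a b)" and cg: "continuous_on UNIV g"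
    unfolding lozi_def g_def case_prod_beta using assms by (auto intro!: continuous_intros)
  have gl: "g (lozi a b p) = p" and lg: "lozi a b (g p) = p" for p
    using assms by (auto simp: lozi_def g_def case_prod_beta)
  have vimage_open: "open (lozi a b -` U)" if "open U" for U
    using cl that by (simp add: open_vimage)
  have "openin (Alexandroff_compactification euclidean) (map_option (lozi a b) -` V)"
    if V: "openin (Alexandroff_compactification euclidean) V" for V
  proof -
    consider U where "open U" "V = Some ` U" | C where "compact C" "V = insert None (Some ` (UNIV - C))"
      using V unfolding openin_Alexandroff_compactification by auto
    then show ?thesis
    proof cases
      case 1
      have "map_option (lozi a b) -` V = Some ` (lozi a b -` U)"
        unfolding 1 by (auto simp: image_iff)
      then show ?thesis using vimage_open[OF 1(1)] by simp
    next
      case 2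
      have "lozi a b -` C = g ` C"
        using gl lg by (auto simp: image_iff) metis
      then have "compact (lozi a b -` C)"
        using 2 cg by (metis compact_continuous_image continuous_on_subset subset_UNIV)
      moreover have "map_option (lozi a b) -` V = insert None (Some ` (- (lozi a b -` C)))"
        unfolding 2 by (auto simp: image_iff)
      ultimately show ?thesis
        by (auto simp: openin_Alexandroff_compactification Compl_eq_Diff_UNIV compact_imp_closed)
    qed
  qed
  then show ?thesis
    by (auto simp: continuous_map_alt simp flip: UNIV_option_conv)
qed

lemma compactified_plane_metrics_nonempty: "compactified_plane_metrics \<noteq> {}"
proof -
  let ?E = "euclidean :: (real \<times> real) topology"
  let ?A = "Alexandroff_compactification ?E"
  define S where "S = sphere (0 :: (real \<times> real) \<times> real) 1"
  define p where "p = ((0 :: real, 0 :: real), 1 :: real)"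
  have p: "p \<in> S"
    by (simp add: p_def S_def norm_Pair)
  have "(S - {p}) homeomorphic (UNIV :: (real \<times> real) set)"
    unfolding S_def by (rule homeomorphic_punctured_sphere_affine) (use p in \<open>auto simp: S_def\<close>)
  then obtain k h where kh: "homeomorphism (S - {p}) UNIV k (h :: real \<times> real \<Rightarrow> _)"
    unfolding homeomorphic_def by blast
  have h: "range h = S - {p}" "continuous_on UNIV h" "\<And>x. k (h x) = x"
    and k: "continuous_on (S - {p}) k" "\<And>y. y \<in> S - {p} \<Longrightarrow> h (k y) = y"
    using kh by (auto simp: homeomorphism_def)
  define \<phi> where "\<phi> = case_option p h"
  have img: "range \<phi> = S"
    using h(1) p by (auto simp: \<phi>_def UNIV_option_conv image_image)
  have inj: "inj \<phi>"
  proof (rule injI)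
    have "h x \<noteq> p" for x
      using h(1) by blast
    then show "x = y" if "\<phi> x = \<phi> y" for x y
      using that h(3) unfolding \<phi>_def by (cases x; cases y; simp) metis+
  qed
  have "openin ?A (\<phi> -` V)" if V: "open V" for V
  proof (cases "p \<in> V")
    case True
    have "compact (S - V)"
      using V by (simp add: S_def compact_diff)
    moreover have "S - V \<subseteq> S - {p}"
      using True by auto
    ultimately have "compact (k ` (S - V))"
      using k(1) by (metis compact_continuous_image continuous_on_subset)
    moreover have "k ` (S - V) = - (h -` V)"
    proof (intro set_eqI iffI)
      fix x assume "x \<in> k ` (S - V)"
      then obtain y where "y \<in> S" "y \<notin> V" "x = k y"
        by blast
      then show "x \<in> - (h -` V)"
        using k(2)[of y] True by (cases "y = p") auto
    next
      fix x assume "x \<in> - (h -` V)"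
      then show "x \<in> k ` (S - V)"
        using h(1,3) by (intro image_eqI[of _ _ "h x"]) auto
    qed
    moreover have "\<phi> -` V = insert None (Some ` (- (- (h -` V))))"
    proof (rule set_eqI)
      show "x \<in> \<phi> -` V \<longleftrightarrow> x \<in> insert None (Some ` (- (- (h -` V))))" for x
        using True by (cases x) (auto simp: \<phi>_def)
    qed
    ultimately show ?thesis
      unfolding openin_Alexandroff_compactification
      by (metis Compl_eq_Diff_UNIV closed_closedin compact_imp_closed compactin_euclidean_iff
          topspace_euclidean)
  next
    case False
    have "\<phi> -` V = Some ` (h -` V)"
    proof (rule set_eqI)
      show "x \<in> \<phi> -` V \<longleftrightarrow> x \<in> Some ` (h -` V)" for x
        using False by (cases x) (auto simp: \<phi>_def)
    qed
    moreover have "open (h -` V)"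
      using h(2) V by (simp add: open_vimage)
    ultimately show ?thesis by simp
  qed
  then have "continuous_map ?A euclidean \<phi>"
    by (auto simp: continuous_map_alt simp flip: UNIV_option_conv)
  then have "continuous_map ?A (top_of_set S) \<phi>"
    using img by (auto simp: continuous_map_in_subtopology)
  then have "homeomorphic_map ?A (top_of_set S) \<phi>"
    using img inj
    by (intro continuous_imp_homeomorphic_map)
       (auto simp: Hausdorff_space_subtopology simp flip: UNIV_option_conv)
  then have "metrizable_space ?A"
    by (metis homeomorphic_map_imp_homeomorphic_space homeomorphic_metrizable_space
        metrizable_space_euclidean metrizable_space_subtopology)
  then obtain M d where "Metric_space M d" "?A = Metric_space.mtopology M d"
    by (auto simp: metrizable_space_def)
  then have "metric (M, d) \<in> compactified_plane_metrics"
    by (simp add: compactified_plane_metrics_def mtopology_of_def Metric_space.mspace_metric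
        Metric_space.mdist_metric)
  then show ?thesis by blast
qed

end

theory Submission
  imports Defs
begin

text \<open>
  Along an orbit of the Lozi map the second coordinates \<open>x\<^sub>n\<close> satisfy
  \<open>x\<^sub>n\<^sub>+\<^sub>2 = 1 - a \<bar>x\<^sub>n\<^sub>+\<^sub>1\<bar> + b x\<^sub>n\<close>.  Code a point by the signs of its \<open>x\<^sub>n\<close>, with \<open>R\<close> for positive and \<open>L\<close>
  for nonpositive.  The point of period two has code \<open>LRLR...\<close>, and on the line \<open>a = 1 + b\<close> one
  multiplier of this point is \<open>-1\<close>.  It is then surrounded by a segment of points of period four, and this
  segment ends at points with \<open>x\<^sub>n = 0\<close> for some \<open>n\<close>, that is, on the fold of the map.  Everything is
  decided there.

  On the line the entropy is zero because the number of sign words of length \<open>n\<close> grows only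
  polynomially.  A word is determined by its first two letters and by its \<^emph>\<open>breaks\<close>, the places where a
  letter differs from the one two steps earlier, and no orbit has more than 19 breaks
  (\<open>lozi_few_breaks\<close>).  The long blocks without a break are \<open>R...R\<close> and \<open>L...L\<close>, close to the two
  saddle fixed points or on the way from and to infinity, and \<open>LRLR...\<close>; every passage between such blocks
  happens in a bounded order.  The delicate block is the last.  For a point with previous coordinate
  \<open>w \<le> 0\<close> and coordinate \<open>x > 0\<close> put \<open>e = x - b w - 1\<close>.  If \<open>a = 1 + b\<close>, then a passage through \<open>LR\<close> maps
  \<open>e\<close> to exactly \<open>-e\<close>, so nothing drifts; near the segment the only other passage is \<open>RRRL\<close>, which moves \<open>e\<close> by
  \<open>2 (1 + b) t\<close>, where \<open>t > 0\<close> is the coordinate after \<open>x\<close>.  After at most two of these \<open>e\<close> is on the inner side of the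
  threshold, and the code alternates forever (\<open>rebound_settles\<close>, \<open>second_rebound_settles\<close>).

  Few words mean few separated orbits.  Points with the same sign word are moved by the same affine maps,
  and a planar set of points whose images under a family of affine maps all lie in one bounded region contains,
  as soon as its size exceeds a bound that does not depend on the family, two points that all maps
  keep together (\<open>affine_family_close_pair\<close>).  Near infinity nothing has to be separated, and the times spent
  in a large box form an interval, since an orbit that leaves the box never comes back.

  Beyond the line, for \<open>a = 1 + b + \<epsilon>\<close>, the fourth iterate pushes points on one side of the fold towards
  it by a step \<open>h\<close> proportional to \<open>\<epsilon>\<close>, and on the other side expands by a factor of about \<open>-3.5\<close>.  In
  coordinates measured in units of \<open>h\<close> the picture does not depend on \<open>\<epsilon>\<close>: it is close to
  the interval map \<open>y \<mapsto> y + 1\<close> for \<open>y \<le> 0\<close> and \<open>y \<mapsto> 1 - 3.5 y\<close> for \<open>y \<ge> 0\<close>.  Here \<open>[0.05, 0.65]\<close> stretches over itself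
  and over \<open>[-1, -0.3]\<close>, and the latter over the former.  So all words without two adjacent letters for
  the second interval occur, their number grows like the powers of the golden ratio, and the entropy is at
  least \<open>ln ((1 + sqrt 5) / 2) / 4 = 0.1203...\<close>, however small \<open>\<epsilon>\<close> is (\<open>entropy_ge\<close>).
\<close>

section \<open>Sign sequences and their breaks\<close>

definition lozi_seq :: "real \<Rightarrow> real \<Rightarrow> (nat \<Rightarrow> real) \<Rightarrow> bool" where
  "lozi_seq a b x \<longleftrightarrow> (\<forall>n. x (n + 2) = 1 - a * \<bar>x (n + 1)\<bar> + b * x n)"

definition breaks :: "(nat \<Rightarrow> real) \<Rightarrow> nat set" where
  "breaks x = {n. (x (n + 2) > 0) \<noteq> (x n > 0)}"

definition few_breaks :: "nat \<Rightarrow> (nat \<Rightarrow> real) \<Rightarrow> bool" where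
  "few_breaks k x \<longleftrightarrow> finite (breaks x) \<and> card (breaks x) \<le> k"

lemma lozi_seq_shift: "lozi_seq a b x \<Longrightarrow> lozi_seq a b (\<lambda>n. x (n + m))"
  unfolding lozi_seq_def
proof
  fix n assume *: "\<forall>n. x (n + 2) = 1 - a * \<bar>x (n + 1)\<bar> + b * x n"
  have "n + 2 + m = (n + m) + 2" "n + 1 + m = (n + m) + 1" by simp_all
  then show "x (n + 2 + m) = 1 - a * \<bar>x (n + 1 + m)\<bar> + b * x (n + m)"
    using * by metis
qed

lemma few_breaks_mono: "few_breaks k x \<Longrightarrow> k \<le> l \<Longrightarrow> few_breaks l x"
  by (auto simp: few_breaks_def)

lemma breaks_shift: "n \<in> breaks (\<lambda>n. x (n + m)) \<longleftrightarrow> n + m \<in> breaks x"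
proof -
  have "n + 2 + m = n + m + 2" by simp
  then show ?thesis unfolding breaks_def mem_Collect_eq by metis
qed

lemma few_breaks_shift:
  assumes "few_breaks k (\<lambda>n. x (n + m))"
    and "card {n. n < m \<and> n \<in> breaks x} \<le> j"
  shows "few_breaks (j + k) x"
proof -
  have eq: "breaks x = {n. n < m \<and> n \<in> breaks x} \<union> (\<lambda>n. n + m) ` breaks (\<lambda>n. x (n + m))"
  proof (intro set_eqI iffI)
    fix n assume n: "n \<in> breaks x"
    show "n \<in> {n. n < m \<and> n \<in> breaks x} \<union> (\<lambda>n. n + m) ` breaks (\<lambda>n. x (n + m))"
    proof (cases "n < m")
      case False
      then have *: "n = (n - m) + m" by simp
      have "n - m \<in> breaks (\<lambda>n. x (n + m))"
        unfolding breaks_shift using n * by argo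
      then show ?thesis using * by blast
    qed (use n in blast)
  next
    fix n assume "n \<in> {n. n < m \<and> n \<in> breaks x} \<union> (\<lambda>n. n + m) ` breaks (\<lambda>n. x (n + m))"
    then show "n \<in> breaks x" unfolding Un_iff image_iff Bex_def breaks_shift by blast
  qed
  have fin: "finite (breaks (\<lambda>n. x (n + m)))" "card (breaks (\<lambda>n. x (n + m))) \<le> k"
    using assms(1) by (auto simp: few_breaks_def)
  have "card (breaks x) \<le> card {n. n < m \<and> n \<in> breaks x}
      + card ((\<lambda>n. n + m) ` breaks (\<lambda>n. x (n + m)))"
    using card_Un_le by (subst eq) blast
  also have "\<dots> \<le> j + k"
    using assms(2) fin card_image_le[OF fin(1), of "\<lambda>n. n + m"] by linarith
  finally show ?thesis
    unfolding few_breaks_def using fin by (subst eq) auto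
qed

lemma few_breaks_shift_crude:
  assumes "few_breaks k (\<lambda>n. x (n + m))"
  shows "few_breaks (m + k) x"
proof (rule few_breaks_shift[OF assms])
  have "card {n. n < m \<and> n \<in> breaks x} \<le> card {..<m}"
    by (intro card_mono) auto
  then show "card {n. n < m \<and> n \<in> breaks x} \<le> m" by simp
qed

text \<open>Of a block of equal signs only the last but one position can be a break, however long the block is.\<close>

lemma few_breaks_constant_prefix:
  assumes "few_breaks k (\<lambda>n. x (n + m))" and "\<And>n. n \<le> m \<Longrightarrow> (x n > 0) = c"
  shows "few_breaks (1 + k) x"
proof (rule few_breaks_shift[OF assms(1)])
  have "{n. n < m \<and> n \<in> breaks x} \<subseteq> {m - 1}"
  proof
    fix n assume n: "n \<in> {n. n < m \<and> n \<in> breaks x}"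
    then have "\<not> n + 2 \<le> m" using assms(2) by (auto simp: breaks_def)
    then show "n \<in> {m - 1}" using n by auto
  qed
  then have "card {n. n < m \<and> n \<in> breaks x} \<le> card {m - 1}"
    by (intro card_mono) auto
  then show "card {n. n < m \<and> n \<in> breaks x} \<le> 1" by simp
qed

lemma few_breaks_constant:
  assumes "\<And>n. (x n > 0) = c"
  shows "few_breaks k x"
proof -
  have "breaks x = {}" unfolding breaks_def using assms by blast
  then show ?thesis by (simp add: few_breaks_def)
qed

lemma sign_run_cases:
  fixes x :: "nat \<Rightarrow> real"
  obtains "\<And>n. (x n > 0) = (x 0 > 0)"
  | m where "\<And>n. n \<le> m \<Longrightarrow> (x n > 0) = (x 0 > 0)" "(x (m + 1) > 0) \<noteq> (x 0 > 0)"
proof (cases "\<forall>n. (x n > 0) = (x 0 > 0)")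
  case True
  then show ?thesis using that by blast
next
  case False
  define k where "k = (LEAST n. (x n > 0) \<noteq> (x 0 > 0))"
  have k: "(x k > 0) \<noteq> (x 0 > 0)"
    unfolding k_def by (rule LeastI_ex) (use False in blast)
  have lt: "(x n > 0) = (x 0 > 0)" if "n < k" for n
    using not_less_Least[of n "\<lambda>n. (x n > 0) \<noteq> (x 0 > 0)"] that unfolding k_def by blast
  obtain m where m: "k = Suc m" using k by (cases k) auto
  show ?thesis
  proof (rule that(2))
    show "(x n > 0) = (x 0 > 0)" if "n \<le> m" for n
      using lt[of n] that m by simp
    show "(x (m + 1) > 0) \<noteq> (x 0 > 0)"
      using k unfolding m by simp
  qed
qed

lemma lozi_seq_pos:
  assumes "lozi_seq (1 + b) b x" "x m > 0" "m = n + 1" "k = n + 2"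
  shows "x k = 1 - x m - b * x m + b * x n"
proof -
  have "x (n + 2) = 1 - (1 + b) * \<bar>x (n + 1)\<bar> + b * x n"
    using assms(1) unfolding lozi_seq_def by blast
  with assms(2-) show ?thesis by (simp add: algebra_simps)
qed

lemma lozi_seq_neg:
  assumes "lozi_seq (1 + b) b x" "x m \<le> 0" "m = n + 1" "k = n + 2"
  shows "x k = 1 + x m + b * x m + b * x n"
proof -
  have "x (n + 2) = 1 - (1 + b) * \<bar>x (n + 1)\<bar> + b * x n"
    using assms(1) unfolding lozi_seq_def by blast
  with assms(2-) show ?thesis by (simp add: algebra_simps)
qed

section \<open>Alternating codes on the critical line\<close>

text \<open>The relative precision \<open>1 / 40000\<close> is chosen so that the products \<open>b x\<close> can be treated as linear terms with a small
  error in the estimates below, the tightest of which leave a margin of a few units in the fourth digit.\<close>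

definition near_two_fifths :: "real \<Rightarrow> bool" where "near_two_fifths b \<longleftrightarrow> 39999 / 100000 \<le> b \<and> b \<le> 40001 / 100000"

lemma near_two_fifths_prod_pos:
  assumes "near_two_fifths b" "(x::real) \<ge> 0" shows "39999 / 100000 * x \<le> b * x" "b * x \<le> 40001 / 100000 * x"
  using assms unfolding near_two_fifths_def by (intro mult_right_mono; simp)+

lemma near_two_fifths_prod_neg:
  assumes "near_two_fifths b" "(x::real) \<le> 0" shows "40001 / 100000 * x \<le> b * x" "b * x \<le> 39999 / 100000 * x"
  using assms unfolding near_two_fifths_def by (intro mult_right_mono_neg; simp)+

lemma near_two_fifths_bounds: "near_two_fifths b \<Longrightarrow> 0 < b" "near_two_fifths b \<Longrightarrow> b < 1"
  by (auto simp: near_two_fifths_def)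

text \<open>Here \<open>w\<close>, \<open>x\<close>, \<open>t\<close> are consecutive terms.  The last condition says that \<open>e = x - b w - 1\<close> lies between the two
  values \<open>\<plusminus> b (1 - b) / (1 + b\<^sup>2)\<close> that belong to the ends of the segment of points of period four.\<close>

definition settled :: "real \<Rightarrow> real \<Rightarrow> real \<Rightarrow> real \<Rightarrow> bool" where
  "settled b w x t \<longleftrightarrow> w \<le> 0 \<and> 0 < x \<and> t \<le> 0 \<and>
     \<bar>(1 + b) * (1 + b^2) * (x - b * w - 1)\<bar> \<le> b * (1 - b^2)"

text \<open>With \<open>e = x\<^sub>1 - b x\<^sub>0 - 1\<close> one finds \<open>x\<^sub>4 = (1 + b) (1 + b\<^sup>2) e - b (1 - b\<^sup>2) + b\<^sup>4 x\<^sub>0\<close>, which is nonpositive because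
  \<open>e\<close> is below the upper end and \<open>x\<^sub>0 \<le> 0\<close>; and the step only changes the sign of \<open>e\<close>.\<close>

lemma settled_step:
  assumes b: "near_two_fifths b" and s: "lozi_seq (1 + b) b x" and st: "settled b (x 0) (x 1) (x 2)"
  shows "settled b (x 2) (x 3) (x 4)"
proof -
  have x0: "x 0 \<le> 0" "0 < x 1" "x 2 \<le> 0"
    and e: "\<bar>(1 + b) * (1 + b^2) * (x 1 - b * x 0 - 1)\<bar> \<le> b * (1 - b^2)"
    using st unfolding settled_def by blast+
  note b1 = near_two_fifths_bounds[OF b]
  have x2: "x 2 = 1 - x 1 - b * x 1 + b * x 0"
    by (rule lozi_seq_pos[OF s x0(2)]) simp_all
  have x3: "x 3 = 1 + x 2 + b * x 2 + b * x 1"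
    by (rule lozi_seq_neg[OF s x0(3)]) simp_all
  have eb: "\<bar>x 1 - b * x 0 - 1\<bar> \<le> 35 / 100"
  proof -
    have "\<bar>x 1 - b * x 0 - 1\<bar> \<le> (1 + b) * (1 + b^2) * \<bar>x 1 - b * x 0 - 1\<bar>"
    proof -
      have "1 * 1 \<le> (1 + b) * (1 + b^2)"
        using b1 by (intro mult_mono) auto
      from mult_right_mono[OF this, of "\<bar>x 1 - b * x 0 - 1\<bar>"] show ?thesis by simp
    qed
    also have "\<dots> \<le> b * (1 - b^2)" 
    proof -
      have "\<bar>(1 + b) * (1 + b^2)\<bar> = (1 + b) * (1 + b^2)" using b1 by simp
      then show ?thesis using e unfolding abs_mult by (metis abs_mult)
    qed
    also have "\<dots> = b - b * b * b" by (simp add: algebra_simps power2_eq_square)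
    also have "\<dots> \<le> 35 / 100"
    proof -
      have "39999 / 100000 * b \<le> b * b" using near_two_fifths_prod_pos(1)[OF b, of b] b1 by linarith
      moreover have "39999 / 100000 * (b * b) \<le> b * (b * b)" using near_two_fifths_prod_pos(1)[OF b, of "b * b"] b1 by (meson mult_nonneg_nonneg less_imp_le)
      ultimately show ?thesis using b unfolding near_two_fifths_def mult.assoc by linarith
    qed
    finally show ?thesis .
  qed
  have x3p: "x 3 > 0"
    using x3 x2 x0 eb near_two_fifths_prod_pos[OF b, of "x 1"] near_two_fifths_prod_neg[OF b x0(1)]
      near_two_fifths_prod_neg[OF b x0(3)] by linarith
  have x4: "x 4 = 1 - x 3 - b * x 3 + b * x 2"
    by (rule lozi_seq_pos[OF s x3p]) simp_all
  have "x 4 = (1 + b) * (1 + b^2) * (x 1 - b * x 0 - 1) - b * (1 - b^2) + b^4 * x 0"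
    unfolding x4 x3 x2 by (simp add: algebra_simps power2_eq_square power4_eq_xxxx)
  moreover have "b^4 * x 0 \<le> 0" using x0 by (simp add: mult_nonneg_nonpos)
  ultimately have x4n: "x 4 \<le> 0" using e by linarith
  have "x 3 - b * x 2 - 1 = - (x 1 - b * x 0 - 1)"
    unfolding x3 x2 by (simp add: algebra_simps)
  then have "\<bar>(1 + b) * (1 + b^2) * (x 3 - b * x 2 - 1)\<bar> \<le> b * (1 - b^2)"
    using e by (simp only: mult_minus_right abs_minus_cancel)
  then show ?thesis
    unfolding settled_def using x0(3) x3p x4n by blast
qed

lemma settled_few_breaks:
  assumes b: "near_two_fifths b" and s: "lozi_seq (1 + b) b x" and st: "settled b (x 0) (x 1) (x 2)"
  shows "few_breaks 0 x"
proof -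
  have *: "settled b (x (2 * n)) (x (2 * n + 1)) (x (2 * n + 2))" for n
  proof (induction n)
    case 0
    show ?case using st unfolding mult_0_right add_0 .
  next
    case (Suc n)
    have i: "2 * Suc n = 2 + 2 * n" "2 + 2 * n + 1 = 3 + 2 * n" "2 + 2 * n + 2 = 4 + 2 * n"
      by simp_all
    have j: "0 + 2 * n = 2 * n" "1 + 2 * n = 2 * n + 1" "2 + 2 * n = 2 * n + 2"
      by simp_all
    have "settled b (x (0 + 2 * n)) (x (1 + 2 * n)) (x (2 + 2 * n))"
      unfolding j by (rule Suc)
    from settled_step[OF b lozi_seq_shift[OF s, of "2 * n"] this]
    show ?case unfolding i .
  qed
  have ev: "\<not> x (2 * n) > 0" "x (2 * n + 1) > 0" for n
    using *[of n] unfolding settled_def by (meson not_less)+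
  have "(x (n + 2) > 0) = (x n > 0)" for n
  proof (cases "even n")
    case True
    then obtain k where k: "n = 2 * k" by blast
    have "n + 2 = 2 * (k + 1)" using k by simp
    then show ?thesis using ev(1)[of k] ev(1)[of "k + 1"] k by metis
  next
    case False
    then obtain k where k: "n = 2 * k + 1" by (blast elim: oddE)
    have "n + 2 = 2 * (k + 1) + 1" using k by simp
    then show ?thesis using ev(2)[of k] ev(2)[of "k + 1"] k by metis
  qed
  then show ?thesis by (simp add: few_breaks_def breaks_def)
qed

text \<open>The region around the segment of points of period four in which the orbits end up that neither escape to infinity
  nor converge to a saddle point.  The bound \<open>0.323\<close> lies between two constraints at \<open>b = 0.4\<close>: runs of positive terms end with
  \<open>\<bar>e\<bar>\<close> up to \<open>0.3217\<close>, and beyond \<open>0.3235\<close> an excursion \<open>RRRL\<close> could throw \<open>e\<close> past the other end of the segment.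
  The bound on \<open>w\<close> is the one that an alternating step then guarantees.\<close>

definition core :: "real \<Rightarrow> real \<Rightarrow> real \<Rightarrow> bool" where
  "core b w x \<longleftrightarrow> w \<le> 0 \<and> 0 < x \<and> - 8523 / 10000 \<le> w \<and>
     x - b * w - 1 \<le> 323 / 1000 \<and> - 323 / 1000 \<le> x - b * w - 1"

text \<open>The situation after an excursion \<open>RRRL\<close>, where \<open>t\<close> is the term by which the orbit overshot the fold.
  The last equation eliminates the earlier history: it expresses \<open>w\<close> by \<open>e\<close> and \<open>t\<close>.\<close>

definition rebound :: "real \<Rightarrow> real \<Rightarrow> real \<Rightarrow> real \<Rightarrow> bool" where
  "rebound b t w x \<longleftrightarrow> core b w x \<and> 0 < t \<and> x - b * w - 1 \<le> 2055 / 10000 \<and>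
     w = (1 + b) * (x - b * w - 1) - b - b^2 * t"

lemma core_alternate:
  assumes b: "near_two_fifths b" and s: "lozi_seq (1 + b) b x" and c: "core b (x 0) (x 1)" and x2: "x 2 \<le> 0"
  shows "core b (x 2) (x 3)"
proof -
  have c0: "x 0 \<le> 0" "0 < x 1" "- 8523 / 10000 \<le> x 0"
     "x 1 - b * x 0 - 1 \<le> 323 / 1000" "- 323 / 1000 \<le> x 1 - b * x 0 - 1"
    using c unfolding core_def by blast+
  have e2: "x 2 = 1 - x 1 - b * x 1 + b * x 0"
    by (rule lozi_seq_pos[OF s c0(2)]) simp_all
  have e3: "x 3 = 1 + x 2 + b * x 2 + b * x 1"
    by (rule lozi_seq_neg[OF s x2]) simp_all
  note p = near_two_fifths_prod_neg[OF b c0(1)] near_two_fifths_prod_pos[OF b less_imp_le[OF c0(2)]]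
    near_two_fifths_prod_neg[OF b x2]
  show ?thesis
    unfolding core_def using c0 e2 e3 p x2 by (intro conjI; linarith)
qed

lemma core_excursion:
  assumes b: "near_two_fifths b" and s: "lozi_seq (1 + b) b x" and c: "core b (x 0) (x 1)" and x2: "x 2 > 0"
  shows "rebound b (x 2) (x 4) (x 5)" and "x 5 - b * x 4 = x 1 - b * x 0 + 2 * (1 + b) * x 2"
proof -
  have c0: "x 0 \<le> 0" "0 < x 1" "- 8523 / 10000 \<le> x 0"
     "x 1 - b * x 0 - 1 \<le> 323 / 1000" "- 323 / 1000 \<le> x 1 - b * x 0 - 1"
    using c unfolding core_def by blast+
  have e2: "x 2 = 1 - x 1 - b * x 1 + b * x 0"
    by (rule lozi_seq_pos[OF s c0(2)]) simp_all
  have e3: "x 3 = 1 - x 2 - b * x 2 + b * x 1"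
    by (rule lozi_seq_pos[OF s x2]) simp_all
  note p = near_two_fifths_prod_neg[OF b c0(1)] near_two_fifths_prod_pos[OF b less_imp_le[OF c0(2)]]
    near_two_fifths_prod_pos[OF b less_imp_le[OF x2]]
  have x3: "x 3 > 0" using c0 e2 e3 p x2 by linarith
  have e4: "x 4 = 1 - x 3 - b * x 3 + b * x 2"
    by (rule lozi_seq_pos[OF s x3]) simp_all
  note p3 = near_two_fifths_prod_pos[OF b less_imp_le[OF x3]]
  have x4: "x 4 \<le> 0" using c0 e2 e3 e4 p p3 x2 by linarith
  have e5: "x 5 = 1 + x 4 + b * x 4 + b * x 3"
    by (rule lozi_seq_neg[OF s x4]) simp_all
  note p4 = near_two_fifths_prod_neg[OF b x4]
  define e where "e = x 5 - b * x 4 - 1"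
  have ee: "e = (x 1 - b * x 0 - 1) + 2 * x 2 + 2 * (b * x 2)"
    unfolding e_def using e5 e4 e3 e2 by linarith
  have elo: "- 323 / 1000 \<le> e" unfolding ee using c0(5) p(5) x2 by linarith
  have ehi: "e \<le> 2055 / 10000" unfolding ee using c0 e2 p x2 by linarith
  have x3e: "x 3 = 1 - e + b * x 2" using ee e3 e2 by linarith
  have x4e: "x 4 = e - b * x 3" unfolding e_def using e5 by linarith
  have x4lo: "- 8523 / 10000 \<le> x 4"
  proof -
    have "x 3 \<le> 1323 / 1000" using x3e ee c0(5) p(5,6) x2 by linarith
    then show ?thesis using x4e p3(2) elo by linarith
  qed
  have x5: "0 < x 5"
  proof -
    have "x 5 = 1 + e + b * x 4" unfolding e_def by linarith
    then show ?thesis using elo x4lo p4(1) by linarith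
  qed
  have "core b (x 4) (x 5)"
    unfolding core_def using x4 x5 x4lo elo ehi unfolding e_def by linarith
  moreover have "x 4 = (1 + b) * (x 5 - b * x 4 - 1) - b - b^2 * x 2"
    unfolding e5 e4 e3 by (simp add: algebra_simps power2_eq_square)
  ultimately show "rebound b (x 2) (x 4) (x 5)"
    unfolding rebound_def using x2 ehi unfolding e_def by blast
  show "x 5 - b * x 4 = x 1 - b * x 0 + 2 * (1 + b) * x 2"
    using ee unfolding e_def by (simp add: algebra_simps)
qed

text \<open>The threshold at which the next term changes sign differs from the end of the segment only by \<open>b\<^sup>4 t\<close>.\<close>

lemma rebound_next:
  assumes s: "lozi_seq (1 + b) b x" and r: "rebound b t (x 0) (x 1)"
  shows "x 2 = b^4 * t - (1 + b) * (1 + b^2) * (x 1 - b * x 0 - 1) - b * (1 - b^2)"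
proof -
  define e where "e = x 1 - b * x 0 - 1"
  have "0 < x 1" and w: "x 0 = (1 + b) * e - b - b^2 * t"
    using r unfolding rebound_def core_def e_def by blast+
  have e2: "x 2 = 1 - x 1 - b * x 1 + b * x 0"
    by (rule lozi_seq_pos[OF s \<open>0 < x 1\<close>]) simp_all
  have "x 2 = - (1 + b) * e - b - b^2 * x 0"
    unfolding e2 e_def by (simp add: algebra_simps power2_eq_square)
  also have "\<dots> = b^4 * t - (1 + b) * (1 + b^2) * e - b * (1 - b^2)"
    unfolding w by (simp add: algebra_simps power2_eq_square power4_eq_xxxx)
  finally show ?thesis unfolding e_def .
qed

lemma near_two_fifths_coeffs:
  assumes "near_two_fifths b"
  shows "0 < (1 + b) * (1 + b^2)" "(1 + b) * (1 + b^2) \<le> 1625 / 1000" "335 / 1000 \<le> b * (1 - b^2)"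
    "0 < b^4" "b^4 \<le> 1"
proof -
  have b: "39999 / 100000 \<le> b" "b \<le> 40001 / 100000"
    using assms unfolding near_two_fifths_def by blast+
  have "b^2 \<le> (40001 / 100000)^2" using b by (intro power_mono) auto
  then have b2: "b^2 \<le> 16001 / 100000" by (simp add: power2_eq_square)
  have b0: "0 < b" "b \<le> 1" "0 \<le> b^2" using b by auto
  show "0 < (1 + b) * (1 + b^2)" using b0 by (intro mult_pos_pos) linarith+
  have "(1 + b) * (1 + b^2) \<le> (140001 / 100000) * (116001 / 100000)"
    using b b2 b0 by (intro mult_mono) auto
  then show "(1 + b) * (1 + b^2) \<le> 1625 / 1000" by simp
  have "(39999 / 100000) * (83999 / 100000) \<le> b * (1 - b^2)"
    using b b2 b0 by (intro mult_mono) auto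
  then show "335 / 1000 \<le> b * (1 - b^2)" by simp
  show "0 < b^4" "b^4 \<le> 1" using b0 by (auto intro: power_le_one)
qed

text \<open>By \<open>rebound_next\<close> the condition \<open>x\<^sub>2 \<le> 0\<close> puts \<open>e\<close> above the lower end of the segment, and the excursion
  was too short to carry it above the upper end.\<close>

lemma rebound_settles:
  assumes b: "near_two_fifths b" and s: "lozi_seq (1 + b) b x" and r: "rebound b t (x 0) (x 1)" and x2: "x 2 \<le> 0"
  shows "settled b (x 0) (x 1) (x 2)"
proof -
  define e where "e = x 1 - b * x 0 - 1"
  define \<mu> where "\<mu> = (1 + b) * (1 + b^2)"
  have r0: "x 0 \<le> 0" "0 < x 1" "0 < t" "e \<le> 2055 / 10000"
    using r unfolding rebound_def core_def e_def by blast+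
  have n: "x 2 = b^4 * t - \<mu> * e - b * (1 - b^2)"
    using rebound_next[OF s r] unfolding e_def \<mu>_def .
  note co = near_two_fifths_coeffs[OF b, folded \<mu>_def]
  have "0 \<le> b^4 * t" using co r0 by simp
  then have lo: "- (b * (1 - b^2)) \<le> \<mu> * e" using n x2 by linarith
  have "\<mu> * e \<le> \<mu> * (2055 / 10000)" using r0 co by (intro mult_left_mono) auto
  also have "\<dots> \<le> (1625 / 1000) * (2055 / 10000)" using co by simp
  also have "\<dots> \<le> b * (1 - b^2)" using co by simp
  finally have "\<bar>\<mu> * e\<bar> \<le> b * (1 - b^2)" using lo by (intro abs_leI) linarith+
  then show ?thesis unfolding settled_def e_def \<mu>_def using r0 x2 by blast
qed

text \<open>The second excursion overshoots by \<open>x\<^sub>2\<close>, and \<open>rebound_next\<close> says that \<open>e\<close> was below the lower end by less than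
  \<open>x\<^sub>2\<close> then.  Since the excursion adds \<open>2 (1 + b) x\<^sub>2\<close>, a third one is impossible.\<close>

lemma second_rebound_settles:
  assumes b: "near_two_fifths b" and s: "lozi_seq (1 + b) b x" and r: "rebound b t (x 0) (x 1)" and x2: "0 < x 2"
  shows "settled b (x 4) (x 5) (x 6)"
proof -
  define e where "e = x 1 - b * x 0 - 1"
  define \<mu> where "\<mu> = (1 + b) * (1 + b^2)"
  have c: "core b (x 0) (x 1)" and t: "0 < t" using r unfolding rebound_def by blast+
  have r2: "rebound b (x 2) (x 4) (x 5)" by (rule core_excursion(1)[OF b s c x2])
  have s4: "lozi_seq (1 + b) b (\<lambda>n. x (n + 4))" by (rule lozi_seq_shift[OF s])
  have i: "x (0 + 4) = x 4" "x (1 + 4) = x 5" "x (2 + 4) = x 6" by simp_all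
  have e5: "x 5 - b * x 4 - 1 = e + 2 * (1 + b) * x 2"
    using core_excursion(2)[OF b s c x2] unfolding e_def by linarith
  have n0: "x 2 = b^4 * t - \<mu> * e - b * (1 - b^2)"
    using rebound_next[OF s r] unfolding e_def \<mu>_def .
  have n1: "x 6 = b^4 * x 2 - \<mu> * (e + 2 * (1 + b) * x 2) - b * (1 - b^2)"
    using rebound_next[OF s4, unfolded i, OF r2] unfolding e5 \<mu>_def .
  note co = near_two_fifths_coeffs[OF b, folded \<mu>_def]
  note b1 = near_two_fifths_bounds[OF b]
  have "1 * 1 \<le> \<mu> * (1 + b)"
    unfolding \<mu>_def using b1 by (intro mult_mono mult_ge1_I) auto
  then have "b^4 + 1 \<le> 2 * (\<mu> * (1 + b))" using co by linarith
  then have "(b^4 + 1) * x 2 \<le> 2 * (\<mu> * (1 + b)) * x 2" using x2 by (intro mult_right_mono) auto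
  moreover have "x 6 = (b^4 + 1) * x 2 - 2 * (\<mu> * (1 + b)) * x 2 - b^4 * t"
    using n0 unfolding n1 by (simp add: algebra_simps)
  moreover have "0 \<le> b^4 * t" using co t by simp
  ultimately have x6: "x 6 \<le> 0" by linarith
  from rebound_settles[OF b s4, unfolded i, OF r2 x6] show ?thesis .
qed

lemma few_breaks_after:
  assumes "few_breaks k (\<lambda>n. x (n + m))" "m + k \<le> l" shows "few_breaks l x"
  using few_breaks_shift_crude[OF assms(1)] few_breaks_mono assms(2) by blast

lemma settled_few_breaks_after:
  assumes b: "near_two_fifths b" and s: "lozi_seq (1 + b) b x"
    and "settled b (x m) (x (m + 1)) (x (m + 2))"
  shows "few_breaks m x"
proof -
  have "settled b (x (0 + m)) (x (1 + m)) (x (2 + m))"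
    using assms(3) by (simp only: add_0 add.commute)
  then have "few_breaks 0 (\<lambda>n. x (n + m))"
    by (rule settled_few_breaks[OF b lozi_seq_shift[OF s]])
  then show ?thesis by (rule few_breaks_after) simp
qed

lemma core_excursion_few_breaks:
  assumes b: "near_two_fifths b" and s: "lozi_seq (1 + b) b x" and c: "core b (x 0) (x 1)" and x2: "x 2 > 0"
  shows "few_breaks 8 x"
proof -
  have r: "rebound b (x 2) (x 4) (x 5)" by (rule core_excursion(1)[OF b s c x2])
  have s4: "lozi_seq (1 + b) b (\<lambda>n. x (n + 4))" by (rule lozi_seq_shift[OF s])
  have i: "x (0 + 4) = x 4" "x (1 + 4) = x 5" "x (2 + 4) = x 6" "x (4 + 4) = x 8" "x (5 + 4) = x 9"
    "x (6 + 4) = x 10" "x (8 + 1) = x 9" "x (8 + 2) = x 10" "x (4 + 1) = x 5" "x (4 + 2) = x 6" by simp_all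
  show ?thesis
  proof (cases "x 6 \<le> 0")
    case True
    have "settled b (x 4) (x 5) (x 6)"
      by (rule rebound_settles[OF b s4, unfolded i, OF r True])
    then have "few_breaks 4 x"
      using settled_few_breaks_after[OF b s, of 4, unfolded i] by blast
    then show ?thesis by (rule few_breaks_mono) simp
  next
    case False
    then have "0 < x 6" by simp
    then have "settled b (x 8) (x 9) (x 10)"
      by (rule second_rebound_settles[OF b s4, unfolded i, OF r])
    then show ?thesis
      using settled_few_breaks_after[OF b s, of 8, unfolded i] by blast
  qed
qed

text \<open>The code alternates until the first excursion, if there is one, and \<open>core\<close> persists on the way there.\<close>

lemma core_few_breaks:
  assumes b: "near_two_fifths b" and s: "lozi_seq (1 + b) b x" and c: "core b (x 0) (x 1)"
  shows "few_breaks 8 x"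
proof -
  have step: "core b (x (2 * Suc n)) (x (2 * Suc n + 1))"
    if "core b (x (2 * n)) (x (2 * n + 1))" "x (2 * Suc n) \<le> 0" for n
  proof -
    have i: "0 + 2 * n = 2 * n" "1 + 2 * n = 2 * n + 1" "2 + 2 * n = 2 * Suc n" "3 + 2 * n = 2 * Suc n + 1"
      by simp_all
    show ?thesis
      by (rule core_alternate[OF b lozi_seq_shift[OF s], of "2 * n", unfolded i, OF that])
  qed
  have reach: "core b (x (2 * n)) (x (2 * n + 1))" if "\<And>k. k < n \<Longrightarrow> x (2 * Suc k) \<le> 0" for n
    using that
  proof (induction n)
    case 0
    show ?case using c unfolding mult_0_right add_0 .
  next
    case (Suc n)
    show ?case by (intro step Suc) simp_all
  qed
  have no_break: "n \<notin> breaks x" if "n < 2 * m" "\<And>k. k < m \<Longrightarrow> x (2 * Suc k) \<le> 0" for n m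
  proof (cases "even n")
    case True
    then obtain k where k: "n = 2 * k" by blast
    have "k < m" using that(1) k by simp
    then have "core b (x (2 * k)) (x (2 * k + 1))" by (intro reach that(2)) simp
    then have "x n \<le> 0" unfolding core_def k by blast
    moreover have "x (n + 2) \<le> 0"
    proof -
      have "n + 2 = 2 * Suc k" using k by simp
      then show ?thesis using that(2)[OF \<open>k < m\<close>] by metis
    qed
    ultimately show ?thesis unfolding breaks_def by auto
  next
    case False
    then obtain k where k: "n = 2 * k + 1" by (blast elim: oddE)
    have "k < m" using that(1) k by simp
    have "core b (x (2 * k)) (x (2 * k + 1))" by (intro reach that(2)) (use \<open>k < m\<close> in simp)
    then have "x n > 0" unfolding core_def k by blast
    moreover have "core b (x (2 * Suc k)) (x (2 * Suc k + 1))"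
      by (intro reach that(2)) (use \<open>k < m\<close> in simp)
    then have "x (n + 2) > 0"
    proof -
      have "n + 2 = 2 * Suc k + 1" using k by simp
      then show ?thesis using \<open>core b (x (2 * Suc k)) (x (2 * Suc k + 1))\<close> unfolding core_def by metis
    qed
    ultimately show ?thesis unfolding breaks_def by auto
  qed
  show ?thesis
  proof (cases "\<forall>k. x (2 * Suc k) \<le> 0")
    case True
    have "n \<notin> breaks x" for n
      by (rule no_break[of _ "Suc n"]) (use True in auto)
    then have "breaks x = {}" by blast
    then show ?thesis by (simp add: few_breaks_def)
  next
    case False
    define m where "m = (LEAST k. \<not> x (2 * Suc k) \<le> 0)"
    have m: "\<not> x (2 * Suc m) \<le> 0" unfolding m_def by (rule LeastI_ex) (use False in blast)
    have lt: "x (2 * Suc k) \<le> 0" if "k < m" for k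
      using not_less_Least[OF that[unfolded m_def]] by blast
    have i: "0 + 2 * m = 2 * m" "1 + 2 * m = 2 * m + 1" "2 + 2 * m = 2 * Suc m"
      by simp_all
    have "few_breaks 8 (\<lambda>n. x (n + 2 * m))"
      by (rule core_excursion_few_breaks[OF b lozi_seq_shift[OF s], of "2 * m", unfolded i, OF reach])
        (use lt m in auto)
    moreover have "{n. n < 2 * m \<and> n \<in> breaks x} = {}"
      using no_break[OF _ lt] by blast
    ultimately have "few_breaks (0 + 8) x" by (intro few_breaks_shift) simp_all
    then show ?thesis by simp
  qed
qed

section \<open>Runs of positive terms\<close>

lemma lozi_seq_pos_approx:
  assumes b: "near_two_fifths b" and s: "lozi_seq (1 + b) b x" and m: "x m > 0" "m = n + 1" "k = n + 2"
    and "x m \<le> 2" "\<bar>x n\<bar> \<le> 3"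
  shows "x k \<le> 1 - 14 / 10 * x m + 4 / 10 * x n + 5 / 100000"
    and "1 - 14 / 10 * x m + 4 / 10 * x n - 5 / 100000 \<le> x k"
proof -
  have e: "x k = 1 - x m - b * x m + b * x n" by (rule lozi_seq_pos[OF s m])
  note p = near_two_fifths_prod_pos[OF b less_imp_le[OF m(1)]]
  have "\<bar>(b - 4 / 10) * x n\<bar> \<le> (1 / 100000) * 3"
    unfolding abs_mult using assms(7) b unfolding near_two_fifths_def by (intro mult_mono abs_leI) auto
  then have "\<bar>b * x n - 4 / 10 * x n\<bar> \<le> 3 / 100000" by (simp add: algebra_simps)
  then show "x k \<le> 1 - 14 / 10 * x m + 4 / 10 * x n + 5 / 100000"
     "1 - 14 / 10 * x m + 4 / 10 * x n - 5 / 100000 \<le> x k"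
    using e p assms(6) by linarith+
qed

text \<open>Both bounds on \<open>e = x\<^sub>4 - b x\<^sub>3 - 1 = 1 - x\<^sub>2 + b x\<^sub>1 = x\<^sub>1 + 2 b x\<^sub>1 - b x\<^sub>0\<close> come from the hypotheses, the
  lower one from the bound on \<open>x\<^sub>0\<close>.\<close>

lemma core_after_run:
  assumes b: "near_two_fifths b" and s: "lozi_seq (1 + b) b x"
    and sg: "0 < x 1" "0 < x 2" "x 3 \<le> 0"
    and q: "x 0 \<le> 8070 / 10000" and e: "1 - x 2 + b * x 1 \<le> 323 / 1000"
  shows "core b (x 3) (x 4)"
proof -
  have e2: "x 2 = 1 - x 1 - b * x 1 + b * x 0"
    by (rule lozi_seq_pos[OF s sg(1)]) simp_all
  have e3: "x 3 = 1 - x 2 - b * x 2 + b * x 1"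
    by (rule lozi_seq_pos[OF s sg(2)]) simp_all
  have e4: "x 4 = 1 + x 3 + b * x 3 + b * x 2"
    by (rule lozi_seq_neg[OF s sg(3)]) simp_all
  note p1 = near_two_fifths_prod_pos[OF b less_imp_le[OF sg(1)]]
  note p2 = near_two_fifths_prod_pos[OF b less_imp_le[OF sg(2)]]
  note p3 = near_two_fifths_prod_neg[OF b sg(3)]
  have "b * x 0 \<le> b * (8070 / 10000)" using q near_two_fifths_bounds[OF b] by (intro mult_left_mono) auto
  then have bq: "b * x 0 \<le> 32281 / 100000" using b unfolding near_two_fifths_def by linarith
  define e where "e = 1 - x 2 + b * x 1"
  have "e = x 1 + 2 * (b * x 1) - b * x 0" unfolding e_def using e2 by linarith
  then have lo: "- 32281 / 100000 + x 1 \<le> e" using bq p1 sg by linarith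
  have x3: "x 3 = e - b * x 2" unfolding e_def using e3 by linarith
  have x4: "x 4 - b * x 3 - 1 = e" unfolding e_def using e4 e3 by linarith
  have "x 3 \<ge> - 8523 / 10000"
  proof -
    have "x 2 \<le> 1 - x 1 - 39999 / 100000 * x 1 + 32281 / 100000" using e2 p1 bq by linarith
    then show ?thesis using x3 p2(2) lo sg(1) by linarith
  qed
  moreover have "0 < x 4"
    using x4 lo sg(1) \<open>x 3 \<ge> - 8523 / 10000\<close> p3(1) by linarith
  moreover have "e \<le> 323 / 1000" using e unfolding e_def .
  moreover have "- 323 / 1000 \<le> e" using lo sg(1) by linarith
  ultimately show ?thesis unfolding core_def x4 using sg(3) by (intro conjI; linarith)
qed

text \<open>Near the saddle point in the first quadrant a run of positive terms approaches the unstable direction by a factor of about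
  \<open>0.15\<close> per step.  Seven terms before the exit are enough to push the bounds for the end of the run to within the
  tolerance of \<open>core\<close>; the limit values are \<open>0.8043\<close> and \<open>0.3217\<close>.\<close>

lemma run_exit_bounds:
  fixes l n p q y z u m :: real
  assumes "0 < m" "0 < n" "0 < p" "0 < q" "0 < y" "0 < z" "u \<le> 0" "l \<le> 1"
    "n \<le> 1 - 14 / 10 * m + 4 / 10 * l + 5 / 100000"
    "p \<le> 1 - 14 / 10 * n + 4 / 10 * m + 5 / 100000" "1 - 14 / 10 * n + 4 / 10 * m - 5 / 100000 \<le> p"
    "q \<le> 1 - 14 / 10 * p + 4 / 10 * n + 5 / 100000" "1 - 14 / 10 * p + 4 / 10 * n - 5 / 100000 \<le> q"
    "y \<le> 1 - 14 / 10 * q + 4 / 10 * p + 5 / 100000" "1 - 14 / 10 * q + 4 / 10 * p - 5 / 100000 \<le> y"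
    "z \<le> 1 - 14 / 10 * y + 4 / 10 * q + 5 / 100000" "1 - 14 / 10 * y + 4 / 10 * q - 5 / 100000 \<le> z"
    "u \<le> 1 - 14 / 10 * z + 4 / 10 * y + 5 / 100000" "1 - 14 / 10 * z + 4 / 10 * y - 5 / 100000 \<le> u"
  shows "q \<le> 8070 / 10000" and "1 - z + 4 / 10 * y \<le> 3229 / 10000"
  using assms by linarith+


text \<open>A run of at least six positive terms is covered by \<open>run_exit_bounds\<close>.  In a shorter run the term \<open>x\<^sub>0 \<le> 0\<close> before it
  plays the part of the oldest term, and the bounds come out even better.\<close>

lemma run_reaches_core:
  assumes b: "near_two_fifths b" and s: "lozi_seq (1 + b) b x"
    and x0: "x 0 \<le> 0" and M: "2 \<le> M" and P: "\<And>n. 1 \<le> n \<Longrightarrow> n \<le> M \<Longrightarrow> 0 < x n" and xM: "x (M + 1) \<le> 0"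
  shows "core b (x (M + 1)) (x (M + 2))"
proof -
  have x12: "0 < x 1" "0 < x 2" using P[of 1] P[of 2] M by auto
  have e2: "x 2 = 1 - x 1 - b * x 1 + b * x 0"
    by (rule lozi_seq_pos[OF s x12(1)]) simp_all
  have x0lo: "- 3 \<le> x 0" and x1: "x 1 \<le> 1"
    using e2 x12 x0 near_two_fifths_prod_neg[OF b x0] near_two_fifths_prod_pos[OF b less_imp_le[OF x12(1)]] by linarith+
  have le1: "x n \<le> 1" if "n + 1 \<le> M" for n
    using that
  proof (induction n)
    case 0
    then show ?case using x0 by linarith
  next
    case (Suc n)
    have p: "0 < x (n + 1)" "0 < x (n + 2)" using P[of "n + 1"] P[of "n + 2"] Suc.prems by auto
    have "x (n + 2) = 1 - x (n + 1) - b * x (n + 1) + b * x n"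
      by (rule lozi_seq_pos[OF s p(1)]) simp_all
    moreover have "b * x n \<le> b * 1"
      using Suc near_two_fifths_bounds[OF b] by (intro mult_left_mono) auto
    ultimately have "(1 + b) * x (n + 1) \<le> (1 + b) * 1" using p(2) by (simp add: algebra_simps)
    then show ?case using near_two_fifths_bounds[OF b] by simp
  qed
  have lo: "- 3 \<le> x n" if "n \<le> M" for n
    using P[of n] that x0lo by (cases n) auto
  have A: "x (n + 2) \<le> 1 - 14 / 10 * x (n + 1) + 4 / 10 * x n + 5 / 100000"
      "1 - 14 / 10 * x (n + 1) + 4 / 10 * x n - 5 / 100000 \<le> x (n + 2)" if "n + 1 \<le> M" for n
  proof -
    have p: "0 < x (n + 1)" using P[of "n + 1"] that by simp
    have "x (n + 1) \<le> 2"
    proof (cases n)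
      case 0
      then show ?thesis using x1 by simp
    next
      case (Suc k)
      have pk: "0 < x (k + 1)" using P[of "k + 1"] that Suc by simp
      have "x (k + 2) = 1 - x (k + 1) - b * x (k + 1) + b * x k"
        by (rule lozi_seq_pos[OF s pk]) simp_all
      moreover have "b * x k \<le> b * 1"
        using le1[of k] that Suc near_two_fifths_bounds[OF b] by (intro mult_left_mono) auto
      moreover have "0 \<le> b * x (k + 1)" using pk near_two_fifths_bounds[OF b] by simp
      moreover have "n + 1 = k + 2" using Suc by simp
      ultimately show ?thesis using pk near_two_fifths_bounds(2)[OF b] by simp
    qed
    moreover have "\<bar>x n\<bar> \<le> 3" using le1[of n] lo[of n] that by (intro abs_leI) auto
    ultimately show "x (n + 2) \<le> 1 - 14 / 10 * x (n + 1) + 4 / 10 * x n + 5 / 100000"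
      "1 - 14 / 10 * x (n + 1) + 4 / 10 * x n - 5 / 100000 \<le> x (n + 2)"
      using lozi_seq_pos_approx[OF b s p] by auto
  qed
  define k where "k = M - 2"
  have k: "M = k + 2" using M unfolding k_def by simp
  have i: "x (0 + k) = x k" "x (1 + k) = x (k + 1)" "x (2 + k) = x (k + 2)" "x (3 + k) = x (M + 1)" "x (4 + k) = x (M + 2)"
    unfolding k by (simp_all add: add.commute numeral_eq_Suc)
  have pk: "0 < x (k + 1)" "0 < x (k + 2)" using P[of "k + 1"] P[of "k + 2"] k by auto
  have "x k \<le> 8070 / 10000 \<and> 1 - x (k + 2) + 4 / 10 * x (k + 1) \<le> 3229 / 10000"
  proof -
    consider "M = 2" | "M = 3" | "M = 4" | "M = 5" | "6 \<le> M"
      using M by linarith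
    then show ?thesis
    proof cases
      case 1
      then have k0: "k = 0" "M + 1 = 3" using k by simp_all
      have "x 2 \<le> 1 - 14 / 10 * x 1 + 4 / 10 * x 0 + 5 / 100000"
        "1 - 14 / 10 * x 2 + 4 / 10 * x 1 - 5 / 100000 \<le> x 3"
        using A(1)[of 0] A(2)[of 1] 1 by (simp_all add: numeral_eq_Suc)
      then have "x 0 \<le> 8070 / 10000 \<and> 1 - x 2 + 4 / 10 * x 1 \<le> 3229 / 10000"
        using x0 x12 xM[unfolded k0] by linarith
      then show ?thesis unfolding k0 by (simp add: numeral_eq_Suc)
    next
      case 2
      then have k0: "k = 1" "M + 1 = 4" using k by simp_all
      have p: "0 < x 3" using P[of 3] 2 by simp
      have "x 2 \<le> 1 - 14 / 10 * x 1 + 4 / 10 * x 0 + 5 / 100000"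
        "x 3 \<le> 1 - 14 / 10 * x 2 + 4 / 10 * x 1 + 5 / 100000"
        "1 - 14 / 10 * x 2 + 4 / 10 * x 1 - 5 / 100000 \<le> x 3"
        "1 - 14 / 10 * x 3 + 4 / 10 * x 2 - 5 / 100000 \<le> x 4"
        using A(1)[of 0] A[of 1] A(2)[of 2] 2 by (simp_all add: numeral_eq_Suc)
      then have "x 1 \<le> 8070 / 10000 \<and> 1 - x 3 + 4 / 10 * x 2 \<le> 3229 / 10000"
        using x0 x12 p xM[unfolded k0] by linarith
      then show ?thesis unfolding k0 by (simp add: numeral_eq_Suc)
    next
      case 3
      then have k0: "k = 2" "M + 1 = 5" using k by simp_all
      have p: "0 < x 3" "0 < x 4" using P[of 3] P[of 4] 3 by simp_all
      have "x 2 \<le> 1 - 14 / 10 * x 1 + 4 / 10 * x 0 + 5 / 100000"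
        "x 3 \<le> 1 - 14 / 10 * x 2 + 4 / 10 * x 1 + 5 / 100000"
        "1 - 14 / 10 * x 2 + 4 / 10 * x 1 - 5 / 100000 \<le> x 3"
        "x 4 \<le> 1 - 14 / 10 * x 3 + 4 / 10 * x 2 + 5 / 100000"
        "1 - 14 / 10 * x 3 + 4 / 10 * x 2 - 5 / 100000 \<le> x 4"
        "1 - 14 / 10 * x 4 + 4 / 10 * x 3 - 5 / 100000 \<le> x 5"
        using A(1)[of 0] A[of 1] A[of 2] A(2)[of 3] 3 by (simp_all add: numeral_eq_Suc)
      then have "x 2 \<le> 8070 / 10000 \<and> 1 - x 4 + 4 / 10 * x 3 \<le> 3229 / 10000"
        using x0 x12 p xM[unfolded k0] by linarith
      then show ?thesis unfolding k0 by (simp add: numeral_eq_Suc)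
    next
      case 4
      then have k0: "k = 3" "M + 1 = 6" using k by simp_all
      have p: "0 < x 3" "0 < x 4" "0 < x 5" using P[of 3] P[of 4] P[of 5] 4 by simp_all
      have "x 2 \<le> 1 - 14 / 10 * x 1 + 4 / 10 * x 0 + 5 / 100000"
        "x 3 \<le> 1 - 14 / 10 * x 2 + 4 / 10 * x 1 + 5 / 100000"
        "1 - 14 / 10 * x 2 + 4 / 10 * x 1 - 5 / 100000 \<le> x 3"
        "x 4 \<le> 1 - 14 / 10 * x 3 + 4 / 10 * x 2 + 5 / 100000"
        "1 - 14 / 10 * x 3 + 4 / 10 * x 2 - 5 / 100000 \<le> x 4"
        "x 5 \<le> 1 - 14 / 10 * x 4 + 4 / 10 * x 3 + 5 / 100000"
        "1 - 14 / 10 * x 4 + 4 / 10 * x 3 - 5 / 100000 \<le> x 5"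
        "1 - 14 / 10 * x 5 + 4 / 10 * x 4 - 5 / 100000 \<le> x 6"
        using A(1)[of 0] A[of 1] A[of 2] A[of 3] A(2)[of 4] 4 by (simp_all add: numeral_eq_Suc)
      then have "x 3 \<le> 8070 / 10000 \<and> 1 - x 5 + 4 / 10 * x 4 \<le> 3229 / 10000"
        using x0 x12 p xM[unfolded k0] by linarith
      then show ?thesis unfolding k0 by (simp add: numeral_eq_Suc)
    next
      case 5
      define j where "j = M - 6"
      with 5 have 5: "M = j + 6" by simp
      then have k0: "k = j + 4" "M + 1 = j + 7" using k by simp_all
      have p: "0 < x (j + 1)" "0 < x (j + 2)" "0 < x (j + 3)" "0 < x (j + 4)" "0 < x (j + 5)" "0 < x (j + 6)"
        using P 5 by simp_all
      have a: "x (j + 3 + n) \<le> 1 - 14 / 10 * x (j + 2 + n) + 4 / 10 * x (j + 1 + n) + 5 / 100000"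
        "1 - 14 / 10 * x (j + 2 + n) + 4 / 10 * x (j + 1 + n) - 5 / 100000 \<le> x (j + 3 + n)" if "n \<le> 4" for n
      proof -
        have e: "j + 3 + n = j + 1 + n + 2" "j + 2 + n = j + 1 + n + 1" by simp_all
        have c: "j + 1 + n + 1 \<le> M" using that 5 by simp
        show "x (j + 3 + n) \<le> 1 - 14 / 10 * x (j + 2 + n) + 4 / 10 * x (j + 1 + n) + 5 / 100000"
          unfolding e by (rule A(1)[OF c])
        show "1 - 14 / 10 * x (j + 2 + n) + 4 / 10 * x (j + 1 + n) - 5 / 100000 \<le> x (j + 3 + n)"
          unfolding e by (rule A(2)[OF c])
      qed
      have i: "j + 3 + 0 = j + 3" "j + 2 + 0 = j + 2" "j + 1 + 0 = j + 1" "j + 3 + 1 = j + 4" "j + 2 + 1 = j + 3" "j + 1 + 1 = j + 2"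
        "j + 3 + 2 = j + 5" "j + 2 + 2 = j + 4" "j + 1 + 2 = j + 3" "j + 3 + 3 = j + 6" "j + 2 + 3 = j + 5" "j + 1 + 3 = j + 4"
        "j + 3 + 4 = j + 7" "j + 2 + 4 = j + 6" "j + 1 + 4 = j + 5"
        by simp_all
      have a0: "x (j + 2) \<le> 1 - 14 / 10 * x (j + 1) + 4 / 10 * x j + 5 / 100000"
        using A(1)[of j] 5 by simp
      note r = run_exit_bounds[OF p xM[unfolded k0] le1[of j] a0 a[of 0, unfolded i] a[of 1, unfolded i] a[of 2, unfolded i]
        a[of 3, unfolded i] a[of 4, unfolded i]]
      have "x (j + 4) \<le> 8070 / 10000 \<and> 1 - x (j + 6) + 4 / 10 * x (j + 5) \<le> 3229 / 10000"
        using r 5 by simp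
      moreover have "j + 4 + 1 = j + 5" "j + 4 + 2 = j + 6" by simp_all
      ultimately show ?thesis unfolding k0 by (simp add: add.commute)
    qed
  qed
  moreover have "b * x (k + 1) \<le> 4 / 10 * x (k + 1) + 1 / 100000"
    using near_two_fifths_prod_pos(2)[OF b less_imp_le[OF pk(1)]] le1[of "k + 1"] k by linarith
  ultimately have "x k \<le> 8070 / 10000" "1 - x (k + 2) + b * x (k + 1) \<le> 323 / 1000" by linarith+
  then show ?thesis
    using core_after_run[OF b lozi_seq_shift[OF s, of k], unfolded i] pk xM by blast
qed

section \<open>Bounded number of breaks\<close>

lemma run_few_breaks:
  assumes b: "near_two_fifths b" and s: "lozi_seq (1 + b) b x" and x0: "x 0 \<le> 0" and p: "0 < x 1" "0 < x 2"
  shows "few_breaks 11 x"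
proof -
  have i: "x (0 + 1) = x 1" "x (1 + 1) = x 2" by (simp_all add: numeral_eq_Suc)
  show ?thesis
  proof (rule sign_run_cases[of "\<lambda>n. x (n + 1)"])
    assume "\<And>n. (0 < x (n + 1)) = (0 < x (0 + 1))"
    then have "few_breaks 0 (\<lambda>n. x (n + 1))" by (rule few_breaks_constant)
    then show ?thesis by (rule few_breaks_after) simp
  next
    fix m assume m: "\<And>n. n \<le> m \<Longrightarrow> (0 < x (n + 1)) = (0 < x (0 + 1))"
      "(0 < x (m + 1 + 1)) \<noteq> (0 < x (0 + 1))"
    have m0: "m \<noteq> 0"
    proof
      assume "m = 0"
      with m(2) have "(0 < x 2) \<noteq> (0 < x 1)" by (simp add: numeral_2_eq_2)
      then show False using p by blast
    qed
    have P: "0 < x n" if "1 \<le> n" "n \<le> m + 1" for n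
      using m(1)[of "n - 1"] that p unfolding i by simp
    have xM: "x (m + 1 + 1) \<le> 0" using m(2) p unfolding i by simp
    have c: "core b (x (m + 1 + 1)) (x (m + 1 + 2))"
      by (rule run_reaches_core[OF b s x0 _ P xM]) (use m0 in simp_all)
    have j: "0 + (m + 2) = m + 1 + 1" "1 + (m + 2) = m + 1 + 2" by simp_all
    have "few_breaks 8 (\<lambda>n. x (n + (m + 2)))"
      by (rule core_few_breaks[OF b lozi_seq_shift[OF s], of "m + 2", unfolded j, OF c])
    moreover have "(\<lambda>n. x (n + (m + 2))) = (\<lambda>n. x (n + 1 + (m + 1)))"
      by (simp add: numeral_2_eq_2)
    ultimately have "few_breaks 8 (\<lambda>n. x (n + 1 + (m + 1)))" by simp
    then have "few_breaks 9 (\<lambda>n. x (n + (m + 1)))"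
      by (intro few_breaks_after[of 8 "\<lambda>n. x (n + (m + 1))" 1]) simp_all
    moreover have "(\<lambda>n. x (n + (m + 1))) = (\<lambda>n. x (n + m + 1))" by simp
    ultimately have "few_breaks 9 (\<lambda>n. x (n + m + 1))" by simp
    moreover have "(0 < x (n + 1)) = True" if "n \<le> m" for n
      using m(1)[OF that] p(1) unfolding i by blast
    ultimately have "few_breaks (1 + 9) (\<lambda>n. x (n + 1))"
      by (rule few_breaks_constant_prefix[of 9 "\<lambda>n. x (n + 1)" m True])
    then show ?thesis by (rule few_breaks_after) simp
  qed
qed

text \<open>If \<open>LRLR\<close> is followed by \<open>L\<close>, then the signs of \<open>x\<^sub>2\<close> and \<open>x\<^sub>4\<close> bound \<open>e\<close> from both sides by
  \<open>b / (1 + b)\<close>, so the orbit is already in \<open>core\<close>.\<close>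

lemma LRLR_few_breaks:
  assumes b: "near_two_fifths b" and s: "lozi_seq (1 + b) b x"
    and sg: "x 0 \<le> 0" "0 < x 1" "x 2 \<le> 0" "0 < x 3"
  shows "few_breaks 13 x"
proof (cases "0 < x 4")
  case True
  have i: "x (0 + 2) = x 2" "x (1 + 2) = x 3" "x (2 + 2) = x 4" by (simp_all add: numeral_eq_Suc)
  have "few_breaks 11 (\<lambda>n. x (n + 2))"
    by (rule run_few_breaks[OF b lozi_seq_shift[OF s, of 2], unfolded i, OF sg(3,4) True])
  then show ?thesis by (rule few_breaks_after) simp
next
  case False
  then have x4: "x 4 \<le> 0" by simp
  have e2: "x 2 = 1 - x 1 - b * x 1 + b * x 0"
    by (rule lozi_seq_pos[OF s sg(2)]) simp_all
  have e3: "x 3 = 1 + x 2 + b * x 2 + b * x 1"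
    by (rule lozi_seq_neg[OF s sg(3)]) simp_all
  have e4: "x 4 = 1 - x 3 - b * x 3 + b * x 2"
    by (rule lozi_seq_pos[OF s sg(4)]) simp_all
  have e5: "x 5 = 1 + x 4 + b * x 4 + b * x 3"
    by (rule lozi_seq_neg[OF s x4]) simp_all
  define e where "e = x 1 - b * x 0 - 1"
  note p0 = near_two_fifths_prod_neg[OF b sg(1)] and p1 = near_two_fifths_prod_pos[OF b less_imp_le[OF sg(2)]]
    and p2 = near_two_fifths_prod_neg[OF b sg(3)] and p3 = near_two_fifths_prod_pos[OF b less_imp_le[OF sg(4)]]
    and p4 = near_two_fifths_prod_neg[OF b x4]
  have x1: "x 1 \<le> 1 + e" unfolding e_def using p0 sg(1) by linarith
  have x2: "x 2 = - e - b * x 1" unfolding e_def using e2 by linarith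
  have x3: "x 3 = 1 - e + b * x 2" using x2 e3 by linarith
  have x4e: "x 4 = e - b * x 3" using x3 e4 by linarith
  have x5: "x 5 - b * x 4 - 1 = e" using x4e e5 by linarith
  have "- 29 / 100 \<le> e" using x1 x2 p1(2) sg(3) by linarith
  moreover have "e \<le> 29 / 100" using x3 x4e p2 p3(2) sg(3) x4 by linarith
  moreover have "- 8523 / 10000 \<le> x 4"
    using x3 x4e p2(2) p3(2) sg(3) \<open>- 29 / 100 \<le> e\<close> by linarith
  moreover have "0 < x 5" using x5 p4(1) calculation by linarith
  ultimately have c: "core b (x 4) (x 5)" unfolding core_def x5 using x4 by linarith
  have i: "x (0 + 4) = x 4" "x (1 + 4) = x 5" by (simp_all add: numeral_eq_Suc)
  have "few_breaks 8 (\<lambda>n. x (n + 4))"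
    by (rule core_few_breaks[OF b lozi_seq_shift[OF s, of 4], unfolded i, OF c])
  then show ?thesis by (rule few_breaks_after) simp
qed

text \<open>After \<open>LLR\<close> the positive term is at most \<open>1 + (1 + b) x\<^sub>1\<close>, hence so small that two nonpositive terms
  cannot follow it.\<close>

lemma LLR_few_breaks:
  assumes b: "near_two_fifths b" and s: "lozi_seq (1 + b) b x"
    and sg: "x 0 \<le> 0" "x 1 \<le> 0" "0 < x 2"
  shows "few_breaks 13 (\<lambda>n. x (n + 1))"
proof -
  have i: "x (0 + 1) = x 1" "x (1 + 1) = x 2" "x (2 + 1) = x 3" "x (3 + 1) = x 4" by (simp_all add: numeral_eq_Suc)
  note run = run_few_breaks[OF b lozi_seq_shift[OF s, of 1], unfolded i]
  note LRLR = LRLR_few_breaks[OF b lozi_seq_shift[OF s, of 1], unfolded i]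
  show ?thesis
  proof (cases "0 < x 3")
    case True
    then have "few_breaks 11 (\<lambda>n. x (n + 1))" using run sg by blast
    then show ?thesis by (rule few_breaks_mono) simp
  next
    case False
    then have x3: "x 3 \<le> 0" by simp
    have e2: "x 2 = 1 + x 1 + b * x 1 + b * x 0"
      by (rule lozi_seq_neg[OF s sg(2)]) simp_all
    have e3: "x 3 = 1 - x 2 - b * x 2 + b * x 1"
      by (rule lozi_seq_pos[OF s sg(3)]) simp_all
    have e4: "x 4 = 1 + x 3 + b * x 3 + b * x 2"
      by (rule lozi_seq_neg[OF s x3]) simp_all
    note p0 = near_two_fifths_prod_neg[OF b sg(1)] and p1 = near_two_fifths_prod_neg[OF b sg(2)]
      and p2 = near_two_fifths_prod_pos[OF b less_imp_le[OF sg(3)]] and p3 = near_two_fifths_prod_neg[OF b x3]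
    have x2: "x 2 \<le> 1 + 13 / 10 * x 1" using e2 p0(2) p1(2) sg(1,2) by linarith
    have "x 3 \<ge> 1 - 14001 / 10000 * x 2 + 40001 / 100000 * x 1" using e3 p1(1) p2(2) sg by linarith
    then have "0 < x 4" using e4 x2 p2(1) p3(1) sg by linarith
    then show ?thesis using LRLR sg x3 by blast
  qed
qed

text \<open>The code \<open>LRLL\<close> is the only one that leads to a block of several nonpositive terms; that block lasts forever or
  ends with \<open>LLR\<close>.\<close>

lemma LR_few_breaks:
  assumes b: "near_two_fifths b" and s: "lozi_seq (1 + b) b x"
    and sg: "x 0 \<le> 0" "0 < x 1"
  shows "few_breaks 16 x"
proof -
  consider "0 < x 2" | "x 2 \<le> 0" "0 < x 3" | "x 2 \<le> 0" "x 3 \<le> 0" by linarith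
  then show ?thesis
  proof cases
    case 1
    show ?thesis by (rule few_breaks_mono[OF run_few_breaks[OF b s sg 1]]) simp
  next
    case 2
    show ?thesis by (rule few_breaks_mono[OF LRLR_few_breaks[OF b s sg 2]]) simp
  next
    case 3
    have i: "x (0 + 2) = x 2" "x (1 + 2) = x 3" by (simp_all add: numeral_eq_Suc)
    have "few_breaks 14 (\<lambda>n. x (n + 2))"
    proof (rule sign_run_cases[of "\<lambda>n. x (n + 2)"])
      assume "\<And>n. (0 < x (n + 2)) = (0 < x (0 + 2))"
      then show ?thesis by (rule few_breaks_constant)
    next
      fix m assume m: "\<And>n. n \<le> m \<Longrightarrow> (0 < x (n + 2)) = (0 < x (0 + 2))"
        "(0 < x (m + 1 + 2)) \<noteq> (0 < x (0 + 2))"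
      have m0: "m \<noteq> 0"
      proof
        assume "m = 0"
        with m(2) have "(0 < x 3) \<noteq> (0 < x 2)" by (simp add: numeral_eq_Suc)
        then show False using 3 by linarith
      qed
      have neg: "x (n + 2) \<le> 0" if "n \<le> m" for n
        using m(1)[OF that] 3(1) unfolding i by linarith
      have j: "0 + (m + 1) = m - 1 + 2" "1 + (m + 1) = m + 2" "2 + (m + 1) = m + 1 + 2"
        using m0 by simp_all
      have "few_breaks 13 (\<lambda>n. x (n + 1 + (m + 1)))"
        by (rule LLR_few_breaks[OF b lozi_seq_shift[OF s], of "m + 1", unfolded j])
          (use neg[of "m - 1"] neg[of m] m(2) 3(1) i in \<open>simp_all add: not_less\<close>)
      moreover have "(\<lambda>n. x (n + 1 + (m + 1))) = (\<lambda>n. x (n + m + 2))"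
        by (simp add: numeral_2_eq_2)
      ultimately have "few_breaks 13 (\<lambda>n. x (n + m + 2))" by simp
      moreover have "(0 < x (n + 2)) = False" if "n \<le> m" for n
        using neg[OF that] by simp
      ultimately have "few_breaks (1 + 13) (\<lambda>n. x (n + 2))"
        by (rule few_breaks_constant_prefix[of 13 "\<lambda>n. x (n + 2)" m False])
      then show ?thesis by simp
    qed
    then show ?thesis by (rule few_breaks_after) simp
  qed
qed

lemma L_few_breaks:
  assumes b: "near_two_fifths b" and s: "lozi_seq (1 + b) b x" and sg: "x 0 \<le> 0"
  shows "few_breaks 17 x"
proof (rule sign_run_cases[of x])
  assume "\<And>n. (0 < x n) = (0 < x 0)"
  then show ?thesis by (rule few_breaks_constant)
next
  fix m assume m: "\<And>n. n \<le> m \<Longrightarrow> (0 < x n) = (0 < x 0)" "(0 < x (m + 1)) \<noteq> (0 < x 0)"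
  have j: "0 + m = m" "1 + m = m + 1" by simp_all
  have "few_breaks 16 (\<lambda>n. x (n + m))"
    by (rule LR_few_breaks[OF b lozi_seq_shift[OF s], of m, unfolded j])
      (use m(1)[of m] m(2) sg in auto)
  then have "few_breaks (1 + 16) x" using m(1) by (rule few_breaks_constant_prefix)
  then show ?thesis by simp
qed

theorem lozi_few_breaks:
  assumes b: "near_two_fifths b" and s: "lozi_seq (1 + b) b x"
  shows "few_breaks 19 x"
proof (rule sign_run_cases[of x])
  assume "\<And>n. (0 < x n) = (0 < x 0)"
  then show ?thesis by (rule few_breaks_constant)
next
  fix m assume m: "\<And>n. n \<le> m \<Longrightarrow> (0 < x n) = (0 < x 0)" "(0 < x (m + 1)) \<noteq> (0 < x 0)"
  show ?thesis
  proof (cases "x 0 \<le> 0")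
    case True
    show ?thesis by (rule few_breaks_mono[OF L_few_breaks[OF b s True]]) simp
  next
    case False
    then have "x (m + 1) \<le> 0" using m(2) by linarith
    then have "few_breaks 17 (\<lambda>n. x (n + (m + 1)))"
      by (intro L_few_breaks[OF b lozi_seq_shift[OF s]]) simp
    moreover have "(\<lambda>n. x (n + (m + 1))) = (\<lambda>n. x (n + 1 + m))" by (simp add: add.commute)
    ultimately have "few_breaks 17 (\<lambda>n. x (n + 1 + m))" by simp
    then have "few_breaks 18 (\<lambda>n. x (n + m))"
      by (intro few_breaks_after[of 17 "\<lambda>n. x (n + m)" 1]) simp_all
    then have "few_breaks (1 + 18) x" using m(1) by (rule few_breaks_constant_prefix)
    then show ?thesis by simp
  qed
qed

section \<open>Counting words with few changes\<close>

definition changes :: "nat \<Rightarrow> nat \<Rightarrow> nat set \<Rightarrow> nat set" where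
  "changes d n S = {k. k + d < n \<and> (k + d \<in> S) \<noteq> (k \<in> S)}"

lemma card_small_subsets_le: "card {B. B \<subseteq> {..<n} \<and> card B \<le> M} \<le> (n + 1) ^ M" for n :: nat
proof -
  let ?L = "{xs. set xs \<subseteq> {..n} \<and> length xs = M}"
  have "{B. B \<subseteq> {..<n} \<and> card B \<le> M} \<subseteq> (\<lambda>xs. set xs \<inter> {..<n}) ` ?L"
  proof
    fix B assume "B \<in> {B. B \<subseteq> {..<n} \<and> card B \<le> M}"
    then have B: "B \<subseteq> {..<n}" "card B \<le> M" by auto
    then have "finite B" using finite_subset by blast
    then obtain ys where ys: "set ys = B" "distinct ys" using finite_distinct_list by blast
    then have len: "length ys \<le> M" using B(2) distinct_card by fastforce
    \<comment> \<open>The padding letter \<open>n\<close> is outside of \<open>{..<n}\<close>.\<close>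
    let ?xs = "ys @ replicate (M - length ys) n"
    have "set ?xs \<inter> {..<n} = B" using ys B(1) by auto
    moreover have "?xs \<in> ?L" using ys B(1) len by auto
    ultimately show "B \<in> (\<lambda>xs. set xs \<inter> {..<n}) ` ?L" by blast
  qed
  then have "card {B. B \<subseteq> {..<n} \<and> card B \<le> M} \<le> card ?L"
    by (intro surj_card_le) (auto simp: finite_lists_length_eq)
  also have "\<dots> = (n + 1) ^ M" by (subst card_lists_length_eq) auto
  finally show ?thesis .
qed

lemma determined_by_changes:
  assumes "0 < d" "S \<subseteq> {..<n}" "T \<subseteq> {..<n}" "S \<inter> {..<d} = T \<inter> {..<d}" "changes d n S = changes d n T"
  shows "S = T"
proof -
  have "k \<in> S \<longleftrightarrow> k \<in> T" if "k < n" for k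
    using that
  proof (induction k rule: less_induct)
    case (less k)
    show ?case
    proof (cases "k < d")
      case True
      then show ?thesis using assms(4) by blast
    next
      case False
      define j where "j = k - d"
      have j: "k = j + d" using False unfolding j_def by simp
      then have "j \<in> S \<longleftrightarrow> j \<in> T" using less assms(1) by simp
      moreover have "j \<in> changes d n S \<longleftrightarrow> j \<in> changes d n T" using assms(5) by simp
      ultimately show ?thesis using less.prems unfolding changes_def j mem_Collect_eq by blast
    qed
  qed
  then show ?thesis using assms(2,3) by blast
qed

text \<open>A subset of \<open>{..<n}\<close> stands for a word over two letters; its first \<open>d\<close> letters and the changes determine it.\<close>

lemma card_few_changes_le:
  assumes "0 < d"
  shows "card {S. S \<subseteq> {..<n} \<and> card (changes d n S) \<le> M} \<le> 2 ^ d * (n + 1) ^ M"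
proof -
  let ?A = "{S. S \<subseteq> {..<n} \<and> card (changes d n S) \<le> M}"
  let ?B = "Pow {..<d} \<times> {B. B \<subseteq> {..<n} \<and> card B \<le> M}"
  let ?f = "\<lambda>S. (S \<inter> {..<d}, changes d n S)"
  have fin: "finite {B. B \<subseteq> {..<n} \<and> card B \<le> M}"
    by (rule finite_subset[of _ "Pow {..<n}"]) auto
  have "card ?A \<le> card ?B"
  proof (rule card_inj_on_le)
    show "inj_on ?f ?A"
      by (rule inj_onI) (use determined_by_changes[OF assms] in auto)
    show "?f ` ?A \<subseteq> ?B"
      by (auto simp: changes_def)
    show "finite ?B" using fin by simp
  qed
  also have "\<dots> = 2 ^ d * card {B. B \<subseteq> {..<n} \<and> card B \<le> M}"
    by (simp add: card_cartesian_product card_Pow)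
  also have "\<dots> \<le> 2 ^ d * (n + 1) ^ M"
    using card_small_subsets_le by simp
  finally show ?thesis .
qed

section \<open>Affine images of finite planar sets\<close>

definition det2 :: "real \<times> real \<Rightarrow> real \<times> real \<Rightarrow> real" where
  "det2 v w = fst v * snd w - snd v * fst w"

text \<open>Choose a triangle of maximal area with vertices in \<open>U\<close>.  By Cramer's rule the coefficients of any other point are
  quotients of areas of two such triangles.  If all areas vanish, the set lies on a line, and a longest segment does the same.\<close>

lemma spanning_differences:
  fixes U :: "(real \<times> real) set"
  assumes "finite U" "U \<noteq> {}"
  obtains p q\<^sub>1 q\<^sub>2 where "p \<in> U" "q\<^sub>1 \<in> U" "q\<^sub>2 \<in> U"
    "\<And>u. u \<in> U \<Longrightarrow> \<exists>\<alpha> \<beta>. \<bar>\<alpha>\<bar> \<le> 1 \<and> \<bar>\<beta>\<bar> \<le> 1 \<and> u - p = \<alpha> *\<^sub>R (q\<^sub>1 - p) + \<beta> *\<^sub>R (q\<^sub>2 - p)"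
proof -
  define D where "D = (\<lambda>(p, q, r). \<bar>det2 (q - p) (r - p)\<bar>)"
  have finD: "finite (D ` (U \<times> U \<times> U))" "D ` (U \<times> U \<times> U) \<noteq> {}" using assms by auto
  obtain t where t: "t \<in> U \<times> U \<times> U" "Max (D ` (U \<times> U \<times> U)) = D t"
    using Max_in[OF finD] by blast
  obtain p q r where pqr: "t = (p, q, r)" by (cases t)
  have U: "p \<in> U" "q \<in> U" "r \<in> U" using t pqr by auto
  have max: "\<bar>det2 (v - u) (w - u)\<bar> \<le> \<bar>det2 (q - p) (r - p)\<bar>" if "u \<in> U" "v \<in> U" "w \<in> U" for u v w
  proof -
    have "D (u, v, w) \<le> Max (D ` (U \<times> U \<times> U))"
      using that finD(1) by (intro Max_ge) auto
    then show ?thesis using t(2) pqr by (simp add: D_def)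
  qed
  show ?thesis
  proof (cases "det2 (q - p) (r - p) = 0")
    case False
    define d where "d = det2 (q - p) (r - p)"
    have "\<exists>\<alpha> \<beta>. \<bar>\<alpha>\<bar> \<le> 1 \<and> \<bar>\<beta>\<bar> \<le> 1 \<and> u - p = \<alpha> *\<^sub>R (q - p) + \<beta> *\<^sub>R (r - p)" if "u \<in> U" for u
    proof (intro exI conjI)
      have "\<bar>det2 (u - p) (r - p)\<bar> \<le> \<bar>d\<bar>" "\<bar>det2 (q - p) (u - p)\<bar> \<le> \<bar>d\<bar>"
        using max U that unfolding d_def by blast+
      then show "\<bar>det2 (u - p) (r - p) / d\<bar> \<le> 1" "\<bar>det2 (q - p) (u - p) / d\<bar> \<le> 1"
        using False unfolding d_def by (simp_all add: divide_le_eq_1)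
      have "d *\<^sub>R (u - p) = det2 (u - p) (r - p) *\<^sub>R (q - p) + det2 (q - p) (u - p) *\<^sub>R (r - p)"
        unfolding d_def det2_def by (simp add: prod_eq_iff algebra_simps)
      then have "inverse d *\<^sub>R (d *\<^sub>R (u - p)) =
          inverse d *\<^sub>R (det2 (u - p) (r - p) *\<^sub>R (q - p) + det2 (q - p) (u - p) *\<^sub>R (r - p))"
        by simp
      then show "u - p = (det2 (u - p) (r - p) / d) *\<^sub>R (q - p) + (det2 (q - p) (u - p) / d) *\<^sub>R (r - p)"
        using False unfolding d_def by (simp add: scaleR_add_right divide_inverse mult.commute)
    qed
    then show ?thesis using that U by blast
  next
    case True
    define E where "E = (\<lambda>(p, q). dist p (q :: real \<times> real))"
    have finE: "finite (E ` (U \<times> U))" "E ` (U \<times> U) \<noteq> {}" using assms by auto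
    obtain s where s: "s \<in> U \<times> U" "Max (E ` (U \<times> U)) = E s"
      using Max_in[OF finE] by blast
    obtain p' q' where pq: "s = (p', q')" by (cases s)
    have U': "p' \<in> U" "q' \<in> U" using s pq by auto
    have max': "dist u v \<le> dist p' q'" if "u \<in> U" "v \<in> U" for u v
    proof -
      have "E (u, v) \<le> Max (E ` (U \<times> U))"
        using that finE(1) by (intro Max_ge) auto
      then show ?thesis using s(2) pq by (simp add: E_def)
    qed
    have "\<exists>\<alpha> \<beta>. \<bar>\<alpha>\<bar> \<le> 1 \<and> \<bar>\<beta>\<bar> \<le> 1 \<and> u - p' = \<alpha> *\<^sub>R (q' - p') + \<beta> *\<^sub>R (q' - p')" if "u \<in> U" for u
    proof (cases "q' = p'")
      case True
      then have "u = p'" using max'[OF that U'(1)] by simp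
      then show ?thesis by (intro exI[of _ 0]) simp
    next
      case False
      define v w where "v = q' - p'" and "w = u - p'"
      have v: "v \<noteq> 0" using False unfolding v_def by simp
      have "det2 w v = 0" using max[OF U'(1) that U'(2)] True unfolding v_def w_def by simp
      then have "fst w * snd v = snd w * fst v" unfolding det2_def by simp
      then have "(v \<bullet> v) *\<^sub>R w = (w \<bullet> v) *\<^sub>R v"
        by (simp add: prod_eq_iff inner_prod_def algebra_simps)
      then have "inverse (v \<bullet> v) *\<^sub>R ((v \<bullet> v) *\<^sub>R w) = inverse (v \<bullet> v) *\<^sub>R ((w \<bullet> v) *\<^sub>R v)"
        by simp
      then have weq: "w = ((w \<bullet> v) / (v \<bullet> v)) *\<^sub>R v"
        using v by (simp add: divide_inverse mult.commute)
      have "norm w \<le> norm v"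
        using max'[OF that U'(1)] unfolding v_def w_def by (simp add: dist_norm norm_minus_commute)
      then have "norm ((w \<bullet> v) / (v \<bullet> v)) * norm v \<le> 1 * norm v"
        using arg_cong[OF weq, of norm] by simp
      then have "\<bar>(w \<bullet> v) / (v \<bullet> v)\<bar> \<le> 1"
        using v by (simp only: mult_le_cancel_right real_norm_def) simp
      then show ?thesis
        using weq unfolding v_def w_def
        by (intro exI[of _ "(u - p') \<bullet> (q' - p') / ((q' - p') \<bullet> (q' - p'))"] exI[of _ 0]) simp
    qed
    then show ?thesis using that U' by blast
  qed
qed

lemma floor_eq_imp_close:
  fixes \<alpha> \<beta> :: real
  assumes "0 < m" "\<lfloor>\<alpha> * real m\<rfloor> = \<lfloor>\<beta> * real m\<rfloor>"
  shows "\<bar>\<alpha> - \<beta>\<bar> \<le> 1 / real m"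
proof -
  have "\<bar>\<alpha> * real m - \<beta> * real m\<bar> \<le> 1" using assms(2) by linarith
  then have "\<bar>\<alpha> - \<beta>\<bar> * real m \<le> 1" by (simp add: left_diff_distrib[symmetric] abs_mult)
  then show ?thesis using assms(1) by (simp add: pos_le_divide_eq)
qed

text \<open>In the coordinates of \<open>spanning_differences\<close> two of more than \<open>(2 m + 1)\<^sup>2\<close> points differ by at most \<open>1 / m\<close> in
  both coefficients.  Every linear part sends the two spanning vectors to vectors of norm at most \<open>2 B\<close>, so the images of the
  two points stay close for all members of the family at once.\<close>

lemma affine_family_close_pair:
  fixes f :: "'i \<Rightarrow> real \<times> real \<Rightarrow> real \<times> real"
  assumes U: "finite U" "(2 * m + 1)\<^sup>2 < card U" and m: "0 < m" "4 * B \<le> \<delta> * real m"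
    and aff: "\<And>i. i \<in> I \<Longrightarrow> \<exists>g c. linear g \<and> (\<forall>p\<in>U. f i p = g p + c)"
    and bd: "\<And>i p. i \<in> I \<Longrightarrow> p \<in> U \<Longrightarrow> norm (f i p) \<le> B"
  obtains p q where "p \<in> U" "q \<in> U" "p \<noteq> q" "\<And>i. i \<in> I \<Longrightarrow> dist (f i p) (f i q) \<le> \<delta>"
proof -
  have "U \<noteq> {}" using U(2) by auto
  then obtain o' q\<^sub>1 q\<^sub>2 where o: "o' \<in> U" "q\<^sub>1 \<in> U" "q\<^sub>2 \<in> U"
    and ex: "\<And>u. u \<in> U \<Longrightarrow> \<exists>\<alpha> \<beta>. \<bar>\<alpha>\<bar> \<le> 1 \<and> \<bar>\<beta>\<bar> \<le> 1 \<and> u - o' = \<alpha> *\<^sub>R (q\<^sub>1 - o') + \<beta> *\<^sub>R (q\<^sub>2 - o')"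
    using spanning_differences[OF U(1)] by blast
  obtain \<alpha> \<beta> where ab: "\<And>u. u \<in> U \<Longrightarrow> \<bar>\<alpha> u\<bar> \<le> 1 \<and> \<bar>\<beta> u\<bar> \<le> 1 \<and> u - o' = \<alpha> u *\<^sub>R (q\<^sub>1 - o') + \<beta> u *\<^sub>R (q\<^sub>2 - o')"
    using ex by metis
  let ?g = "\<lambda>u. (\<lfloor>\<alpha> u * real m\<rfloor>, \<lfloor>\<beta> u * real m\<rfloor>)"
  let ?K = "{- int m..int m} \<times> {- int m..int m}"
  have range: "\<lfloor>t * real m\<rfloor> \<in> {- int m..int m}" if "\<bar>t\<bar> \<le> 1" for t
  proof -
    have "\<bar>t * real m\<bar> \<le> 1 * real m" unfolding abs_mult using that by (intro mult_mono) auto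
    then have "- real m \<le> t * real m" "t * real m \<le> real m" by auto
    then show ?thesis by (simp add: le_floor_iff floor_le_iff)
  qed
  have "card {- int m..int m} = 2 * m + 1"
    unfolding card_atLeastAtMost_int by linarith
  then have "card ?K = (2 * m + 1)\<^sup>2"
    unfolding card_cartesian_product power2_eq_square by simp
  moreover have "?g ` U \<subseteq> ?K" using ab range by auto
  ultimately have "card (?g ` U) < card U"
    using U(2) card_mono[of ?K "?g ` U"] by simp
  then obtain p q where pq: "p \<in> U" "q \<in> U" "p \<noteq> q" "?g p = ?g q"
    using pigeonhole[of ?g U] by (auto simp: inj_on_def)
  have "dist (f i p) (f i q) \<le> \<delta>" if "i \<in> I" for i
  proof -
    obtain g c where g: "linear g" "\<And>p. p \<in> U \<Longrightarrow> f i p = g p + c" using aff[OF \<open>i \<in> I\<close>] by blast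
    have nd: "norm (g (u - v)) \<le> 2 * B" if "u \<in> U" "v \<in> U" for u v
    proof -
      have "g (u - v) = f i u - f i v" using g that by (simp add: linear_diff)
      then show ?thesis using bd[OF \<open>i \<in> I\<close> that(1)] bd[OF \<open>i \<in> I\<close> that(2)] norm_triangle_ineq4[of "f i u" "f i v"]
        by simp
    qed
    have "p - q = (p - o') - (q - o')" by simp
    also have "\<dots> = (\<alpha> p - \<alpha> q) *\<^sub>R (q\<^sub>1 - o') + (\<beta> p - \<beta> q) *\<^sub>R (q\<^sub>2 - o')"
      using ab[OF pq(1)] ab[OF pq(2)] by (simp add: scaleR_left_diff_distrib)
    finally have "g (p - q) = (\<alpha> p - \<alpha> q) *\<^sub>R g (q\<^sub>1 - o') + (\<beta> p - \<beta> q) *\<^sub>R g (q\<^sub>2 - o')"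
      by (simp only: linear_add[OF g(1)] linear_scale[OF g(1)])
    moreover have "f i p - f i q = g (p - q)" using g(2) pq by (simp add: linear_diff[OF g(1)])
    ultimately have "dist (f i p) (f i q) \<le> \<bar>\<alpha> p - \<alpha> q\<bar> * norm (g (q\<^sub>1 - o')) + \<bar>\<beta> p - \<beta> q\<bar> * norm (g (q\<^sub>2 - o'))"
      unfolding dist_norm by (simp only:) (rule order_trans[OF norm_triangle_ineq], simp)
    also have "\<dots> \<le> (1 / real m) * (2 * B) + (1 / real m) * (2 * B)"
      using floor_eq_imp_close[OF m(1), of "\<alpha> p" "\<alpha> q"] floor_eq_imp_close[OF m(1), of "\<beta> p" "\<beta> q"] pq(4) nd o
      by (intro add_mono mult_mono) auto
    also have "\<dots> = 4 * B / real m" by simp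
    also have "\<dots> \<le> \<delta>" using m by (simp add: pos_divide_le_eq)
    finally show ?thesis .
  qed
  then show ?thesis using that pq by blast
qed


section \<open>Orbits with equal codes and escape to infinity\<close>

definition state_coord :: "real \<Rightarrow> real \<Rightarrow> real \<times> real \<Rightarrow> nat \<Rightarrow> real" where
  "state_coord a b p n = snd ((lozi a b ^^ n) p)"

lemma funpow_lozi: "(lozi a b ^^ n) p = (state_coord a b p (Suc n), state_coord a b p n)"
proof -
  have "fst ((lozi a b ^^ n) p) = snd (lozi a b ((lozi a b ^^ n) p))"
    by (simp add: lozi_def case_prod_beta)
  then show ?thesis by (simp add: state_coord_def prod_eq_iff)
qed

lemma lozi_seq_state_coord: "lozi_seq a b (state_coord a b p)"
  unfolding lozi_seq_def
proof
  fix n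
  have "(lozi a b ^^ Suc n) p = lozi a b (state_coord a b p (Suc n), state_coord a b p n)"
    using funpow_lozi[of n a b p] by simp
  then show "state_coord a b p (n + 2) = 1 - a * \<bar>state_coord a b p (n + 1)\<bar> + b * state_coord a b p n"
    unfolding funpow_lozi by (simp add: lozi_def)
qed

lemma funpow_lozi_affine:
  assumes "\<And>p q j. p \<in> U \<Longrightarrow> q \<in> U \<Longrightarrow> j < n \<Longrightarrow> (state_coord a b p j > 0) = (state_coord a b q j > 0)"
    and "k < n"
  shows "\<exists>g c. linear g \<and> (\<forall>p\<in>U. (lozi a b ^^ k) p = g p + c)"
  using \<open>k < n\<close>
proof (induction k)
  case 0
  have "linear (\<lambda>p::real \<times> real. p)" by (simp add: linear_iff)
  then show ?case by (intro exI[of _ "\<lambda>p. p"] exI[of _ 0]) simp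
next
  case (Suc k)
  then obtain g c where g: "linear g" "\<And>p. p \<in> U \<Longrightarrow> (lozi a b ^^ k) p = g p + c" by auto
  obtain \<sigma> where \<sigma>: "\<And>p. p \<in> U \<Longrightarrow> \<bar>state_coord a b p (Suc k)\<bar> = \<sigma> * state_coord a b p (Suc k)"
  proof (cases "\<exists>p\<in>U. state_coord a b p (Suc k) > 0")
    case True
    then have "state_coord a b p (Suc k) > 0" if "p \<in> U" for p using assms(1) that Suc.prems by blast
    then have "\<bar>state_coord a b p (Suc k)\<bar> = 1 * state_coord a b p (Suc k)" if "p \<in> U" for p
      using that by (metis abs_of_pos mult_1)
    then show ?thesis by (rule that)
  next
    case False
    then have "\<bar>state_coord a b p (Suc k)\<bar> = - 1 * state_coord a b p (Suc k)" if "p \<in> U" for p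
      using that by (metis abs_of_nonpos mult_minus1 not_less)
    then show ?thesis by (rule that)
  qed
  let ?h = "\<lambda>p :: real \<times> real. (- a * \<sigma> * fst p + b * snd p, fst p)"
  have h: "linear ?h" by (auto simp: linear_iff algebra_simps)
  show ?case
  proof (intro exI conjI ballI)
    show "linear (?h \<circ> g)" using g(1) h by (rule linear_compose)
    fix p assume p: "p \<in> U"
    have "(lozi a b ^^ Suc k) p = ?h ((lozi a b ^^ k) p) + (1, 0)"
    proof -
      have "(lozi a b ^^ Suc k) p = lozi a b ((lozi a b ^^ k) p)" by simp
      also have "\<dots> = (1 - a * \<bar>state_coord a b p (Suc k)\<bar> + b * state_coord a b p k, state_coord a b p (Suc k))"
        unfolding funpow_lozi by (simp add: lozi_def)
      finally show ?thesis unfolding funpow_lozi[of k] \<sigma>[OF p] by simp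
    qed
    also have "\<dots> = (?h \<circ> g) p + (?h c + (1, 0))"
      using linear_add[OF h] g(2)[OF p] by simp
    finally show "(lozi a b ^^ Suc k) p = (?h \<circ> g) p + (?h c + (1, 0))" .
  qed
qed

definition in_box :: "real \<Rightarrow> (nat \<Rightarrow> real) \<Rightarrow> nat \<Rightarrow> bool" where
  "in_box R x n \<longleftrightarrow> \<bar>x n\<bar> \<le> R \<and> \<bar>x (Suc n)\<bar> \<le> R"

lemma escape_forever:
  assumes b: "near_two_fifths b" and s: "lozi_seq (1 + b) b x" and R: "10 \<le> R"
    and k: "x k < - R" "x (Suc k) < - R"
  shows "x (Suc k + j) < - R"
proof -
  have "x (k + j) < - R \<and> x (Suc k + j) < - R"
  proof (induction j)
    case 0
    then show ?case using k by simp
  next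
    case (Suc j)
    then have 1: "x (k + j) < - R" "x (Suc k + j) < - R" by auto
    have "x (Suc k + Suc j) = 1 + x (Suc k + j) + b * x (Suc k + j) + b * x (k + j)"
      by (rule lozi_seq_neg[OF s]) (use 1 R in simp_all)
    moreover have "b * x (k + j) \<le> 39999 / 100000 * x (k + j)"
      "b * x (Suc k + j) \<le> 39999 / 100000 * x (Suc k + j)"
      using near_two_fifths_prod_neg(2)[OF b] 1 R by simp_all
    ultimately have "x (Suc k + Suc j) < - R" using 1 R by linarith
    then show ?case using 1 by simp
  qed
  then show ?thesis by simp
qed

text \<open>Since \<open>b < 1\<close>, an orbit can leave the box only through \<open>x\<^sub>k\<^sub>+\<^sub>2 < -R\<close>.  The next terms may be slightly above \<open>-R\<close> once,
  but from \<open>x\<^sub>k\<^sub>+\<^sub>4\<close> on all terms are below it.\<close>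

lemma box_exit_final:
  assumes b: "near_two_fifths b" and s: "lozi_seq (1 + b) b x" and R: "10 \<le> R"
    and k: "in_box R x k" "\<not> in_box R x (Suc k)"
  shows "\<not> in_box R x (Suc k + j)"
proof -
  have i: "\<bar>x k\<bar> \<le> R" "\<bar>x (Suc k)\<bar> \<le> R" "\<not> \<bar>x (k + 2)\<bar> \<le> R"
    using k unfolding in_box_def by auto
  have e2: "x (k + 2) = 1 - (1 + b) * \<bar>x (Suc k)\<bar> + b * x k"
    using s unfolding lozi_seq_def by (metis Suc_eq_plus1)
  have b0: "0 < b" "b < 1" using near_two_fifths_bounds[OF b] .
  have "0 \<le> (1 + b) * \<bar>x (Suc k)\<bar>" using b0 by simp
  moreover have "b * x k \<le> 40001 / 100000 * R"
  proof -
    have "b * x k \<le> b * R" using i b0 by (intro mult_left_mono) auto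
    also have "\<dots> \<le> 40001 / 100000 * R" using near_two_fifths_prod_pos(2)[OF b] R by simp
    finally show ?thesis .
  qed
  ultimately have "x (k + 2) \<le> 1 + 40001 / 100000 * R" using e2 by linarith
  then have x2: "x (k + 2) < - R" using i(3) R by linarith
  have e3: "x (k + 3) = 1 + x (k + 2) + b * x (k + 2) + b * x (k + 1)"
    by (rule lozi_seq_neg[OF s]) (use x2 R in simp_all)
  have "b * x (k + 1) \<le> b * (- x (k + 2))" using i(2) x2 b0 by (intro mult_left_mono) auto
  then have x3: "x (k + 3) \<le> 1 + x (k + 2)" using e3 by (simp add: algebra_simps)
  have e4: "x (k + 4) = 1 + x (k + 3) + b * x (k + 3) + b * x (k + 2)"
    by (rule lozi_seq_neg[OF s]) (use x2 x3 R in simp_all)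
  have p: "b * x (k + 3) \<le> 39999 / 100000 * x (k + 3)" "b * x (k + 2) \<le> 39999 / 100000 * x (k + 2)"
    using near_two_fifths_prod_neg(2)[OF b] x2 x3 R by simp_all
  have x4: "x (k + 4) < - R" using e4 p x2 x3 R by linarith
  have e5: "x (k + 5) = 1 + x (k + 4) + b * x (k + 4) + b * x (k + 3)"
    by (rule lozi_seq_neg[OF s]) (use x4 R in simp_all)
  have x5: "x (k + 5) < - R"
    using e5 p(1) near_two_fifths_prod_neg(2)[OF b, of "x (k + 4)"] x2 x3 x4 R by linarith
  consider "j = 0" | "j = 1" | "j = 2" | i where "j = 3 + i"
    by (metis One_nat_def add_Suc add_0 numeral_2_eq_2 numeral_3_eq_3 not0_implies_Suc)
  then show ?thesis
  proof cases
    case 1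
    then show ?thesis using x2 R unfolding in_box_def by (simp add: numeral_eq_Suc)
  next
    case 2
    then show ?thesis using x2 R unfolding in_box_def by (simp add: numeral_eq_Suc)
  next
    case 3
    then show ?thesis using x4 R unfolding in_box_def by (simp add: numeral_eq_Suc)
  next
    case (4 i)
    have "x (Suc (k + 4) + i) < - R"
      by (rule escape_forever[OF b s R x4]) (use x5 in \<open>simp add: numeral_eq_Suc\<close>)
    then show ?thesis using R 4 unfolding in_box_def by (simp add: numeral_eq_Suc)
  qed
qed

lemma box_exit_permanent:
  assumes b: "near_two_fifths b" and s: "lozi_seq (1 + b) b x" and R: "10 \<le> R"
    and "in_box R x i" "i \<le> k" "\<not> in_box R x k" "k \<le> l"
  shows "\<not> in_box R x l"
proof -
  define m where "m = (LEAST m. i \<le> m \<and> \<not> in_box R x m)"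
  have m: "i \<le> m \<and> \<not> in_box R x m"
    unfolding m_def by (rule LeastI[of _ k]) (use assms in blast)
  have mk: "m \<le> k" unfolding m_def by (rule Least_le) (use assms in blast)
  have "i \<noteq> m" using m assms(4) by blast
  then obtain m' where m': "m = Suc m'" "i \<le> m'" using m by (cases m) auto
  have "\<not> (i \<le> m' \<and> \<not> in_box R x m')"
    using not_less_Least[of m' "\<lambda>m. i \<le> m \<and> \<not> in_box R x m"] m' unfolding m_def by simp
  then have "in_box R x m'" "\<not> in_box R x (Suc m')" using m m' by auto
  from box_exit_final[OF b s R this, of "l - m"] show ?thesis
    using m' mk assms(7) by simp
qed

lemma box_changes_le:
  assumes b: "near_two_fifths b" and s: "lozi_seq (1 + b) b x" and R: "10 \<le> R"
  shows "card (changes 1 n {k. k < n \<and> in_box R x k}) \<le> 2"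
proof -
  let ?A = "{k. in_box R x k \<and> \<not> in_box R x (Suc k)}"
  let ?B = "{k. \<not> in_box R x k \<and> in_box R x (Suc k)}"
  note perm = box_exit_permanent[OF b s R]
  have one: "finite S \<and> card S \<le> 1" if "\<And>i j :: nat. i \<in> S \<Longrightarrow> j \<in> S \<Longrightarrow> i = j" for S
  proof (cases "S = {}")
    case False
    then obtain i where "i \<in> S" by blast
    then have "S = {i}" using that by blast
    then show ?thesis by simp
  qed simp
  have A: "finite ?A \<and> card ?A \<le> 1"
  proof (rule one)
    show "i = j" if "i \<in> ?A" "j \<in> ?A" for i j
      using that perm[of i "Suc i" j] perm[of j "Suc j" i] by (cases i j rule: linorder_cases) auto
  qed
  have B: "finite ?B \<and> card ?B \<le> 1"
  proof (rule one)
    show "i = j" if "i \<in> ?B" "j \<in> ?B" for i j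
      using that perm[of "Suc i" j "Suc j"] perm[of "Suc j" i "Suc i"] by (cases i j rule: linorder_cases) auto
  qed
  have fin: "finite ?A" "finite ?B" "card ?A \<le> 1" "card ?B \<le> 1"
    using A B by blast+
  have "card (changes 1 n {k. k < n \<and> in_box R x k}) \<le> card (?A \<union> ?B)"
  proof (rule card_mono)
    show "finite (?A \<union> ?B)" using fin by blast
    show "changes 1 n {k. k < n \<and> in_box R x k} \<subseteq> ?A \<union> ?B"
      by (auto simp: changes_def)
  qed
  also have "\<dots> \<le> card ?A + card ?B" by (rule card_Un_le)
  finally show ?thesis using fin by linarith
qed

lemma sign_changes_le:
  assumes "near_two_fifths b" "lozi_seq (1 + b) b x"
  shows "card (changes 2 n {k. k < n \<and> x k > 0}) \<le> 19"
proof -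
  have "few_breaks 19 x" by (rule lozi_few_breaks[OF assms])
  moreover have "changes 2 n {k. k < n \<and> x k > 0} \<subseteq> breaks x"
    by (auto simp: changes_def breaks_def)
  ultimately show ?thesis
    unfolding few_breaks_def using card_mono le_trans by blast
qed

section \<open>Separated sets and entropy\<close>

lemma mdist_self: "z \<in> mspace X \<Longrightarrow> mdist X z z = 0"
  by simp

text \<open>A finite cover by sets on which the first \<open>n\<close> iterates vary by less than \<open>\<epsilon>\<close> exists by compactness, and a separated
  set meets each of them in at most one point.\<close>

lemma separated_set_bounded:
  assumes cpt: "compact_space (mtopology_of X)"
    and f: "continuous_map (mtopology_of X) (mtopology_of X) f" and e: "0 < \<epsilon>"
  obtains N where "\<And>U. separated_set X n \<epsilon> f U \<Longrightarrow> finite U \<and> card U \<le> N"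
proof -
  have cont: "continuous_map (mtopology_of X) (mtopology_of X) (f ^^ m)" for m
  proof (induction m)
    case 0
    then show ?case by (simp add: id_def[symmetric])
  next
    case (Suc m)
    then show ?case using continuous_map_compose[OF Suc f] by (simp add: o_def)
  qed
  have in_space: "(f ^^ m) x \<in> mspace X" if "x \<in> mspace X" for m x
    using cont[of m] that unfolding continuous_map_def by auto
  define V where "V x = {y \<in> mspace X. \<forall>m<n. mdist X ((f ^^ m) x) ((f ^^ m) y) < \<epsilon> / 2}" for x
  have opn: "openin (mtopology_of X) (V x)" if x: "x \<in> mspace X" for x
  proof -
    have "openin (mtopology_of X) {y \<in> mspace X. mdist X ((f ^^ m) x) ((f ^^ m) y) \<in> {..<\<epsilon> / 2}}" for m
    proof -
      have "continuous_map (mtopology_of X) euclidean (\<lambda>y. mdist X ((f ^^ m) x) ((f ^^ m) y))"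
        by (intro continuous_map_mdist cont continuous_map_const[THEN iffD2]) (use in_space[OF x] in simp)
      from openin_continuous_map_preimage[OF this, of "{..<\<epsilon> / 2}"] show ?thesis by simp
    qed
    then have "openin (mtopology_of X) (mspace X \<inter> (\<Inter>m<n. {y \<in> mspace X. mdist X ((f ^^ m) x) ((f ^^ m) y) \<in> {..<\<epsilon> / 2}}))"
    proof (cases "n = 0")
      case True
      then show ?thesis using openin_topspace[of "mtopology_of X"] by simp
    next
      case False
      then show ?thesis
        using \<open>\<And>m. openin _ _\<close> openin_topspace[of "mtopology_of X"]
        by (intro openin_Int openin_INT2) auto
    qed
    moreover have "V x = mspace X \<inter> (\<Inter>m<n. {y \<in> mspace X. mdist X ((f ^^ m) x) ((f ^^ m) y) \<in> {..<\<epsilon> / 2}})"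
      unfolding V_def by auto
    ultimately show ?thesis by simp
  qed
  have self: "x \<in> V x" if "x \<in> mspace X" for x
    using that e in_space[OF that] unfolding V_def by (simp add: mdist_self)
  have "compactin (mtopology_of X) (mspace X)" using cpt by (simp add: compact_space_def)
  then obtain \<F> where F: "finite \<F>" "\<F> \<subseteq> V ` mspace X" "mspace X \<subseteq> \<Union>\<F>"
    using compactinD[of "mtopology_of X" "mspace X" "V ` mspace X"] opn self by blast
  have "finite U \<and> card U \<le> card \<F>" if U: "separated_set X n \<epsilon> f U" for U
  proof -
    have sub: "U \<subseteq> mspace X" using U unfolding separated_set_def by blast
    then have "\<forall>u\<in>U. \<exists>W\<in>\<F>. u \<in> W" using F(3) by blast
    then obtain \<phi> where \<phi>: "\<And>u. u \<in> U \<Longrightarrow> \<phi> u \<in> \<F> \<and> u \<in> \<phi> u" by metis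
    have inj: "inj_on \<phi> U"
    proof (rule inj_onI, rule ccontr)
      fix u v assume uv: "u \<in> U" "v \<in> U" "\<phi> u = \<phi> v" "u \<noteq> v"
      then obtain m where m: "m < n" "mdist X ((f ^^ m) u) ((f ^^ m) v) > \<epsilon>"
        using U unfolding separated_set_def by blast
      obtain x where x: "x \<in> mspace X" "\<phi> u = V x" using \<phi>[OF uv(1)] F(2) by blast
      have "u \<in> V x" "v \<in> V x" using \<phi> uv x by metis+
      then have "mdist X ((f ^^ m) x) ((f ^^ m) u) < \<epsilon> / 2" "mdist X ((f ^^ m) x) ((f ^^ m) v) < \<epsilon> / 2"
        using m(1) unfolding V_def by blast+
      then show False
        using m(2) mdist_triangle[of "(f ^^ m) u" X "(f ^^ m) x" "(f ^^ m) v"] in_space x(1) sub uv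
        by (smt (verit) field_sum_of_halves mdist_commute subsetD)
    qed
    have "\<phi> ` U \<subseteq> \<F>" using \<phi> by blast
    then show ?thesis using inj F(1) by (meson card_inj_on_le inj_on_finite)
  qed
  then show ?thesis using that by blast
qed

lemma card_le_max_separated:
  assumes "\<And>U. separated_set X n \<epsilon> f U \<Longrightarrow> card U \<le> N" "separated_set X n \<epsilon> f U"
  shows "card U \<le> max_separated X n \<epsilon> f"
proof -
  have "finite {card U | U. separated_set X n \<epsilon> f U}"
    by (rule finite_subset[of _ "{..N}"]) (use assms(1) in auto)
  then show ?thesis unfolding max_separated_def using assms(2) by (intro Max_ge) auto
qed

lemma max_separated_le:
  assumes "\<And>U. separated_set X n \<epsilon> f U \<Longrightarrow> card U \<le> N"
  shows "max_separated X n \<epsilon> f \<le> N"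
proof -
  have "finite {card U | U. separated_set X n \<epsilon> f U}"
    by (rule finite_subset[of _ "{..N}"]) (use assms(1) in auto)
  moreover have "separated_set X n \<epsilon> f {}" by (simp add: separated_set_def)
  ultimately show ?thesis unfolding max_separated_def using assms by (subst Max_le_iff) auto
qed

lemma one_le_max_separated:
  assumes "\<And>U. separated_set X n \<epsilon> f U \<Longrightarrow> card U \<le> N" "x \<in> mspace X"
  shows "1 \<le> max_separated X n \<epsilon> f"
  using card_le_max_separated[where U = "{x}", OF assms(1)] assms(2) by (simp add: separated_set_def)

lemma entropy_at_scale_polynomial:
  assumes "\<And>n. 1 \<le> max_separated X n \<epsilon> f" "\<And>n. max_separated X n \<epsilon> f \<le> C * (n + 1) ^ M"
  shows "entropy_at_scale X \<epsilon> f = 0"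
proof -
  let ?r = "\<lambda>n. ln (real (max_separated X n \<epsilon> f)) / real n"
  have C: "0 < C" using assms(1,2)[of 0] by (cases C) auto
  have "?r \<longlonglongrightarrow> 0"
  proof (rule tendsto_sandwich[of "\<lambda>_. 0" _ _ "\<lambda>n. (ln (real C) + real M * ln 2) / real n + real M * (ln (real n) / real n)"])
    show "eventually (\<lambda>n. 0 \<le> ?r n) sequentially"
      using assms(1) by (intro always_eventually allI divide_nonneg_nonneg ln_ge_zero) (simp_all add: Suc_leI)
    show "eventually (\<lambda>n. ?r n \<le> (ln (real C) + real M * ln 2) / real n + real M * (ln (real n) / real n)) sequentially"
    proof (rule eventually_sequentiallyI[of 1])
      fix n :: nat assume n: "1 \<le> n"
      have "real (max_separated X n \<epsilon> f) \<le> real (C * (n + 1) ^ M)" using assms(2) of_nat_le_iff by blast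
      also have "\<dots> = real C * (real n + 1) ^ M" by (simp add: add.commute)
      also have "\<dots> \<le> real C * (2 * real n) ^ M"
        using n by (intro mult_left_mono power_mono) simp_all
      finally have "ln (real (max_separated X n \<epsilon> f)) \<le> ln (real C * (2 * real n) ^ M)"
        using assms(1)[of n] by (intro ln_mono) auto
      also have "\<dots> = ln (real C) + real M * (ln 2 + ln (real n))"
        using C n by (simp add: ln_mult ln_realpow distrib_left)
      finally have "ln (real (max_separated X n \<epsilon> f)) / real n \<le> (ln (real C) + real M * (ln 2 + ln (real n))) / real n"
        by (intro divide_right_mono) auto
      then show "?r n \<le> (ln (real C) + real M * ln 2) / real n + real M * (ln (real n) / real n)"
        by (simp add: add_divide_distrib distrib_left)
    qed
    have "(\<lambda>n. (ln (real C) + real M * ln 2) / real n) \<longlonglongrightarrow> 0" by (rule lim_const_over_n)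
    moreover have "(\<lambda>n. ln (real n) / real n) \<longlonglongrightarrow> 0" by (rule lim_ln_over_n)
    ultimately show "(\<lambda>n. (ln (real C) + real M * ln 2) / real n + real M * (ln (real n) / real n)) \<longlonglongrightarrow> 0"
      using tendsto_add tendsto_mult_right_zero by fastforce
  qed simp
  then have "(\<lambda>n. ereal (?r n)) \<longlonglongrightarrow> ereal 0" by simp
  then show ?thesis
    unfolding entropy_at_scale_def by (intro lim_imp_Limsup) (auto simp: zero_ereal_def)
qed

lemma topological_entropy_eq_0:
  assumes "\<And>\<epsilon>. 0 < \<epsilon> \<Longrightarrow> entropy_at_scale X \<epsilon> f = 0"
  shows "topological_entropy X f = 0"
proof -
  have "((\<lambda>\<epsilon>. entropy_at_scale X \<epsilon> f) \<longlongrightarrow> 0) (at_right 0)"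
    using assms by (intro tendsto_eventually) (auto simp: eventually_at_right_field intro: exI[of _ 1])
  then show ?thesis
    unfolding topological_entropy_def by (intro tendsto_Lim) auto
qed

lemma entropy_at_scale_antimono:
  assumes bd: "\<And>n. \<exists>N. \<forall>U. separated_set X n \<delta> f U \<longrightarrow> card U \<le> N"
    and one: "x \<in> mspace X" and le: "\<delta> \<le> \<epsilon>"
  shows "entropy_at_scale X \<epsilon> f \<le> entropy_at_scale X \<delta> f"
proof -
  have "max_separated X n \<epsilon> f \<le> max_separated X n \<delta> f" "1 \<le> max_separated X n \<epsilon> f" for n
  proof -
    obtain N where N: "\<And>U. separated_set X n \<delta> f U \<Longrightarrow> card U \<le> N" using bd by blast
    have sub: "separated_set X n \<delta> f U" if "separated_set X n \<epsilon> f U" for U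
      using that le unfolding separated_set_def by (meson le_less_trans)
    show "max_separated X n \<epsilon> f \<le> max_separated X n \<delta> f"
    proof (rule max_separated_le)
      fix U assume "separated_set X n \<epsilon> f U"
      then show "card U \<le> max_separated X n \<delta> f" using card_le_max_separated[OF N sub] by blast
    qed
    show "1 \<le> max_separated X n \<epsilon> f"
      by (rule one_le_max_separated[OF _ one]) (use N sub in blast)
  qed
  then show ?thesis
    unfolding entropy_at_scale_def
    by (intro Limsup_mono always_eventually allI)
       (auto intro!: divide_right_mono ln_mono simp: Suc_le_eq)
qed

text \<open>The limit in the definition of entropy exists by monotonicity in the scale and is a supremum.\<close>

lemma topological_entropy_ge:
  assumes bd: "\<And>n \<epsilon>. 0 < \<epsilon> \<Longrightarrow> \<exists>N. \<forall>U. separated_set X n \<epsilon> f U \<longrightarrow> card U \<le> N"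
    and one: "x \<in> mspace X" and e: "0 < \<epsilon>\<^sub>0" and h: "h \<le> entropy_at_scale X \<epsilon>\<^sub>0 f"
  shows "h \<le> topological_entropy X f"
proof -
  let ?g = "\<lambda>\<epsilon>. entropy_at_scale X \<epsilon> f"
  let ?S = "SUP \<epsilon>\<in>{0<..}. ?g \<epsilon>"
  have anti: "?g \<epsilon> \<le> ?g \<delta>" if "0 < \<delta>" "\<delta> \<le> \<epsilon>" for \<delta> \<epsilon>
    by (rule entropy_at_scale_antimono[OF bd[OF that(1)] one that(2)])
  have "(?g \<longlongrightarrow> ?S) (at_right 0)"
  proof (rule order_tendstoI)
    fix a assume "a < ?S"
    then obtain \<epsilon>\<^sub>1 where 1: "0 < \<epsilon>\<^sub>1" "a < ?g \<epsilon>\<^sub>1" by (auto simp: less_SUP_iff)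
    then have "\<And>y. 0 < y \<Longrightarrow> y < \<epsilon>\<^sub>1 \<Longrightarrow> a < ?g y" using anti by (meson less_imp_le less_le_trans)
    then show "eventually (\<lambda>y. a < ?g y) (at_right 0)"
      unfolding eventually_at_right_field using 1(1) by blast
  next
    fix a assume "?S < a"
    then have "\<And>y. 0 < y \<Longrightarrow> ?g y < a" by (meson SUP_upper greaterThan_iff le_less_trans)
    then show "eventually (\<lambda>y. ?g y < a) (at_right 0)"
      unfolding eventually_at_right_field by (intro exI[of _ 1]) auto
  qed
  then have "topological_entropy X f = ?S"
    unfolding topological_entropy_def by (intro tendsto_Lim) auto
  moreover have "?g \<epsilon>\<^sub>0 \<le> ?S" using e by (intro SUP_upper) auto
  ultimately show ?thesis using h by simp
qed


section \<open>Zero entropy on the critical line\<close>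

lemma compactified_plane_metric:
  assumes "X \<in> compactified_plane_metrics"
  shows "mspace X = UNIV" "compact_space (mtopology_of X)"
    "b \<noteq> 0 \<Longrightarrow> continuous_map (mtopology_of X) (mtopology_of X) (map_option (lozi a b))"
    "continuous_map euclidean (mtopology_of X) Some"
proof -
  have X: "mtopology_of X = Alexandroff_compactification (euclidean :: (real \<times> real) topology)"
    using assms unfolding compactified_plane_metrics_def by blast
  have "topspace (mtopology_of X) = UNIV"
    unfolding X topspace_Alexandroff_compactification by (simp add: UNIV_option_conv)
  then show "mspace X = UNIV" by simp
  show "compact_space (mtopology_of X)" "continuous_map euclidean (mtopology_of X) Some"
    unfolding X by (simp_all add: continuous_map_Some)
  show "b \<noteq> 0 \<Longrightarrow> continuous_map (mtopology_of X) (mtopology_of X) (map_option (lozi a b))"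
    unfolding X by (rule continuous_map_map_option_lozi)
qed

lemma continuous_on_mdist_Some:
  assumes "X \<in> compactified_plane_metrics"
  shows "continuous_on UNIV (\<lambda>z. mdist X (Some (fst z)) (Some (snd z)))"
proof -
  have "continuous_map euclidean (mtopology_of X) (Some \<circ> fst)"
    "continuous_map euclidean (mtopology_of X) (Some \<circ> snd)"
    by (rule continuous_map_compose[OF _ compactified_plane_metric(4)[OF assms]];
        simp add: continuous_on_fst continuous_on_snd)+
  then have "continuous_map euclidean euclidean (\<lambda>z. mdist X ((Some \<circ> fst) z) ((Some \<circ> snd) z))"
    by (intro continuous_map_mdist)
  then show ?thesis by simp
qed

lemma near_infinity:
  assumes "X \<in> compactified_plane_metrics" "0 < \<epsilon>"
  obtains R where "10 \<le> R" "\<And>x y. \<not> (\<bar>y\<bar> \<le> R \<and> \<bar>x\<bar> \<le> R) \<Longrightarrow> mdist X None (Some (x, y)) < \<epsilon>"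
proof -
  have X: "mtopology_of X = Alexandroff_compactification (euclidean :: (real \<times> real) topology)"
    using assms unfolding compactified_plane_metrics_def by blast
  let ?V = "mball_of X None \<epsilon>"
  have "openin (mtopology_of X) ?V"
    unfolding mtopology_of_def mball_of_def
    by (rule Metric_space.openin_mball) (rule Metric_space_mspace_mdist)
  moreover have "None \<in> ?V" using compactified_plane_metric(1)[OF assms(1)] assms(2) by (simp add: mdist_self)
  ultimately obtain C where C: "compact C" "?V = insert None (Some ` (- C))"
    unfolding X openin_Alexandroff_compactification by (auto simp: Compl_eq_Diff_UNIV)
  obtain B where B: "\<And>z. z \<in> C \<Longrightarrow> norm z \<le> B"
    using compact_imp_bounded[OF C(1)] unfolding bounded_iff by blast
  show ?thesis
  proof (rule that[of "max 10 B"])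
    fix x y assume xy: "\<not> (\<bar>y\<bar> \<le> max 10 B \<and> \<bar>x\<bar> \<le> max 10 B)"
    have "(x, y) \<notin> C"
    proof
      assume "(x, y) \<in> C"
      then have "norm (x, y) \<le> B" by (rule B)
      moreover have "\<bar>x\<bar> \<le> norm (x, y)" "\<bar>y\<bar> \<le> norm (x, y)"
        using norm_fst_le[of x y] norm_snd_le[of y x] by simp_all
      ultimately show False using xy by linarith
    qed
    then have "Some (x, y) \<in> ?V" unfolding C(2) by simp
    then show "mdist X None (Some (x, y)) < \<epsilon>" by simp
  qed simp
qed

lemma uniform_in_box:
  assumes "X \<in> compactified_plane_metrics" "0 < \<epsilon>"
  obtains \<delta> where "0 < \<delta>" "\<And>p q :: real \<times> real. norm p \<le> B \<Longrightarrow> norm q \<le> B \<Longrightarrow> dist p q \<le> \<delta> \<Longrightarrow> mdist X (Some p) (Some q) < \<epsilon>"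
proof -
  let ?K = "cball (0 :: real \<times> real) B \<times> cball (0 :: real \<times> real) B"
  let ?h = "\<lambda>z. mdist X (Some (fst z)) (Some (snd z))"
  have "uniformly_continuous_on ?K ?h"
    by (intro compact_uniformly_continuous compact_Times compact_cball)
      (use continuous_on_mdist_Some[OF assms(1)] continuous_on_subset in blast)
  then obtain d where d: "0 < d" "\<And>z z'. z \<in> ?K \<Longrightarrow> z' \<in> ?K \<Longrightarrow> dist z' z < d \<Longrightarrow> dist (?h z') (?h z) < \<epsilon>"
    using assms(2) unfolding uniformly_continuous_on_def by meson
  show ?thesis
  proof (rule that[of "d / 2"])
    fix p q :: "real \<times> real" assume pq: "norm p \<le> B" "norm q \<le> B" "dist p q \<le> d / 2"
    have "dist (p, q) (p, p) < d" using pq(3) d(1) by (simp add: dist_Pair_Pair dist_commute)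
    then have "dist (?h (p, q)) (?h (p, p)) < \<epsilon>" using pq by (intro d(2)) auto
    then show "mdist X (Some p) (Some q) < \<epsilon>"
      using mdist_self[of "Some p" X] compactified_plane_metric(1)[OF assms(1)] by (simp add: dist_real_def)
  qed (use d(1) in simp)
qed

lemma funpow_map_option:
  fixes f :: "'a \<Rightarrow> 'a"
  shows "(map_option f ^^ n) (Some p) = Some ((f ^^ n) p)"
  by (induction n) simp_all

text \<open>The code of a point records the signs of its first \<open>n\<close> terms and the times at which it is in a box outside of which
  everything is \<open>\<epsilon> / 2\<close>-close to infinity.  There are polynomially many codes, and \<open>affine_family_close_pair\<close> bounds
  the number of separated points with a common code.\<close>

lemma lozi_separated_set_card:
  assumes b: "near_two_fifths b" and X: "X \<in> compactified_plane_metrics" and e: "0 < \<epsilon>"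
  obtains C where "\<And>n U. separated_set X n \<epsilon> (map_option (lozi (1 + b) b)) U \<Longrightarrow> card U \<le> C * (n + 1) ^ 21"
proof -
  let ?L = "lozi (1 + b) b"
  let ?x = "state_coord (1 + b) b"
  obtain R where R: "10 \<le> R" "\<And>x y. \<not> (\<bar>y\<bar> \<le> R \<and> \<bar>x\<bar> \<le> R) \<Longrightarrow> mdist X None (Some (x, y)) < \<epsilon> / 2"
    using near_infinity[OF X, of "\<epsilon> / 2"] e by auto
  obtain \<delta> where d: "0 < \<delta>" "\<And>p q :: real \<times> real. norm p \<le> 2 * R \<Longrightarrow> norm q \<le> 2 * R \<Longrightarrow> dist p q \<le> \<delta> \<Longrightarrow> mdist X (Some p) (Some q) < \<epsilon>"
    using uniform_in_box[OF X e] by metis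
  obtain m :: nat where m: "4 * (2 * R) / \<delta> < real m" using reals_Archimedean2 by blast
  have m0: "0 < m"
  proof -
    have "0 < 4 * (2 * R) / \<delta>" using R(1) d(1) by simp
    then show ?thesis using m by (cases m) auto
  qed
  have md: "4 * (2 * R) \<le> \<delta> * real m" using m d(1) by (simp add: pos_divide_less_eq mult.commute)
  define N where "N = (2 * m + 1)\<^sup>2"
  show ?thesis
  proof (rule that[of "8 * N + 1"])
    fix n U assume U: "separated_set X n \<epsilon> (map_option ?L) U"
    define W where "W = Some -` U"
    define code where "code p = ({k. k < n \<and> ?x p k > 0}, {k. k < n \<and> in_box R (?x p) k})" for p
    define S where "S = {S. S \<subseteq> {..<n} \<and> card (changes 2 n S) \<le> 19}"
    define T where "T = {S. S \<subseteq> {..<n} \<and> card (changes 1 n S) \<le> 2}"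
    have fin: "finite S" "finite T"
      unfolding S_def T_def by (rule finite_subset[of _ "Pow {..<n}"]; auto)+
    have cS: "card S \<le> 4 * (n + 1) ^ 19" and cT: "card T \<le> 2 * (n + 1) ^ 2"
      unfolding S_def T_def using card_few_changes_le[of 2 n 19] card_few_changes_le[of 1 n 2] by simp_all
    have code: "code p \<in> S \<times> T" for p
      using sign_changes_le[OF b lozi_seq_state_coord] box_changes_le[OF b lozi_seq_state_coord R(1)]
      unfolding code_def S_def T_def by auto
    have fibre: "card F \<le> N" if F: "finite F" "F \<subseteq> W" "\<And>p q. p \<in> F \<Longrightarrow> q \<in> F \<Longrightarrow> code p = code q" for F
    proof (rule ccontr)
      assume "\<not> card F \<le> N"
      then have big: "(2 * m + 1)\<^sup>2 < card F" "F \<noteq> {}" unfolding N_def by auto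
      then obtain o' where o: "o' \<in> F" by blast
      have mem: "k < n \<Longrightarrow> (?x p k > 0) = (?x q k > 0)" "k < n \<Longrightarrow> in_box R (?x p) k = in_box R (?x q) k"
        if "p \<in> F" "q \<in> F" for p q k
        using F(3)[OF that] unfolding code_def by blast+
      let ?I = "{k. k < n \<and> in_box R (?x o') k}"
      have bd: "norm ((?L ^^ k) p) \<le> 2 * R" if "k \<in> ?I" "p \<in> F" for k p
      proof -
        have "in_box R (?x p) k" using mem(2)[OF that(2) o] that(1) by blast
        then have "\<bar>?x p k\<bar> \<le> R" "\<bar>?x p (Suc k)\<bar> \<le> R" unfolding in_box_def by auto
        then show ?thesis
          unfolding funpow_lozi using norm_Pair_le[of "?x p (Suc k)" "?x p k"] by simp
      qed
      obtain p q where pq: "p \<in> F" "q \<in> F" "p \<noteq> q" "\<And>k. k \<in> ?I \<Longrightarrow> dist ((?L ^^ k) p) ((?L ^^ k) q) \<le> \<delta>"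
      proof (rule affine_family_close_pair[OF F(1) big(1) m0 md, of ?I "\<lambda>k. ?L ^^ k"])
        show "\<exists>g c. linear g \<and> (\<forall>p\<in>F. (?L ^^ k) p = g p + c)" if "k \<in> ?I" for k
        proof (rule funpow_lozi_affine)
          show "(?x p j > 0) = (?x q j > 0)" if "p \<in> F" "q \<in> F" "j < n" for p q j
            using that by (rule mem(1))
          show "k < n" using that by blast
        qed
      qed (use bd in auto)
      have "mdist X ((map_option ?L ^^ k) (Some p)) ((map_option ?L ^^ k) (Some q)) \<le> \<epsilon>" if "k < n" for k
      proof (cases "k \<in> ?I")
        case True
        then show ?thesis
          unfolding funpow_map_option using d(2) bd pq by (meson less_imp_le)
      next
        case False
        then have "\<not> in_box R (?x p) k" "\<not> in_box R (?x q) k" using mem(2)[OF _ o] pq that by blast+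
        then have "mdist X None (Some ((?L ^^ k) p)) < \<epsilon> / 2" "mdist X None (Some ((?L ^^ k) q)) < \<epsilon> / 2"
          unfolding funpow_lozi in_box_def by (blast intro: R(2))+
        then show ?thesis
          unfolding funpow_map_option
          using mdist_triangle[of "Some ((?L ^^ k) p)" X None "Some ((?L ^^ k) q)"]
            compactified_plane_metric(1)[OF X] mdist_commute[of X None "Some ((?L ^^ k) p)"]
          by simp
      qed
      moreover have "Some p \<in> U" "Some q \<in> U" "Some p \<noteq> Some q"
        using pq F(2) unfolding W_def by auto
      ultimately show False
        using U unfolding separated_set_def by (meson not_less)
    qed
    have cardW: "card F \<le> 8 * N * (n + 1) ^ 21" if F: "finite F" "F \<subseteq> W" for F
    proof -
      have "F = (\<Union>c\<in>S \<times> T. {p \<in> F. code p = c})" using code by blast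
      then have "card F \<le> (\<Sum>c\<in>S \<times> T. card {p \<in> F. code p = c})"
        using card_UN_le[of "S \<times> T" "\<lambda>c. {p \<in> F. code p = c}"] fin by simp
      also have "\<dots> \<le> card (S \<times> T) * N"
        by (rule sum_bounded_above[of _ _ N, simplified]) (use F in \<open>auto intro!: fibre\<close>)
      also have "\<dots> \<le> (4 * (n + 1) ^ 19 * (2 * (n + 1) ^ 2)) * N"
        unfolding card_cartesian_product using cS cT by (intro mult_right_mono mult_mono) auto
      also have "\<dots> = 8 * N * (n + 1) ^ 21"
        by (simp add: power_add[symmetric])
      finally show ?thesis .
    qed
    have one: "1 \<le> (n + 1) ^ 21" by simp
    show "card U \<le> (8 * N + 1) * (n + 1) ^ 21"
    proof (cases "finite U")
      case True
      then have "finite W" unfolding W_def by (intro finite_vimageI) auto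
      have "U \<subseteq> insert None (Some ` W)" unfolding W_def by (auto simp: image_iff)
      then have "card U \<le> card (insert None (Some ` W))" using \<open>finite W\<close> by (intro card_mono) auto
      also have "\<dots> \<le> Suc (card W)" using \<open>finite W\<close> card_image_le[of W Some] by (simp add: card_insert_if)
      also have "\<dots> \<le> 8 * N * (n + 1) ^ 21 + (n + 1) ^ 21"
        using cardW[OF \<open>finite W\<close> order_refl] one by linarith
      finally show ?thesis by (simp add: algebra_simps)
    qed simp
  qed
qed

theorem lozi_entropy_zero:
  assumes b: "near_two_fifths b" and X: "X \<in> compactified_plane_metrics"
  shows "lozi_entropy X (1 + b) b = 0"
  unfolding lozi_entropy_def
proof (rule topological_entropy_eq_0)
  fix \<epsilon> :: real assume "0 < \<epsilon>"
  then obtain C where C: "\<And>n U. separated_set X n \<epsilon> (map_option (lozi (1 + b) b)) U \<Longrightarrow> card U \<le> C * (n + 1) ^ 21"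
    using lozi_separated_set_card[OF b X] by blast
  show "entropy_at_scale X \<epsilon> (map_option (lozi (1 + b) b)) = 0"
  proof (rule entropy_at_scale_polynomial)
    show "1 \<le> max_separated X n \<epsilon> (map_option (lozi (1 + b) b))" for n
      by (rule one_le_max_separated[where x = None, OF C]) (simp_all add: compactified_plane_metric(1)[OF X])
    show "max_separated X n \<epsilon> (map_option (lozi (1 + b) b)) \<le> C * (n + 1) ^ 21" for n
      by (rule max_separated_le[OF C])
  qed
qed

section \<open>Entropy of a golden mean horseshoe\<close>

fun golden :: "bool list \<Rightarrow> bool" where
  "golden (s # t # w) \<longleftrightarrow> (s \<or> t) \<and> golden (t # w)"
| "golden w \<longleftrightarrow> True"

definition golden_words :: "nat \<Rightarrow> bool list set" where
  "golden_words m = {w. length w = m \<and> golden w}"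

lemma finite_golden_words: "finite (golden_words m)"
proof (rule finite_subset)
  show "golden_words m \<subseteq> {w. set w \<subseteq> (UNIV :: bool set) \<and> length w = m}"
    unfolding golden_words_def by auto
qed (rule finite_lists_length_eq, simp)

lemma golden_True_Cons: "golden w \<Longrightarrow> golden (True # w)"
  by (cases w) auto

lemma golden_False_True_Cons: "golden w \<Longrightarrow> golden (False # True # w)"
  by (simp add: golden_True_Cons)

text \<open>Prefixing \<^term>\<open>True\<close> or \<open>False, True\<close> gives the Fibonacci recursion; asking only for \<open>c\<^sup>2 \<le> c + 1\<close> allows a rational
  lower approximation to the golden ratio.\<close>

lemma card_golden_words_ge:
  fixes c :: real
  assumes c: "0 \<le> c" "c \<le> 2" "c\<^sup>2 \<le> c + 1"
  shows "c ^ m \<le> real (card (golden_words m))"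
proof (induction m rule: less_induct)
  case (less m)
  consider "m = 0" | "m = 1" | k where "m = k + 2"
    by (metis One_nat_def add_2_eq_Suc' not0_implies_Suc)
  then show ?case
  proof cases
    case 1
    have "golden_words 0 = {[]}" unfolding golden_words_def by auto
    then show ?thesis using 1 by simp
  next
    case 2
    have "golden_words 1 = {[True], [False]}"
      unfolding golden_words_def by (auto simp: length_Suc_conv)
    then show ?thesis using 2 c by simp
  next
    case (3 k)
    let ?A = "(\<lambda>w. True # w) ` golden_words (k + 1)"
    let ?B = "(\<lambda>w. False # True # w) ` golden_words k"
    have "?A \<union> ?B \<subseteq> golden_words m"
      unfolding golden_words_def 3 by (auto intro: golden_True_Cons simp del: golden.simps(1) intro: golden_False_True_Cons)
    then have "card (?A \<union> ?B) \<le> card (golden_words m)"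
      by (intro card_mono finite_golden_words)
    moreover have "card (?A \<union> ?B) = card ?A + card ?B"
      by (intro card_Un_disjoint finite_imageI finite_golden_words) auto
    moreover have "card ?A = card (golden_words (k + 1))" "card ?B = card (golden_words k)"
      by (simp_all add: card_image inj_on_def)
    ultimately have le: "card (golden_words (k + 1)) + card (golden_words k) \<le> card (golden_words m)" by simp
    have "c ^ m = c\<^sup>2 * c ^ k" unfolding 3 by (simp add: power_add power2_eq_square)
    also have "\<dots> \<le> (c + 1) * c ^ k" using c by (intro mult_right_mono) auto
    also have "\<dots> = c ^ (k + 1) + c ^ k" by (simp add: algebra_simps)
    also have "\<dots> \<le> real (card (golden_words (k + 1))) + real (card (golden_words k))"
      using less.IH[of "k + 1"] less.IH[of k] unfolding 3 by simp
    finally show ?thesis using le by linarith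
  qed
qed

text \<open>The two disjoint compact sets have a positive distance in any metric of the compactification.  Orbits that follow
  different words are separated at this scale, since one of their itineraries is in the first set while the other is in the second.
  The factor \<open>1 / 4\<close> appears because the itineraries are those of the fourth iterate.\<close>

lemma lozi_entropy_ge_ln:
  fixes D :: "bool \<Rightarrow> (real \<times> real) set" and c :: real
  assumes X: "X \<in> compactified_plane_metrics" and b: "b \<noteq> 0"
    and D: "compact (D True)" "compact (D False)" "D True \<inter> D False = {}"
    and orbit: "\<And>w. golden w \<Longrightarrow> \<exists>z. \<forall>i<length w. ((lozi a b ^^ 4) ^^ i) z \<in> D (w ! i)"
    and c: "1 \<le> c" "c \<le> 2" "c\<^sup>2 \<le> c + 1"
  shows "ereal (ln c / 4) \<le> lozi_entropy X a b"
proof -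
  let ?L = "lozi a b" and ?F = "map_option (lozi a b)"
  have ne: "D s \<noteq> {}" for s using orbit[of "[s]"] by auto
  obtain \<epsilon> where e: "0 < \<epsilon>" "\<And>p q. p \<in> D True \<Longrightarrow> q \<in> D False \<Longrightarrow> \<epsilon> < mdist X (Some p) (Some q)"
  proof -
    let ?h = "\<lambda>z. mdist X (Some (fst z)) (Some (snd z))"
    have "compact (D True \<times> D False)" "D True \<times> D False \<noteq> {}"
      using D ne by (auto intro: compact_Times)
    moreover have "continuous_on (D True \<times> D False) ?h"
      by (rule continuous_on_subset[OF continuous_on_mdist_Some[OF X]]) simp
    ultimately have "\<exists>z\<in>D True \<times> D False. \<forall>z'\<in>D True \<times> D False. ?h z \<le> ?h z'"
      by (rule continuous_attains_inf)
    then obtain z where z: "z \<in> D True \<times> D False" "\<And>z'. z' \<in> D True \<times> D False \<Longrightarrow> ?h z \<le> ?h z'"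
      by blast
    have "fst z \<noteq> snd z" using z(1) D(3) by auto
    then have "?h z \<noteq> 0"
      using mdist_zero[of "Some (fst z)" X "Some (snd z)"] compactified_plane_metric(1)[OF X] by simp
    then have pos: "0 < ?h z" using mdist_nonneg[of X "Some (fst z)" "Some (snd z)"] by linarith
    show ?thesis
    proof (rule that[of "?h z / 2"])
      fix p q assume "p \<in> D True" "q \<in> D False"
      then show "?h z / 2 < mdist X (Some p) (Some q)" using z(2)[of "(p, q)"] pos by simp
    qed (use pos in simp)
  qed
  have bounded: "\<exists>N. \<forall>U. separated_set X n \<delta> ?F U \<longrightarrow> card U \<le> N" if "0 < \<delta>" for n \<delta>
    by (rule separated_set_bounded[OF compactified_plane_metric(2)[OF X] compactified_plane_metric(3)[OF X b] that]) blast
  have many: "c ^ m \<le> real (max_separated X (4 * m) \<epsilon> ?F)" for m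
  proof -
    obtain z where z: "\<And>w i. golden w \<Longrightarrow> i < length w \<Longrightarrow> ((?L ^^ 4) ^^ i) (z w) \<in> D (w ! i)"
      using orbit by metis
    have far: "\<exists>k<4 * m. \<epsilon> < mdist X ((?F ^^ k) (Some (z v))) ((?F ^^ k) (Some (z w)))"
      if vw: "v \<in> golden_words m" "w \<in> golden_words m" "v \<noteq> w" for v w
    proof -
      have len: "length v = m" "length w = m" "golden v" "golden w"
        using vw unfolding golden_words_def by auto
      then obtain i where i: "i < m" "v ! i \<noteq> w ! i" using vw(3) nth_equalityI[of v w] by metis
      have "(?L ^^ (4 * i)) (z v) \<in> D (v ! i)" "(?L ^^ (4 * i)) (z w) \<in> D (w ! i)"
        using z[OF len(3), of i] z[OF len(4), of i] i(1) len(1,2) by (simp_all add: funpow_mult mult.commute)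
      then have "\<epsilon> < mdist X (Some ((?L ^^ (4 * i)) (z v))) (Some ((?L ^^ (4 * i)) (z w)))"
        using i(2) e(2) mdist_commute[of X] by (cases "v ! i"; cases "w ! i") (simp_all, metis)
      then show ?thesis unfolding funpow_map_option using i(1) by (intro exI[of _ "4 * i"]) simp
    qed
    let ?U = "(\<lambda>w. Some (z w)) ` golden_words m"
    have inj: "inj_on (\<lambda>w. Some (z w)) (golden_words m)"
    proof (rule inj_onI, rule ccontr)
      fix v w assume vw: "v \<in> golden_words m" "w \<in> golden_words m" "Some (z v) = Some (z w)" "v \<noteq> w"
      then obtain k where "\<epsilon> < mdist X ((?F ^^ k) (Some (z v))) ((?F ^^ k) (Some (z w)))" using far by blast
      then show False
        using vw(3) e(1) mdist_self compactified_plane_metric(1)[OF X] by (metis UNIV_I not_less_iff_gr_or_eq)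
    qed
    have "separated_set X (4 * m) \<epsilon> ?F ?U"
      unfolding separated_set_def compactified_plane_metric(1)[OF X] using far by fastforce
    moreover obtain N where "\<And>U. separated_set X (4 * m) \<epsilon> ?F U \<Longrightarrow> card U \<le> N"
      using bounded[OF e(1)] by blast
    ultimately have "card ?U \<le> max_separated X (4 * m) \<epsilon> ?F" by (intro card_le_max_separated)
    then have "card (golden_words m) \<le> max_separated X (4 * m) \<epsilon> ?F"
      using card_image[OF inj] by simp
    then show ?thesis using card_golden_words_ge[of c m] c by linarith
  qed
  have "ereal (ln c / 4) \<le> limsup ((\<lambda>n. ereal (ln (real (max_separated X n \<epsilon> ?F)) / real n)) \<circ> (\<lambda>m. 4 * (m + 1)))"
  proof (rule le_Limsup, simp, rule always_eventually, rule allI)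
    fix m
    have "ln (c ^ (m + 1)) \<le> ln (real (max_separated X (4 * (m + 1)) \<epsilon> ?F))"
      using c many[of "m + 1"] by (intro ln_mono) auto
    then have "real (m + 1) * ln c \<le> ln (real (max_separated X (4 * (m + 1)) \<epsilon> ?F))"
      using c by (simp only: ln_realpow)
    then have "real (m + 1) * ln c / (4 * real (m + 1)) \<le> ln (real (max_separated X (4 * (m + 1)) \<epsilon> ?F)) / (4 * real (m + 1))"
      by (intro divide_right_mono) auto
    moreover have "real (m + 1) * ln c / (4 * real (m + 1)) = ln c / 4"
    proof -
      have "k * ln c / (4 * k) = ln c / 4" if "k \<noteq> 0" for k :: real
        using that by simp
      moreover have "real (m + 1) \<noteq> 0" by simp
      ultimately show ?thesis by blast
    qed
    moreover have "real (4 * (m + 1)) = 4 * real (m + 1)" by simp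
    ultimately show "ereal (ln c / 4) \<le> ((\<lambda>n. ereal (ln (real (max_separated X n \<epsilon> ?F)) / real n)) \<circ> (\<lambda>m. 4 * (m + 1))) m"
      unfolding o_def ereal_less_eq by metis
  qed
  also have "\<dots> \<le> entropy_at_scale X \<epsilon> ?F"
    unfolding entropy_at_scale_def by (rule limsup_subseq_mono) (simp add: strict_mono_def)
  finally show ?thesis
    unfolding lozi_entropy_def
    by (intro topological_entropy_ge[OF bounded _ e(1)]) (simp_all add: compactified_plane_metric(1)[OF X])
qed

lemma ln_golden_ge: "12030 / 100000 \<le> ln (161803 / 100000 :: real) / 4"
  using ln_approx_bounds[of "161803 / 100000" 4] by (simp add: eval_nat_numeral)

lemma intermediate_on_segment:
  fixes \<alpha> \<beta> l r :: real
  assumes "l < r" "(\<alpha> \<le> l \<and> r \<le> \<beta>) \<or> (\<beta> \<le> l \<and> r \<le> \<alpha>)" "l \<le> v" "v \<le> r"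
  obtains u where "0 \<le> u" "u \<le> 1" "(1 - u) * \<alpha> + u * \<beta> = v"
proof (rule that[of "(v - \<alpha>) / (\<beta> - \<alpha>)"])
  define d where "d = (v - \<alpha>) / (\<beta> - \<alpha>)"
  have "\<beta> - \<alpha> \<noteq> 0" using assms by linarith
  then have "d * (\<beta> - \<alpha>) = v - \<alpha>" unfolding d_def by simp
  then show "(1 - (v - \<alpha>) / (\<beta> - \<alpha>)) * \<alpha> + (v - \<alpha>) / (\<beta> - \<alpha>) * \<beta> = v"
    unfolding d_def[symmetric] by (simp add: algebra_simps)
  show "0 \<le> (v - \<alpha>) / (\<beta> - \<alpha>)" "(v - \<alpha>) / (\<beta> - \<alpha>) \<le> 1"
    using assms by (auto simp: divide_le_eq zero_le_divide_iff)
qed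

text \<open>Each \<open>D s\<close> is a strip between the levels \<open>l s\<close> and \<open>r s\<close> of \<open>y\<close>.  The image of a segment that crosses \<open>D s\<close> contains a
  segment that crosses \<open>D s'\<close> whenever \<open>s s'\<close> is allowed, because \<open>F\<close> is affine on \<open>D s\<close>; the parameter
  of the point sought is found by pulling such subsegments back one at a time.\<close>

lemma golden_itinerary_on_segment:
  fixes F :: "'v::real_vector \<Rightarrow> 'v" and y :: "'v \<Rightarrow> real" and D :: "bool \<Rightarrow> 'v set"
  assumes conv: "\<And>s A B u. A \<in> D s \<Longrightarrow> B \<in> D s \<Longrightarrow> 0 \<le> u \<Longrightarrow> u \<le> 1 \<Longrightarrow> (1 - u) *\<^sub>R A + u *\<^sub>R B \<in> D s"
    and aff: "\<And>s A B u. A \<in> D s \<Longrightarrow> B \<in> D s \<Longrightarrow> 0 \<le> u \<Longrightarrow> u \<le> 1 \<Longrightarrow>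
      F ((1 - u) *\<^sub>R A + u *\<^sub>R B) = (1 - u) *\<^sub>R F A + u *\<^sub>R F B"
    and yaff: "\<And>A B u. y ((1 - u) *\<^sub>R A + u *\<^sub>R B) = (1 - u) * y A + u * y B"
    and lr: "\<And>s. l s < r s"
    and into: "\<And>s s' p. s \<or> s' \<Longrightarrow> p \<in> D s \<Longrightarrow> l s' \<le> y (F p) \<Longrightarrow> y (F p) \<le> r s' \<Longrightarrow> F p \<in> D s'"
    and cross: "\<And>s s' A B. s \<or> s' \<Longrightarrow> A \<in> D s \<Longrightarrow> B \<in> D s \<Longrightarrow> y A = l s \<Longrightarrow> y B = r s \<Longrightarrow>
      (y (F A) \<le> l s' \<and> r s' \<le> y (F B)) \<or> (y (F B) \<le> l s' \<and> r s' \<le> y (F A))"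
    and "golden (s # w)" "A \<in> D s" "B \<in> D s" "y A = l s" "y B = r s"
  shows "\<exists>u. 0 \<le> u \<and> u \<le> 1 \<and> (\<forall>i<length (s # w). (F ^^ i) ((1 - u) *\<^sub>R A + u *\<^sub>R B) \<in> D ((s # w) ! i))"
  using assms(7-)
proof (induction w arbitrary: s A B)
  case Nil
  then show ?case by (intro exI[of _ 0]) simp
next
  case (Cons s' w)
  have ss: "s \<or> s'" and g: "golden (s' # w)" using Cons.prems(1) by auto
  note AB = Cons.prems(2,3)
  let ?P = "\<lambda>u. (1 - u) *\<^sub>R A + u *\<^sub>R B"
  have yF: "y (F (?P u)) = (1 - u) * y (F A) + u * y (F B)" if "0 \<le> u" "u \<le> 1" for u
    unfolding aff[OF AB that] by (rule yaff)
  note c = cross[OF ss AB Cons.prems(4,5)]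
  obtain u where u: "0 \<le> u" "u \<le> 1" "y (F (?P u)) = l s'"
  proof -
    obtain u where "0 \<le> u" "u \<le> 1" "(1 - u) * y (F A) + u * y (F B) = l s'"
      by (rule intermediate_on_segment[OF lr c order_refl less_imp_le[OF lr]])
    then show ?thesis using that yF by metis
  qed
  obtain v where v: "0 \<le> v" "v \<le> 1" "y (F (?P v)) = r s'"
  proof -
    obtain v where "0 \<le> v" "v \<le> 1" "(1 - v) * y (F A) + v * y (F B) = r s'"
      by (rule intermediate_on_segment[OF lr c less_imp_le[OF lr] order_refl])
    then show ?thesis using that yF by metis
  qed
  have PD: "?P u \<in> D s" "?P v \<in> D s" using conv[OF AB] u v by blast+
  have FD: "F (?P u) \<in> D s'" "F (?P v) \<in> D s'"
    using into[OF ss PD(1)] into[OF ss PD(2)] u(3) v(3) less_imp_le[OF lr[of s']] by auto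
  from Cons.IH[OF g FD u(3) v(3)] obtain t where t: "0 \<le> t" "t \<le> 1"
    "\<And>i. i < length (s' # w) \<Longrightarrow> (F ^^ i) ((1 - t) *\<^sub>R F (?P u) + t *\<^sub>R F (?P v)) \<in> D ((s' # w) ! i)" by blast
  define q where "q = (1 - t) * u + t * v"
  have Pq: "(1 - t) *\<^sub>R ?P u + t *\<^sub>R ?P v = ?P q"
    unfolding q_def by (simp add: algebra_simps)
  have q: "0 \<le> q" "q \<le> 1"
    unfolding q_def using u v t convex_bound_le[of u 1 v "1 - t" t] by (auto intro!: add_nonneg_nonneg)
  have Fq: "F (?P q) = (1 - t) *\<^sub>R F (?P u) + t *\<^sub>R F (?P v)"
    using aff[OF PD t(1,2)] unfolding Pq .
  have "(F ^^ i) (?P q) \<in> D ((s # s' # w) ! i)" if "i < length (s # s' # w)" for i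
  proof (cases i)
    case 0
    then show ?thesis using conv[OF AB q] by simp
  next
    case (Suc j)
    then have "j < length (s' # w)" using that by simp
    then show ?thesis using t(3)[of j] Suc unfolding Fq[symmetric] by (simp add: funpow_swap1)
  qed
  then show ?case using q by blast
qed

section \<open>The horseshoe beyond the critical line\<close>

lemma lozi_affine_on_half_plane:
  assumes "\<bar>fst A\<bar> = \<sigma> * fst A" "\<bar>fst B\<bar> = \<sigma> * fst B"
    "\<bar>fst ((1 - u) *\<^sub>R A + u *\<^sub>R B)\<bar> = \<sigma> * fst ((1 - u) *\<^sub>R A + u *\<^sub>R B)"
  shows "lozi a b ((1 - u) *\<^sub>R A + u *\<^sub>R B) = (1 - u) *\<^sub>R lozi a b A + u *\<^sub>R lozi a b B"
proof -
  have form: "lozi a b P = (1 - a * (\<sigma> * fst P) + b * snd P, fst P)" if "\<bar>fst P\<bar> = \<sigma> * fst P" for P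
    using that unfolding lozi_def by (simp add: case_prod_beta)
  show ?thesis
    unfolding form[OF assms(1)] form[OF assms(2)] form[OF assms(3)] by (simp add: algebra_simps)
qed

locale past_threshold =
  fixes b \<epsilon> :: real
  assumes b: "near_two_fifths b" and \<epsilon>: "0 < \<epsilon>" "\<epsilon> \<le> 1 / 100000"
begin

definition a where "a = 1 + b + \<epsilon>"
text \<open>The constants are the coefficients of the return map \<open>lozi a b ^^ 4\<close>, see \<open>return_identities\<close>.  The value \<open>e\<^sub>0\<close> of
  \<open>x - b w - 1\<close> is chosen so that no constant term occurs in the second identity; for \<open>\<epsilon> = 0\<close> it belongs to the end of
  the segment of points of period four.  The step \<open>h\<close> is what then remains as constant term in the first.\<close>

definition \<Delta> where "\<Delta> = 1 + \<epsilon> * (1 + a)"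
definition c\<^sub>0 where "c\<^sub>0 = \<Delta> * b / (b + \<epsilon>)"
definition c\<^sub>1 where "c\<^sub>1 = (1 + \<epsilon>) * b + c\<^sub>0"
definition c\<^sub>2 where "c\<^sub>2 = a * \<Delta>"
definition \<mu> where "\<mu> = a + (b + \<epsilon>) * a * b / \<Delta>"
definition \<nu> where "\<nu> = (b + \<epsilon>) * b^3 / \<Delta>"
definition e\<^sub>0 where "e\<^sub>0 = - ((b + \<epsilon>) * (1 - b^2 / \<Delta>)) / \<mu>"
definition h where "h = \<epsilon> * a + (1 - c\<^sub>0) * e\<^sub>0"

text \<open>A point is \<open>p = (x, w)\<close> with \<open>x = x\<^sub>n\<close> and \<open>w = x\<^sub>n\<^sub>-\<^sub>1\<close>; the two affine coordinates used for it are the term \<open>x\<^sub>n\<^sub>+\<^sub>1\<close>,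
  whose sign tells the side of the fold, and the amount by which \<open>e = x - b w - 1\<close> is below \<open>e\<^sub>0\<close>.\<close>

definition next_x :: "real \<times> real \<Rightarrow> real" where "next_x p = 1 - a * fst p + b * snd p"
definition overshoot :: "real \<times> real \<Rightarrow> real" where "overshoot p = e\<^sub>0 - (fst p - b * snd p - 1)"

lemma b_bounds: "39999 / 100000 \<le> b" "b \<le> 40001 / 100000"
  using b unfolding near_two_fifths_def by blast+

lemma a_bounds: "139999 / 100000 \<le> a" "a \<le> 140002 / 100000"
  using b_bounds \<epsilon> unfolding a_def by linarith+

lemma \<Delta>_bounds: "1 \<le> \<Delta>" "\<Delta> \<le> 1 + 25 / 10 * \<epsilon>" "\<Delta> \<le> 100003 / 100000"
proof -
  have "0 \<le> \<epsilon> * (1 + a)" using \<epsilon> a_bounds by simp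
  moreover have "\<epsilon> * (1 + a) \<le> \<epsilon> * (25 / 10)" using \<epsilon> a_bounds by (intro mult_left_mono) auto
  ultimately show "1 \<le> \<Delta>" "\<Delta> \<le> 1 + 25 / 10 * \<epsilon>" "\<Delta> \<le> 100003 / 100000" using \<epsilon> unfolding \<Delta>_def by linarith+
qed

lemma c\<^sub>0_eq: "1 - c\<^sub>0 = \<epsilon> * ((1 - (1 + a) * b) / (b + \<epsilon>))"
proof -
  have "b + \<epsilon> \<noteq> 0" using b_bounds \<epsilon> by linarith
  then show ?thesis unfolding c\<^sub>0_def \<Delta>_def by (simp add: field_simps)
qed

lemma drift_bounds: "0 \<le> (1 - (1 + a) * b) / (b + \<epsilon>)" "(1 - (1 + a) * b) / (b + \<epsilon>) \<le> 2 / 10"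
proof -
  have "(1 + a) * b \<le> (240002 / 100000) * (40001 / 100000)" "(239999 / 100000) * (39999 / 100000) \<le> (1 + a) * b"
    using a_bounds b_bounds by (intro mult_mono; simp)+
  then have "0 \<le> 1 - (1 + a) * b" "1 - (1 + a) * b \<le> 7 / 100" by simp_all
  moreover have "35 / 100 \<le> b + \<epsilon>" using b_bounds \<epsilon> by simp
  ultimately show "0 \<le> (1 - (1 + a) * b) / (b + \<epsilon>)" "(1 - (1 + a) * b) / (b + \<epsilon>) \<le> 2 / 10"
    by (simp_all add: pos_divide_le_eq)
qed

lemma c\<^sub>0_bounds: "99999 / 100000 \<le> c\<^sub>0" "c\<^sub>0 \<le> 1"
proof -
  have "0 \<le> \<epsilon> * ((1 - (1 + a) * b) / (b + \<epsilon>))"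
    by (rule mult_nonneg_nonneg[OF less_imp_le[OF \<epsilon>(1)] drift_bounds(1)])
  moreover have "\<epsilon> * ((1 - (1 + a) * b) / (b + \<epsilon>)) \<le> (1 / 100000) * (2 / 10)"
    using drift_bounds \<epsilon> by (intro mult_mono) auto
  ultimately show "99999 / 100000 \<le> c\<^sub>0" "c\<^sub>0 \<le> 1" using c\<^sub>0_eq by linarith+
qed

lemma c\<^sub>1_bounds: "1399 / 1000 \<le> c\<^sub>1" "c\<^sub>1 \<le> 1401 / 1000"
proof -
  have "0 \<le> \<epsilon> * b" using b_bounds \<epsilon> by simp
  moreover have "\<epsilon> * b \<le> (1 / 100000) * 1" using b_bounds \<epsilon> by (intro mult_mono) auto
  moreover have "c\<^sub>1 = b + \<epsilon> * b + c\<^sub>0" unfolding c\<^sub>1_def by (simp add: algebra_simps)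
  ultimately show "1399 / 1000 \<le> c\<^sub>1" "c\<^sub>1 \<le> 1401 / 1000"
    using b_bounds c\<^sub>0_bounds by linarith+
qed

lemma c\<^sub>2_bounds: "1399 / 1000 \<le> c\<^sub>2" "c\<^sub>2 \<le> 1401 / 1000"
proof -
  have "(139999 / 100000) * 1 \<le> c\<^sub>2" "c\<^sub>2 \<le> (140002 / 100000) * (100003 / 100000)"
    unfolding c\<^sub>2_def using a_bounds \<Delta>_bounds by (intro mult_mono; simp)+
  then show "1399 / 1000 \<le> c\<^sub>2" "c\<^sub>2 \<le> 1401 / 1000" by simp_all
qed

lemma \<mu>_bounds: "162 / 100 \<le> \<mu>" "\<mu> \<le> 163 / 100"
proof -
  have 1: "(39999 / 100000) * (139999 / 100000) * (39999 / 100000) \<le> (b + \<epsilon>) * a * b"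
    "(b + \<epsilon>) * a * b \<le> (40002 / 100000) * (140002 / 100000) * (40001 / 100000)"
    using a_bounds b_bounds \<epsilon> by (intro mult_mono; simp)+
  have "(b + \<epsilon>) * a * b / \<Delta> \<le> (b + \<epsilon>) * a * b"
    using 1 \<Delta>_bounds by (intro divide_le_eq[THEN iffD2]) (simp add: mult_le_cancel_left1)
  moreover have "223 / 1000 \<le> (b + \<epsilon>) * a * b / \<Delta>"
    using 1 \<Delta>_bounds by (simp add: pos_le_divide_eq)
  ultimately show "162 / 100 \<le> \<mu>" "\<mu> \<le> 163 / 100" using a_bounds 1 unfolding \<mu>_def by linarith+
qed

lemma \<nu>_bounds: "0 \<le> \<nu>" "\<nu> \<le> 258 / 10000"
proof -
  have "(b + \<epsilon>) * b^3 \<le> (40002 / 100000) * (40001 / 100000)^3"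
    using b_bounds \<epsilon> by (intro mult_mono power_mono) auto
  then have 1: "(b + \<epsilon>) * b^3 \<le> 258 / 10000" by (simp add: power3_eq_cube)
  have 0: "0 \<le> (b + \<epsilon>) * b^3" using b_bounds \<epsilon> by simp
  show "0 \<le> \<nu>" unfolding \<nu>_def using 0 \<Delta>_bounds by simp
  have "(b + \<epsilon>) * b^3 / \<Delta> \<le> (b + \<epsilon>) * b^3 / 1" using 0 \<Delta>_bounds by (intro divide_left_mono) auto
  then show "\<nu> \<le> 258 / 10000" unfolding \<nu>_def div_by_1 using 1 by linarith
qed

lemma e\<^sub>0_bounds: "- 21 / 100 \<le> e\<^sub>0" "e\<^sub>0 \<le> - 20 / 100"
proof -
  have b2: "b^2 \<le> 1601 / 10000" "1599 / 10000 \<le> b^2"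
    using power_mono[of b "40001 / 100000" 2] power_mono[of "39999 / 100000" b 2] b_bounds
    by (simp_all add: power2_eq_square)
  have "b^2 / \<Delta> \<le> b^2 / 1" using \<Delta>_bounds by (intro divide_left_mono) auto
  moreover have "1598 / 10000 \<le> b^2 / \<Delta>" using b2 \<Delta>_bounds by (simp add: pos_le_divide_eq)
  moreover define \<rho> where "\<rho> = 1 - b^2 / \<Delta>"
  ultimately have r: "8399 / 10000 \<le> \<rho>" "\<rho> \<le> 8402 / 10000"
    using b2 unfolding div_by_1 by linarith+
  have "(39999 / 100000) * (8399 / 10000) \<le> (b + \<epsilon>) * \<rho>"
    "(b + \<epsilon>) * \<rho> \<le> (40002 / 100000) * (8402 / 10000)"
    using r b_bounds \<epsilon> by (intro mult_mono; simp)+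
  then have "335 / 1000 \<le> (b + \<epsilon>) * \<rho>" "(b + \<epsilon>) * \<rho> \<le> 337 / 1000" by simp_all
  then show "- 21 / 100 \<le> e\<^sub>0" "e\<^sub>0 \<le> - 20 / 100"
    using \<mu>_bounds unfolding e\<^sub>0_def \<rho>_def[symmetric] by (simp_all add: pos_divide_le_eq pos_le_divide_eq)
qed

lemma h_bounds: "0 < h" "h \<le> 2 / 100000"
proof -
  define \<kappa> where "\<kappa> = (1 - (1 + a) * b) / (b + \<epsilon>)"
  have heq: "h = \<epsilon> * (a + \<kappa> * e\<^sub>0)"
    unfolding h_def c\<^sub>0_eq \<kappa>_def[symmetric] by (simp add: algebra_simps)
  have k: "0 \<le> \<kappa>" "\<kappa> \<le> 2 / 10" using drift_bounds unfolding \<kappa>_def by auto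
  have "\<kappa> * (- e\<^sub>0) \<le> (2 / 10) * (21 / 100)" "0 \<le> \<kappa> * (- e\<^sub>0)"
    using k e\<^sub>0_bounds by (intro mult_mono mult_nonneg_nonneg; simp)+
  then have r: "1 \<le> a + \<kappa> * e\<^sub>0" "a + \<kappa> * e\<^sub>0 \<le> 2" using a_bounds by simp_all
  show "0 < h" unfolding heq using r \<epsilon> by simp
  have "\<epsilon> * (a + \<kappa> * e\<^sub>0) \<le> (1 / 100000) * 2" using r \<epsilon> by (intro mult_mono) auto
  then show "h \<le> 2 / 100000" unfolding heq by simp
qed

text \<open>The terms \<open>x\<^sub>2\<close>, \<open>x\<^sub>3\<close>, \<open>x\<^sub>4\<close> follow the codes \<open>RLRL\<close> and \<open>RRRL\<close>, according to the sign of \<open>t\<close>.  Both identities use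
  \<open>e + t = - (b + \<epsilon>) x\<close> to eliminate \<open>x\<close>.  They are homogeneous except for the term \<open>h\<close>, so the dynamics scales with \<open>h\<close>.\<close>

lemma return_identities:
  fixes x w :: real
  defines "t \<equiv> 1 - a * x + b * w"
  defines "x\<^sub>2 \<equiv> 1 - a * \<bar>t\<bar> + b * x"
  defines "x\<^sub>3 \<equiv> 1 - a * x\<^sub>2 + b * t"
  defines "x\<^sub>4 \<equiv> 1 + a * x\<^sub>3 + b * x\<^sub>2"
  shows "overshoot (x\<^sub>4, x\<^sub>3) = c\<^sub>0 * overshoot (x, w) + h - c\<^sub>1 * t - c\<^sub>2 * \<bar>t\<bar>"
    and "next_x (x\<^sub>4, x\<^sub>3) = \<mu> * overshoot (x\<^sub>4, x\<^sub>3) + \<nu> * t"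
proof -
  have nz: "b + \<epsilon> \<noteq> 0" "\<Delta> \<noteq> 0" "\<mu> \<noteq> 0" using b_bounds \<epsilon> \<Delta>_bounds \<mu>_bounds by linarith+
  define e where "e = x - b * w - 1"
  define e' where "e' = x\<^sub>4 - b * x\<^sub>3 - 1"
  have D: "\<Delta> = (1 + \<epsilon>) * a - b" unfolding \<Delta>_def a_def by (simp add: algebra_simps)
  have et: "e + t = - (b + \<epsilon>) * x" unfolding e_def t_def a_def by (simp add: algebra_simps)
  have e'1: "e' = (1 + \<epsilon>) * x\<^sub>3 + b * x\<^sub>2" unfolding e'_def x\<^sub>4_def a_def by (simp add: algebra_simps)
  have "e' = (1 + \<epsilon>) * (1 + b * t) - \<Delta> * x\<^sub>2"
    unfolding e'1 x\<^sub>3_def D by (simp add: algebra_simps)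
  also have "\<dots> = (1 + \<epsilon>) * (1 + b * t) - \<Delta> + c\<^sub>2 * \<bar>t\<bar> - \<Delta> * b * x"
    unfolding x\<^sub>2_def c\<^sub>2_def by (simp add: algebra_simps)
  also have "\<Delta> * b * x = - c\<^sub>0 * (e + t)"
    unfolding et c\<^sub>0_def using nz by (simp add: field_simps)
  finally have e'2: "e' = c\<^sub>0 * e + c\<^sub>1 * t + c\<^sub>2 * \<bar>t\<bar> - \<epsilon> * a"
    unfolding c\<^sub>1_def \<Delta>_def by (simp add: algebra_simps)
  have y: "overshoot (x, w) = e\<^sub>0 - e" "overshoot (x\<^sub>4, x\<^sub>3) = e\<^sub>0 - e'"
    unfolding overshoot_def e_def e'_def by simp_all
  show "overshoot (x\<^sub>4, x\<^sub>3) = c\<^sub>0 * overshoot (x, w) + h - c\<^sub>1 * t - c\<^sub>2 * \<bar>t\<bar>"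
    unfolding y e'2 h_def by (simp add: algebra_simps)
  have "a * e' = \<Delta> * x\<^sub>3 + b * (1 + b * t)"
    unfolding e'1 D x\<^sub>3_def by (simp add: algebra_simps)
  then have x3: "x\<^sub>3 = (a * e' - b - b^2 * t) / \<Delta>"
    using nz by (simp add: field_simps power2_eq_square)
  have "next_x (x\<^sub>4, x\<^sub>3) = - e' - (b + \<epsilon>) * (1 + e' + b * x\<^sub>3)"
    unfolding next_x_def e'_def a_def by (simp add: algebra_simps)
  also have "\<dots> = - \<mu> * e' - (b + \<epsilon>) * (1 - b^2 / \<Delta>) + \<nu> * t"
    unfolding x3 \<mu>_def \<nu>_def a_def using nz by (simp add: field_simps power2_eq_square power3_eq_cube)
  also have "(b + \<epsilon>) * (1 - b^2 / \<Delta>) = - \<mu> * e\<^sub>0"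
    unfolding e\<^sub>0_def using nz by simp
  finally show "next_x (x\<^sub>4, x\<^sub>3) = \<mu> * overshoot (x\<^sub>4, x\<^sub>3) + \<nu> * t"
    unfolding y by (simp add: algebra_simps)
qed

text \<open>For \<^term>\<open>True\<close> the strip is beyond the fold, for \<^term>\<open>False\<close> it is before it.  The lines \<open>next_x p = \<mu> * overshoot p\<close> attract
  the returning orbits, because \<open>\<nu>\<close> is about \<open>b\<^sup>4\<close>; the width \<open>0.045 h\<close> leaves room for the error \<open>\<nu> \<bar>next_x p\<bar>\<close>.\<close>

definition lo :: "bool \<Rightarrow> real" where "lo s = (if s then 5 / 100 * h else - h)"
definition hi :: "bool \<Rightarrow> real" where "hi s = (if s then 65 / 100 * h else - 3 / 10 * h)"
definition strip :: "bool \<Rightarrow> (real \<times> real) set" where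
  "strip s = {p. lo s \<le> overshoot p \<and> overshoot p \<le> hi s \<and> \<bar>next_x p - \<mu> * overshoot p\<bar> \<le> 45 / 1000 * h}"

lemma next_x_affine: "next_x ((1 - u) *\<^sub>R A + u *\<^sub>R B) = (1 - u) * next_x A + u * next_x B"
  unfolding next_x_def by (simp add: algebra_simps)

lemma overshoot_affine: "overshoot ((1 - u) *\<^sub>R A + u *\<^sub>R B) = (1 - u) * overshoot A + u * overshoot B"
  unfolding overshoot_def by (simp add: algebra_simps)

lemma strip_convex:
  assumes "A \<in> strip s" "B \<in> strip s" "0 \<le> u" "u \<le> 1"
  shows "(1 - u) *\<^sub>R A + u *\<^sub>R B \<in> strip s"
proof -
  define z where "z p = next_x p - \<mu> * overshoot p" for p
  have z: "z ((1 - u) *\<^sub>R A + u *\<^sub>R B) = (1 - u) * z A + u * z B"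
    unfolding z_def next_x_affine overshoot_affine by (simp add: algebra_simps)
  have zA: "\<bar>z A\<bar> \<le> 45 / 1000 * h" and zB: "\<bar>z B\<bar> \<le> 45 / 1000 * h"
    using assms(1,2) unfolding strip_def z_def by blast+
  have A: "lo s \<le> overshoot A" "overshoot A \<le> hi s" "z A \<le> 45 / 1000 * h" "- (z A) \<le> 45 / 1000 * h"
    and B: "lo s \<le> overshoot B" "overshoot B \<le> hi s" "z B \<le> 45 / 1000 * h" "- (z B) \<le> 45 / 1000 * h"
    using assms(1,2) zA[THEN abs_le_D1] zA[THEN abs_le_D2] zB[THEN abs_le_D1] zB[THEN abs_le_D2]
    unfolding strip_def by blast+
  have u: "0 \<le> 1 - u" "0 \<le> u" "1 - u + u = 1" using assms(3,4) by simp_all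
  have c: "(1 - u) * k + u * k = k" for k :: real by (simp add: algebra_simps)
  have "lo s \<le> (1 - u) * overshoot A + u * overshoot B"
    using add_mono[OF mult_left_mono[OF A(1) u(1)] mult_left_mono[OF B(1) u(2)]] c[of "lo s"] by linarith
  moreover have "(1 - u) * overshoot A + u * overshoot B \<le> hi s" "(1 - u) * z A + u * z B \<le> 45 / 1000 * h"
      "(1 - u) * - z A + u * - z B \<le> 45 / 1000 * h"
    using convex_bound_le[OF A(2) B(2) u] convex_bound_le[OF A(3) B(3) u] convex_bound_le[OF A(4) B(4) u] by blast+
  ultimately show ?thesis
    unfolding strip_def mem_Collect_eq z_def[symmetric] z overshoot_affine by (intro conjI abs_leI) simp_all
qed

lemma strip_next_x_bounds:
  assumes "p \<in> strip s"
  shows "s \<Longrightarrow> 0 < next_x p" "\<not> s \<Longrightarrow> next_x p < 0" "\<bar>next_x p\<bar> \<le> 1675 / 1000 * h" "\<bar>overshoot p\<bar> \<le> h"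
    "162 / 100 * \<bar>overshoot p\<bar> - 45 / 1000 * h \<le> \<bar>next_x p\<bar>" "\<bar>next_x p\<bar> \<le> 163 / 100 * \<bar>overshoot p\<bar> + 45 / 1000 * h"
proof -
  have p: "lo s \<le> overshoot p" "overshoot p \<le> hi s" "\<bar>next_x p - \<mu> * overshoot p\<bar> \<le> 45 / 1000 * h"
    using assms unfolding strip_def by blast+
  note h = h_bounds
  have m: "0 < \<mu>" using \<mu>_bounds by simp
  have t: "\<mu> * overshoot p - 45 / 1000 * h \<le> next_x p" "next_x p \<le> \<mu> * overshoot p + 45 / 1000 * h"
    using p(3)[THEN abs_le_D1] p(3)[THEN abs_le_D2] by linarith+
  have "(s \<longrightarrow> 0 < next_x p) \<and> (\<not> s \<longrightarrow> next_x p < 0) \<and> \<bar>next_x p\<bar> \<le> 1675 / 1000 * h \<and> \<bar>overshoot p\<bar> \<le> h \<and>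
    162 / 100 * \<bar>overshoot p\<bar> - 45 / 1000 * h \<le> \<bar>next_x p\<bar> \<and> \<bar>next_x p\<bar> \<le> 163 / 100 * \<bar>overshoot p\<bar> + 45 / 1000 * h"
  proof (cases s)
    case True
    then have y: "5 / 100 * h \<le> overshoot p" "overshoot p \<le> 65 / 100 * h" using p unfolding lo_def hi_def by simp_all
    then have y0: "0 < overshoot p" using h by linarith
    have "162 / 100 * overshoot p \<le> \<mu> * overshoot p" "\<mu> * overshoot p \<le> 163 / 100 * overshoot p"
      using \<mu>_bounds y0 by (auto intro!: mult_right_mono)
    then show ?thesis using True t y y0 h(1) by linarith
  next
    case False
    then have y: "- h \<le> overshoot p" "overshoot p \<le> - 3 / 10 * h" using p unfolding lo_def hi_def by simp_all
    then have y0: "overshoot p < 0" using h by linarith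
    have "163 / 100 * overshoot p \<le> \<mu> * overshoot p" "\<mu> * overshoot p \<le> 162 / 100 * overshoot p"
      using \<mu>_bounds y0 by (auto intro!: mult_right_mono_neg)
    then show ?thesis using False t y y0 h(1) by linarith
  qed
  then show "s \<Longrightarrow> 0 < next_x p" "\<not> s \<Longrightarrow> next_x p < 0" "\<bar>next_x p\<bar> \<le> 1675 / 1000 * h" "\<bar>overshoot p\<bar> \<le> h"
    "162 / 100 * \<bar>overshoot p\<bar> - 45 / 1000 * h \<le> \<bar>next_x p\<bar>" "\<bar>next_x p\<bar> \<le> 163 / 100 * \<bar>overshoot p\<bar> + 45 / 1000 * h"
    by blast+
qed

lemma strip_location:
  assumes "p \<in> strip s"
  shows "49 / 100 \<le> fst p" "fst p \<le> 53 / 100" "\<bar>snd p\<bar> \<le> 2"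
proof -
  note t = strip_next_x_bounds(3,4)[OF assms]
  have "(b + \<epsilon>) * fst p = overshoot p - e\<^sub>0 - next_x p"
    unfolding overshoot_def next_x_def a_def by (simp add: algebra_simps)
  then have m: "19 / 100 < (b + \<epsilon>) * fst p" "1999 / 10000 \<le> (b + \<epsilon>) * fst p" "(b + \<epsilon>) * fst p \<le> 2101 / 10000"
    using t h_bounds e\<^sub>0_bounds by linarith+
  have pos: "0 < fst p"
  proof (rule ccontr)
    assume "\<not> 0 < fst p"
    then have "(b + \<epsilon>) * fst p \<le> 0" using b_bounds \<epsilon> by (intro mult_nonneg_nonpos) auto
    then show False using m by linarith
  qed
  have "(b + \<epsilon>) * fst p \<le> (40002 / 100000) * fst p" "(39999 / 100000) * fst p \<le> (b + \<epsilon>) * fst p"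
    using b_bounds \<epsilon> pos by (auto intro!: mult_right_mono)
  then show x: "49 / 100 \<le> fst p" "fst p \<le> 53 / 100" using m by linarith+
  have "b * snd p = fst p - 1 - e\<^sub>0 + overshoot p" unfolding overshoot_def by simp
  then have bw: "\<bar>b * snd p\<bar> \<le> 6 / 10" using x t h_bounds e\<^sub>0_bounds by linarith
  have "(39999 / 100000) * \<bar>snd p\<bar> \<le> b * \<bar>snd p\<bar>" using b_bounds by (intro mult_right_mono) auto
  then show "\<bar>snd p\<bar> \<le> 2" using bw b_bounds by (simp add: abs_mult)
qed

lemma orbit_signs:
  assumes "p \<in> strip s"
  defines "x\<^sub>2 \<equiv> 1 - a * \<bar>next_x p\<bar> + b * fst p"
  defines "x\<^sub>3 \<equiv> 1 - a * x\<^sub>2 + b * next_x p"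
  shows "0 < x\<^sub>2" "x\<^sub>3 < 0"
proof -
  note t = strip_next_x_bounds(3)[OF assms(1)] and x = strip_location(1,2)[OF assms(1)]
  have t': "\<bar>next_x p\<bar> \<le> 1 / 10000" using t h_bounds by linarith
  have "a * \<bar>next_x p\<bar> \<le> 2 * (1 / 10000)" using a_bounds t' by (intro mult_mono) auto
  moreover have "(39999 / 100000) * (49 / 100) \<le> b * fst p"
    using b_bounds x by (intro mult_mono) auto
  moreover have "0 \<le> a * \<bar>next_x p\<bar>" using a_bounds by simp
  ultimately have x2: "119 / 100 \<le> x\<^sub>2" unfolding x\<^sub>2_def by linarith
  then show "0 < x\<^sub>2" by simp
  have "(139999 / 100000) * (119 / 100) \<le> a * x\<^sub>2" using a_bounds x2 by (intro mult_mono) auto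
  moreover have "b * next_x p \<le> 1 * (1 / 10000)"
  proof -
    have "b * next_x p \<le> b * \<bar>next_x p\<bar>" using b_bounds by (intro mult_left_mono) auto
    also have "\<dots> \<le> 1 * (1 / 10000)" using b_bounds t' by (intro mult_mono) auto
    finally show ?thesis .
  qed
  ultimately show "x\<^sub>3 < 0" unfolding x\<^sub>3_def by linarith
qed

abbreviation F :: "real \<times> real \<Rightarrow> real \<times> real" where "F \<equiv> lozi a b ^^ 4"

lemma F_unfold: "F p = lozi a b (lozi a b (lozi a b (lozi a b p)))"
  by (simp add: eval_nat_numeral)

lemma orbit_points:
  assumes "p \<in> strip s"
  defines "x\<^sub>2 \<equiv> 1 - a * \<bar>next_x p\<bar> + b * fst p"
  defines "x\<^sub>3 \<equiv> 1 - a * x\<^sub>2 + b * next_x p"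
  shows "lozi a b p = (next_x p, fst p)" "lozi a b (lozi a b p) = (x\<^sub>2, next_x p)"
    "lozi a b (lozi a b (lozi a b p)) = (x\<^sub>3, x\<^sub>2)" "F p = (1 + a * x\<^sub>3 + b * x\<^sub>2, x\<^sub>3)"
proof -
  have x: "0 < fst p" using strip_location(1)[OF assms(1)] by simp
  have sg: "0 < x\<^sub>2" "x\<^sub>3 < 0" using orbit_signs[OF assms(1)] unfolding x\<^sub>2_def x\<^sub>3_def by blast+
  show 1: "lozi a b p = (next_x p, fst p)" using x unfolding lozi_def next_x_def by (simp add: case_prod_beta)
  show 2: "lozi a b (lozi a b p) = (x\<^sub>2, next_x p)" unfolding 1 by (simp add: lozi_def x\<^sub>2_def)
  show 3: "lozi a b (lozi a b (lozi a b p)) = (x\<^sub>3, x\<^sub>2)" unfolding 2 using sg by (simp add: lozi_def x\<^sub>3_def)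
  show "F p = (1 + a * x\<^sub>3 + b * x\<^sub>2, x\<^sub>3)" unfolding F_unfold 3 using sg by (simp add: lozi_def)
qed

lemma F_coordinates:
  assumes "p \<in> strip s"
  shows "overshoot (F p) = c\<^sub>0 * overshoot p + h - c\<^sub>1 * next_x p - c\<^sub>2 * \<bar>next_x p\<bar>"
    and "next_x (F p) = \<mu> * overshoot (F p) + \<nu> * next_x p"
  unfolding orbit_points(4)[OF assms]
  by (rule return_identities[of "fst p" "snd p", folded next_x_def, unfolded prod.collapse])+

lemma F_affine:
  assumes A: "A \<in> strip s" and B: "B \<in> strip s" and u: "0 \<le> u" "u \<le> 1"
  shows "F ((1 - u) *\<^sub>R A + u *\<^sub>R B) = (1 - u) *\<^sub>R F A + u *\<^sub>R F B"
proof -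
  let ?C = "(1 - u) *\<^sub>R A + u *\<^sub>R B"
  have C: "?C \<in> strip s" by (rule strip_convex[OF assms])
  note oA = orbit_points(1-3)[OF A] and oB = orbit_points(1-3)[OF B] and oC = orbit_points(1-3)[OF C]
  note sA = orbit_signs[OF A] and sB = orbit_signs[OF B] and sC = orbit_signs[OF C]
  have x: "0 < fst A" "0 < fst B" "0 < fst ?C"
    using strip_location(1)[OF A] strip_location(1)[OF B] strip_location(1)[OF C] by linarith+
  have 1: "lozi a b ?C = (1 - u) *\<^sub>R lozi a b A + u *\<^sub>R lozi a b B"
    by (rule lozi_affine_on_half_plane[of _ 1]) (use x in \<open>simp_all only: abs_of_pos mult_1\<close>)
  obtain \<sigma> where \<sigma>: "\<And>p. p \<in> strip s \<Longrightarrow> \<bar>next_x p\<bar> = \<sigma> * next_x p"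
  proof (cases s)
    case True
    then show ?thesis using that[of 1] strip_next_x_bounds(1) by (simp only: abs_of_pos mult_1)
  next
    case False
    then show ?thesis using that[of "- 1"] strip_next_x_bounds(2) by (simp only: abs_of_neg mult_minus1)
  qed
  have "\<bar>fst (lozi a b A)\<bar> = \<sigma> * fst (lozi a b A)" "\<bar>fst (lozi a b B)\<bar> = \<sigma> * fst (lozi a b B)"
    "\<bar>fst (lozi a b ?C)\<bar> = \<sigma> * fst (lozi a b ?C)"
    unfolding oA oB oC fst_conv by (rule \<sigma>[OF A] \<sigma>[OF B] \<sigma>[OF C])+
  from lozi_affine_on_half_plane[OF this(1,2) this(3)[unfolded 1]]
  have 2: "lozi a b (lozi a b ?C) = (1 - u) *\<^sub>R lozi a b (lozi a b A) + u *\<^sub>R lozi a b (lozi a b B)"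
    unfolding 1 .
  have "\<bar>fst (lozi a b (lozi a b A))\<bar> = 1 * fst (lozi a b (lozi a b A))" "\<bar>fst (lozi a b (lozi a b B))\<bar> = 1 * fst (lozi a b (lozi a b B))"
    "\<bar>fst (lozi a b (lozi a b ?C))\<bar> = 1 * fst (lozi a b (lozi a b ?C))"
    unfolding oA(2) oB(2) oC(2) fst_conv mult_1 by (rule abs_of_pos[OF sA(1)] abs_of_pos[OF sB(1)] abs_of_pos[OF sC(1)])+
  from lozi_affine_on_half_plane[OF this(1,2) this(3)[unfolded 2]]
  have 3: "lozi a b (lozi a b (lozi a b ?C)) = (1 - u) *\<^sub>R lozi a b (lozi a b (lozi a b A)) + u *\<^sub>R lozi a b (lozi a b (lozi a b B))"
    unfolding 2 .
  have "\<bar>fst (lozi a b (lozi a b (lozi a b A)))\<bar> = - 1 * fst (lozi a b (lozi a b (lozi a b A)))"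
    "\<bar>fst (lozi a b (lozi a b (lozi a b B)))\<bar> = - 1 * fst (lozi a b (lozi a b (lozi a b B)))"
    "\<bar>fst (lozi a b (lozi a b (lozi a b ?C)))\<bar> = - 1 * fst (lozi a b (lozi a b (lozi a b ?C)))"
    unfolding oA(3) oB(3) oC(3) fst_conv mult_minus1 by (rule abs_of_neg[OF sA(2)] abs_of_neg[OF sB(2)] abs_of_neg[OF sC(2)])+
  from lozi_affine_on_half_plane[OF this(1,2) this(3)[unfolded 3]]
  show ?thesis unfolding F_unfold 3 .
qed

lemma F_into:
  assumes "p \<in> strip s" "lo s' \<le> overshoot (F p)" "overshoot (F p) \<le> hi s'"
  shows "F p \<in> strip s'"
proof -
  have "\<bar>\<nu> * next_x p\<bar> \<le> (258 / 10000) * (1675 / 1000 * h)"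
    unfolding abs_mult using \<nu>_bounds strip_next_x_bounds(3)[OF assms(1)] by (intro mult_mono) auto
  also have "\<dots> \<le> 45 / 1000 * h" using h_bounds by simp
  finally show ?thesis
    using assms(2,3) F_coordinates(2)[OF assms(1)] unfolding strip_def by simp
qed

text \<open>Up to small errors \<open>overshoot (F p)\<close> is \<open>overshoot p + h - 2.8 next_x p\<close> beyond the fold and \<open>overshoot p + h\<close> before it, and
  \<open>next_x p\<close> is \<open>1.62 overshoot p\<close>.\<close>

lemma F_crosses:
  assumes ss: "s \<or> s'" and A: "A \<in> strip s" and B: "B \<in> strip s" and AB: "overshoot A = lo s" "overshoot B = hi s"
  shows "(overshoot (F A) \<le> lo s' \<and> hi s' \<le> overshoot (F B)) \<or> (overshoot (F B) \<le> lo s' \<and> hi s' \<le> overshoot (F A))"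
proof -
  note h = h_bounds(1)
  have prod: "99999 / 100000 * z \<le> c\<^sub>0 * z" "c\<^sub>0 * z \<le> z" "1399 / 1000 * z \<le> c\<^sub>1 * z" "c\<^sub>1 * z \<le> 1401 / 1000 * z"
    "1399 / 1000 * z \<le> c\<^sub>2 * z" "c\<^sub>2 * z \<le> 1401 / 1000 * z" if "0 \<le> z" for z
    using mult_right_mono[OF c\<^sub>0_bounds(1) that] mult_right_mono[OF c\<^sub>0_bounds(2) that]
      mult_right_mono[OF c\<^sub>1_bounds(1) that] mult_right_mono[OF c\<^sub>1_bounds(2) that]
      mult_right_mono[OF c\<^sub>2_bounds(1) that] mult_right_mono[OF c\<^sub>2_bounds(2) that] by simp_all
  note fA = F_coordinates(1)[OF A] and fB = F_coordinates(1)[OF B]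
  note tA = strip_next_x_bounds[OF A] and tB = strip_next_x_bounds[OF B]
  show ?thesis
  proof (cases s)
    case True
    have y: "overshoot A = 5 / 100 * h" "overshoot B = 65 / 100 * h" using AB True unfolding lo_def hi_def by simp_all
    have pos: "0 < next_x A" "0 < next_x B" using tA tB True by auto
    have ya: "overshoot (F A) = c\<^sub>0 * overshoot A + h - c\<^sub>1 * next_x A - c\<^sub>2 * next_x A" "overshoot (F B) = c\<^sub>0 * overshoot B + h - c\<^sub>1 * next_x B - c\<^sub>2 * next_x B"
      using fA fB pos by simp_all
    have "next_x A \<le> 1265 / 10000 * h" using tA(6) y pos h by simp
    then have "65 / 100 * h \<le> overshoot (F A)"
      using ya(1) y prod(1)[of "overshoot A"] prod(4,6)[of "next_x A"] pos h by linarith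
    moreover have "1008 / 1000 * h \<le> next_x B" using tB(5) y pos h by simp
    then have "overshoot (F B) \<le> - h"
      using ya(2) y prod(2)[of "overshoot B"] prod(3,5)[of "next_x B"] pos h by linarith
    ultimately show ?thesis using h unfolding lo_def hi_def by (cases s') simp_all
  next
    case False
    then have s': "s'" using ss by blast
    have y: "overshoot A = - h" "overshoot B = - 3 / 10 * h" using AB False unfolding lo_def hi_def by simp_all
    have neg: "next_x A < 0" "next_x B < 0" using tA(2) tB(2) False by auto
    have ya: "overshoot (F A) = - (c\<^sub>0 * - overshoot A) + h + c\<^sub>1 * - next_x A - c\<^sub>2 * - next_x A" "overshoot (F B) = - (c\<^sub>0 * - overshoot B) + h + c\<^sub>1 * - next_x B - c\<^sub>2 * - next_x B"
      using fA fB neg by simp_all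
    have b: "- next_x A \<le> 1675 / 1000 * h" "- next_x B \<le> 1675 / 1000 * h" using tA(3) tB(3) by linarith+
    have "overshoot (F A) \<le> 5 / 100 * h"
      using ya(1) y prod(1)[of "- overshoot A"] prod(4,5)[of "- next_x A"] neg b(1) h by linarith
    moreover have "65 / 100 * h \<le> overshoot (F B)"
      using ya(2) y prod(2)[of "- overshoot B"] prod(3,6)[of "- next_x B"] neg b(2) h by linarith
    ultimately show ?thesis using s' unfolding lo_def hi_def by simp
  qed
qed

lemma strip_point:
  assumes "lo s \<le> y" "y \<le> hi s"
  obtains p where "p \<in> strip s" "overshoot p = y"
proof -
  define e where "e = e\<^sub>0 - y"
  define x where "x = - (e + \<mu> * y) / (b + \<epsilon>)"
  define w where "w = (x - 1 - e) / b"
  have nz: "b + \<epsilon> \<noteq> 0" "b \<noteq> 0" using b_bounds \<epsilon> by linarith+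
  have bx: "(b + \<epsilon>) * x = - (e + \<mu> * y)" and bw: "b * w = x - 1 - e" unfolding x_def w_def using nz by simp_all
  have "overshoot (x, w) = y" unfolding overshoot_def using bw by (simp add: e_def)
  moreover have "next_x (x, w) = \<mu> * y"
  proof -
    have "next_x (x, w) = - e - (b + \<epsilon>) * x" unfolding next_x_def a_def using bw by (simp add: algebra_simps)
    then show ?thesis unfolding bx by simp
  qed
  ultimately show ?thesis using that[of "(x, w)"] assms h_bounds unfolding strip_def by simp
qed

lemma lo_less_hi: "lo s < hi s"
  using h_bounds unfolding lo_def hi_def by simp

lemma compact_strip: "compact (strip s)"
proof -
  have "continuous_on UNIV overshoot" "continuous_on UNIV next_x"
    unfolding overshoot_def next_x_def by (intro continuous_intros)+
  then have "closed (strip s)"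
    unfolding strip_def by (intro closed_Collect_conj closed_Collect_le continuous_intros)
  moreover have "bounded (strip s)"
    unfolding bounded_iff
  proof (intro exI[of _ 3] ballI)
    fix p assume p: "p \<in> strip s"
    have "norm p \<le> \<bar>fst p\<bar> + \<bar>snd p\<bar>" using norm_Pair_le[of "fst p" "snd p"] by simp
    then show "norm p \<le> 3" using strip_location[OF p] by linarith
  qed
  ultimately show ?thesis by (simp add: compact_eq_bounded_closed)
qed

lemma golden_orbit: "golden w \<Longrightarrow> \<exists>z. \<forall>i<length w. (F ^^ i) z \<in> strip (w ! i)"
proof (cases w)
  case (Cons s v)
  assume g: "golden w"
  obtain A where A: "A \<in> strip s" "overshoot A = lo s"
    by (rule strip_point[OF order_refl less_imp_le[OF lo_less_hi]])
  obtain B where B: "B \<in> strip s" "overshoot B = hi s"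
    by (rule strip_point[OF less_imp_le[OF lo_less_hi] order_refl])
  have "\<exists>u. 0 \<le> u \<and> u \<le> 1 \<and> (\<forall>i<length (s # v). (F ^^ i) ((1 - u) *\<^sub>R A + u *\<^sub>R B) \<in> strip ((s # v) ! i))"
    apply (rule golden_itinerary_on_segment[of strip F overshoot lo hi])
    subgoal by (rule strip_convex)
    subgoal by (rule F_affine)
    subgoal by (rule overshoot_affine)
    subgoal by (rule lo_less_hi)
    subgoal by (rule F_into)
    subgoal by (rule F_crosses)
    using A B g unfolding Cons by blast+
  then show ?thesis unfolding Cons by blast
qed simp

theorem entropy_ge:
  assumes "X \<in> compactified_plane_metrics"
  shows "ereal (12030 / 100000) \<le> lozi_entropy X a b"
proof -
  have "strip True \<inter> strip False = {}"
    using strip_next_x_bounds(1,2) by fastforce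
  then have "ereal (ln (161803 / 100000) / 4) \<le> lozi_entropy X a b"
    using b_bounds golden_orbit
    by (intro lozi_entropy_ge_ln[OF assms _ compact_strip compact_strip]) (auto simp: power2_eq_square)
  then show ?thesis
    by (rule order_trans[rotated]) (use ln_golden_ge in simp)
qed

end

lemma lozi_entropy_on_line:
  assumes "X \<in> compactified_plane_metrics" "\<bar>\<epsilon>\<^sub>2\<bar> < 1 / 100000"
  shows "lozi_entropy X (1.4 + \<epsilon>\<^sub>2) (0.4 + \<epsilon>\<^sub>2) = 0"
proof -
  have "- (1 / 100000) < \<epsilon>\<^sub>2" "\<epsilon>\<^sub>2 < 1 / 100000" using assms(2) by linarith+
  then have "near_two_fifths (0.4 + \<epsilon>\<^sub>2)" unfolding near_two_fifths_def by simp
  moreover have "1 + (0.4 + \<epsilon>\<^sub>2) = 1.4 + \<epsilon>\<^sub>2" by simp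
  ultimately show ?thesis using lozi_entropy_zero[OF _ assms(1), of "0.4 + \<epsilon>\<^sub>2"] by metis
qed

lemma lozi_entropy_past_line:
  assumes "X \<in> compactified_plane_metrics" "\<bar>\<epsilon>\<^sub>2\<bar> < 1 / 100000" "0 < \<epsilon>\<^sub>1" "\<epsilon>\<^sub>1 < 1 / 100000"
  shows "ereal 0.1203 \<le> lozi_entropy X (1.4 + \<epsilon>\<^sub>1 + \<epsilon>\<^sub>2) (0.4 + \<epsilon>\<^sub>2)"
proof -
  have "- (1 / 100000) < \<epsilon>\<^sub>2" "\<epsilon>\<^sub>2 < 1 / 100000" using assms(2) by linarith+
  then interpret past_threshold "0.4 + \<epsilon>\<^sub>2" \<epsilon>\<^sub>1
    by unfold_locales (use assms(3,4) in \<open>simp_all add: near_two_fifths_def\<close>)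
  have "a = 1.4 + \<epsilon>\<^sub>1 + \<epsilon>\<^sub>2" unfolding a_def by simp
  then show ?thesis using entropy_ge[OF assms(1)] by simp
qed

theorem theorem1p2:
  shows "(\<forall>X\<in>compactified_plane_metrics.
            \<not> continuous_on {(a, b). b \<noteq> 0} (\<lambda>(a, b). lozi_entropy X a b)) \<and>
         (\<exists>\<epsilon>\<^sub>s>0. \<forall>X\<in>compactified_plane_metrics. \<forall>\<epsilon>\<^sub>1 \<epsilon>\<^sub>2 :: real.
            0 < \<epsilon>\<^sub>1 \<and> \<epsilon>\<^sub>1 < \<epsilon>\<^sub>s \<and> \<bar>\<epsilon>\<^sub>2\<bar> < \<epsilon>\<^sub>s \<longrightarrow>
              lozi_entropy X (1.4 + \<epsilon>\<^sub>2) (0.4 + \<epsilon>\<^sub>2) = 0 \<and>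
              lozi_entropy X (1.4 + \<epsilon>\<^sub>1 + \<epsilon>\<^sub>2) (0.4 + \<epsilon>\<^sub>2) \<ge> ereal 0.1203)"
proof (intro conjI ballI notI)
  fix X assume X: "X \<in> compactified_plane_metrics"
    and cont: "continuous_on {(a, b). b \<noteq> 0} (\<lambda>(a, b). lozi_entropy X a b)"
  \<comment> \<open>Approach the point \<open>(1.4, 0.4)\<close> of the critical line from the side of positive entropy.\<close>
  define \<delta> :: "nat \<Rightarrow> real" where "\<delta> n = (1 / 200000) / real (Suc n)" for n
  have \<delta>: "0 < \<delta> n" "\<delta> n < 1 / 100000" for n
    unfolding \<delta>_def by (simp_all add: divide_simps)
  have "\<delta> \<longlonglongrightarrow> 0"
    unfolding \<delta>_def by (rule LIMSEQ_Suc[OF lim_const_over_n])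
  then have "(\<lambda>n. (1.4 + \<delta> n, 0.4 :: real)) \<longlonglongrightarrow> (1.4 + 0, 0.4)"
    by (intro tendsto_intros)
  then have "(\<lambda>n. case (1.4 + \<delta> n, 0.4) of (a, b) \<Rightarrow> lozi_entropy X a b) \<longlonglongrightarrow>
      (case (1.4 + 0, 0.4) of (a, b) \<Rightarrow> lozi_entropy X a b)"
    by (rule continuous_on_tendsto_compose[OF cont]) simp_all
  moreover have "ereal 0.1203 \<le> (case (1.4 + \<delta> n, 0.4) of (a, b) \<Rightarrow> lozi_entropy X a b)" for n
    using lozi_entropy_past_line[OF X, of 0 "\<delta> n"] \<delta>[of n] by simp
  ultimately have "ereal 0.1203 \<le> (case (1.4 + 0, 0.4) of (a, b) \<Rightarrow> lozi_entropy X a b)"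
    by (intro LIMSEQ_le_const) auto
  also have "\<dots> = 0" using lozi_entropy_on_line[OF X, of 0] by simp
  finally show False by simp
next
  show "\<exists>\<epsilon>\<^sub>s>0. \<forall>X\<in>compactified_plane_metrics. \<forall>\<epsilon>\<^sub>1 \<epsilon>\<^sub>2 :: real.
      0 < \<epsilon>\<^sub>1 \<and> \<epsilon>\<^sub>1 < \<epsilon>\<^sub>s \<and> \<bar>\<epsilon>\<^sub>2\<bar> < \<epsilon>\<^sub>s \<longrightarrow>
        lozi_entropy X (1.4 + \<epsilon>\<^sub>2) (0.4 + \<epsilon>\<^sub>2) = 0 \<and>
        lozi_entropy X (1.4 + \<epsilon>\<^sub>1 + \<epsilon>\<^sub>2) (0.4 + \<epsilon>\<^sub>2) \<ge> ereal 0.1203"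
    using lozi_entropy_on_line lozi_entropy_past_line
    by (intro exI[of _ "1 / 100000"] conjI[OF _ ballI] allI impI) (simp, blast)
qed

end
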